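(* Let $\phi(s)=\sum_{n\ge1}a(n)\lambda_n^{-s}$ be a Dirichlet series belonging to the class $\mathcal A$ with parameter $r>0$ and dual series $\psi(s)=\sum_{n\ge1}b(n)\mu_n^{-s}$ (see context). Suppose that $b(n)=\overline{a(n)}$ and $\lambda_n=\mu_n$ for all $n$, and that the abscissa of absolute convergence $\sigma_a$ of $\phi$ satisfies $\sigma_a<\frac{r+1}2$. Then, for any fixed $\epsilon>0$, there exists a positive number $T_0(\epsilon)$ such that, for all $T\ge T_0(\epsilon)$, there is a zero $s=\frac r2+i\tau$ ($\tau\in\mathbb R$) of $\phi(s)$ with $$|\tau-T|\le T^{\sigma_a+\frac{1-r}2+\epsilon}.$$
   Context: Hecke pair with parameter $r>0$: $(\lambda_n)_{n\ge1}$, $(\mu_n)_{n\ge1}$ are sequences of positive numbers strictly increasing to $\infty$; $(a(n))_{n\ge1}$, $(b(n))_{n\ge1}$ are complex sequences, not identically zero; $\phi(s)=\sum_{n\ge1}a(n)\lambda_n^{-s}$ and $\psi(s)=\sum_{n\ge1}b(n)\mu_n^{-s}$ have finite abscissas of absolute convergence $\sigma_a$, $\sigma_b$; and there is a meromorphic function $\chi$ on $\mathbb C$ such that (1) $\chi(s)=\Gamma(s)\phi(s)$ for $\mathrm{Re}(s)>\sigma_a$ and $\chi(s)=\Gamma(r-s)\psi(r-s)$ for $\mathrm{Re}(s)<r-\sigma_b$; (2) $\lim_{|\mathrm{Im}(s)|\to\infty}\chi(s)=0$ uniformly in every strip $\sigma_1\le\mathrm{Re}(s)\le\sigma_2$;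 (3) the singularities of $\chi$ are at most poles and are confined to some compact set. Class $\mathcal A$: $\phi$ belongs to $\mathcal A$ (with parameter $r$ and dual series $\psi$) if $(\phi,\psi)$ is a Hecke pair with parameter $r$; $\phi$ and $\psi$ have analytic continuations to $\mathbb C$, analytic except for possible simple poles at $s=r$; and the coefficients are extended to $n=0$ by $a(0):=-\phi(0)$, $b(0):=-\psi(0)$. *)

theory Defs
  imports "HOL-Complex_Analysis.Complex_Analysis"
begin

text \<open>
  All sequences are indexed from 1; the general Dirichlet series of \<open>(a(n), \<lambda>\<^sub>n)\<close> never looks at
  the index 0, which is reserved for the extra coefficient \<open>a(0)\<close> below.
\<close>

definition dirichlet_term ::
  "(nat \<Rightarrow> real) \<Rightarrow> (nat \<Rightarrow> complex) \<Rightarrow> complex \<Rightarrow> nat \<Rightarrow> complex"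
where
  "dirichlet_term lam a s n = a n * of_real (lam n) powr (- s)"

definition dirichlet_sum ::
  "(nat \<Rightarrow> real) \<Rightarrow> (nat \<Rightarrow> complex) \<Rightarrow> complex \<Rightarrow> complex"
where
  "dirichlet_sum lam a s = (\<Sum>n. dirichlet_term lam a s (Suc n))"

definition abs_abscissa :: "(nat \<Rightarrow> real) \<Rightarrow> (nat \<Rightarrow> complex) \<Rightarrow> ereal" where
  "abs_abscissa lam a =
     (INF s\<in>{s. summable (\<lambda>n. norm (dirichlet_term lam a s (Suc n)))}. ereal (Re s))"

definition admissible_exponents :: "(nat \<Rightarrow> real) \<Rightarrow> bool" where
  "admissible_exponents lam \<longleftrightarrow>
     (\<forall>n\<ge>1. lam n > 0) \<and> strict_mono_on {1..} lam \<and> filterlim lam at_top sequentially"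

text \<open>
  The functional equations are required only away from the poles of the Gamma factor: the library
  function \<^const>\<open>Gamma\<close> takes the junk value 0 at the non-positive integers, whereas the equations
  are identities between meromorphic functions. At the excluded points they hold by continuation.
\<close>

definition hecke_pair ::
  "real \<Rightarrow> (nat \<Rightarrow> real) \<Rightarrow> (nat \<Rightarrow> complex) \<Rightarrow> (nat \<Rightarrow> real) \<Rightarrow> (nat \<Rightarrow> complex) \<Rightarrow> bool"
where
  "hecke_pair r lam a mu b \<longleftrightarrow>
     r > 0 \<and>
     admissible_exponents lam \<and> admissible_exponents mu \<and>
     (\<exists>n\<ge>1. a n \<noteq> 0) \<and> (\<exists>n\<ge>1. b n \<noteq> 0) \<and>
     \<bar>abs_abscissa lam a\<bar> \<noteq> \<infinity> \<and> \<bar>abs_abscissa mu b\<bar> \<noteq> \<infinity> \<and>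
     (\<exists>X. X meromorphic_on UNIV \<and>
        (\<forall>s. abs_abscissa lam a < ereal (Re s) \<longrightarrow> s \<notin> \<int>\<^sub>\<le>\<^sub>0 \<longrightarrow>
             X s = Gamma s * dirichlet_sum lam a s) \<and>
        (\<forall>s. ereal (Re s) < ereal r - abs_abscissa mu b \<longrightarrow> of_real r - s \<notin> \<int>\<^sub>\<le>\<^sub>0 \<longrightarrow>
             X s = Gamma (of_real r - s) * dirichlet_sum mu b (of_real r - s)) \<and>
        (\<forall>\<sigma>1 \<sigma>2. \<forall>e>0. \<exists>B. \<forall>s. \<sigma>1 \<le> Re s \<and> Re s \<le> \<sigma>2 \<and> B \<le> \<bar>Im s\<bar> \<longrightarrow> norm (X s) < e) \<and>
        (\<exists>K. compact K \<and> X analytic_on (- K)))"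

text \<open>
  \<open>F\<close> is the continuation of the Dirichlet series to the whole plane, analytic except for a possible
  simple pole at \<open>r\<close>. If there is a pole, the value \<open>F r\<close> is arbitrary; everywhere else \<open>F\<close> is
  uniquely determined by the series.
\<close>

definition dirichlet_continuation ::
  "real \<Rightarrow> (nat \<Rightarrow> real) \<Rightarrow> (nat \<Rightarrow> complex) \<Rightarrow> (complex \<Rightarrow> complex) \<Rightarrow> bool"
where
  "dirichlet_continuation r lam a F \<longleftrightarrow>
     (\<forall>s. abs_abscissa lam a < ereal (Re s) \<longrightarrow> F s = dirichlet_sum lam a s) \<and>
     F analytic_on (- {of_real r}) \<and>
     (F analytic_on {of_real r} \<or> is_pole F (of_real r) \<and> zorder F (of_real r) = - 1)"

text \<open>
  In \<open>class_A r lam a mu b \<phi> \<psi>\<close>, \<open>\<phi>\<close> and \<open>\<psi>\<close> are the continued functions, so that \<open>\<phi> 0\<close> and \<open>\<psi> 0\<close>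
  are meaningful (note that \<open>r > 0\<close>).
\<close>

definition class_A ::
  "real \<Rightarrow> (nat \<Rightarrow> real) \<Rightarrow> (nat \<Rightarrow> complex) \<Rightarrow> (nat \<Rightarrow> real) \<Rightarrow> (nat \<Rightarrow> complex) \<Rightarrow>
   (complex \<Rightarrow> complex) \<Rightarrow> (complex \<Rightarrow> complex) \<Rightarrow> bool"
where
  "class_A r lam a mu b \<phi> \<psi> \<longleftrightarrow>
     hecke_pair r lam a mu b \<and>
     dirichlet_continuation r lam a \<phi> \<and> dirichlet_continuation r mu b \<psi> \<and>
     a 0 = - \<phi> 0 \<and> b 0 = - \<psi> 0"

end

theory Submission
  imports Defs "HOL-Probability.Probability" "HOL-Real_Asymp.Real_Asymp"
begin

text \<open>
  Since \<open>b = cnj a\<close> and \<open>\<lambda> = \<mu>\<close>, the function \<open>X = \<Gamma> \<phi>\<close> is real on the line \<open>Re s = r/2\<close>. Suppose that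
  \<open>\<phi>\<close> has no zero there with \<open>\<bar>t - T\<bar> \<le> H = T powr (\<gamma> + \<eta>)\<close>, and put \<open>G = T powr \<gamma>\<close>. Then \<open>X\<close> has
  constant sign, so the integral of \<open>X\<close> against the weight \<open>exp ((\<pi>/2 - 1/T) t - ((t - T) / G)\<^sup>2)\<close> and
  that of its modulus have the same size.

  By Stirling's formula the latter is at least \<open>T powr ((r - 1) / 2)\<close> times the Gaussian mean of \<open>\<bar>\<phi>\<bar>\<close>,
  which is \<open>\<gg> G\<close>: shift the line of integration to the right, where the first nonzero term of the
  series dominates.

  For an upper bound shift to \<open>Re s = c > \<sigma>\<^sub>a\<close> and expand \<open>\<phi>\<close>. In each term
  \<open>\<Gamma> s (\<lambda> z) powr (- s) = \<integral> exp (s v - \<lambda> z e\<^sup>v) dv\<close> with \<open>z = exp (\<i> (\<pi>/2 - 1/T))\<close>, and the Gaussian in \<open>t\<close>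
  becomes a Gaussian in \<open>v\<close> of width about \<open>1 / G\<close>; this gives \<open>\<ll> T powr c\<close>, independently of \<open>G\<close>. With
  \<open>c\<close> close to \<open>\<sigma>\<^sub>a\<close> the two bounds contradict each other. All horizontal segments are negligible because
  \<open>\<phi>\<close> grows polynomially in vertical strips by Phragmen-Lindelof.
\<close>

section \<open>Vertical strips\<close>

text \<open>Why these parameters. The twist has to cancel the decay
  \<open>exp (- pi * t / 2)\<close> of \<open>Gamma\<close>, yet \<open>z\<close> needs a positive
  real part for the rotated integral to converge. The angle deficit \<open>1 / T\<close> does both:
  for \<open>t\<close> comparable to \<open>T\<close> it changes the weight by a bounded factor
  only, and \<open>Re z = sin (1 / T)\<close> costs no more than \<open>T powr c\<close>. Comparing
  \<open>G\<close> with \<open>T powr (c + (1 - r) / 2)\<close> forces \<gamma> slightly above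
  \<open>\<sigma>a + (1 - r) / 2\<close>, the exponent of the claim. The hypothesis
  \<open>\<sigma>a < (r + 1) / 2\<close> says that this exponent is below 1, so that the window
  stays within \<open>[T / 2, 3 * T / 2]\<close>, above all singularities. A lower counterpart,
  \<open>\<sigma>a \<ge> r / 2\<close>, has to be proved: it puts \<gamma> above 1/2, so
  \<open>G\<close> grows with \<open>T\<close> and the kernel hardly oscillates when the line is
  moved. The window exceeds \<open>G\<close> by the factor \<open>T powr \<eta>\<close>. At its ends
  the Gaussian is \<open>exp (- (T powr (2 * \<eta>)))\<close>, smaller than every negative power of
  \<open>T\<close>; hence the degree of the polynomial bound for \<phi> is irrelevant.\<close>

text \<open>The damping factor \<open>exp (\<eta> * s\<^sup>2)\<close> has modulus
  \<open>exp (\<eta> * ((Re s)\<^sup>2 - (Im s)\<^sup>2))\<close>, which beats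
  \<open>exp (D * Im s)\<close> in a strip of bounded width. On a tall enough rectangle the maximum
  principle applies with a harmless top edge, and then \<eta> tends to 0 at a fixed point.\<close>

lemma phragmen_lindelof_half_strip:
  fixes f :: "complex \<Rightarrow> complex"
  assumes hol: "f holomorphic_on {s. Im s > t0}" and t: "t0 < t1"
    and growth: "\<And>s. \<alpha> \<le> Re s \<Longrightarrow> Re s \<le> \<beta> \<Longrightarrow> Im s \<ge> t1 \<Longrightarrow> norm (f s) \<le> C * exp (D * Im s)"
    and edges: "\<And>s. Re s = \<alpha> \<or> Re s = \<beta> \<Longrightarrow> Im s \<ge> t1 \<Longrightarrow> norm (f s) \<le> B"
  obtains K where "K > 0"
    "\<And>s. \<alpha> \<le> Re s \<Longrightarrow> Re s \<le> \<beta> \<Longrightarrow> Im s \<ge> t1 \<Longrightarrow> norm (f s) \<le> K"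
proof -
  \<comment> \<open>The entries serve the two sides, the bottom edge \<open>Im s = t1\<close> and
    the top edge; the 1 also makes \<open>K\<close> positive.\<close>
  define K where "K = max (max B (C * exp (D * t1))) 1"
  define m where "m = (\<bar>\<alpha>\<bar> + \<bar>\<beta>\<bar>)\<^sup>2"
  have damped: "norm (f s) * exp (\<eta> * ((Re s)\<^sup>2 - (Im s)\<^sup>2)) \<le> K * exp (\<eta> * m)"
    if s: "\<alpha> \<le> Re s" "Re s \<le> \<beta>" "Im s \<ge> t1" and \<eta>: "\<eta> > 0" for s \<eta>
  proof -
    have "((\<lambda>R::real. exp (D * R - \<eta> * R\<^sup>2)) \<longlongrightarrow> 0) at_top"
      using \<eta> by real_asymp
    then have "((\<lambda>R::real. C * exp (D * R - \<eta> * R\<^sup>2)) \<longlongrightarrow> C * 0) at_top"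
      by (rule tendsto_mult_left)
    then have "((\<lambda>R::real. C * exp (D * R) * exp (- \<eta> * R\<^sup>2)) \<longlongrightarrow> 0) at_top"
      by (simp add: exp_diff exp_minus field_simps)
    then have "\<forall>\<^sub>F R in at_top. C * exp (D * R) * exp (- \<eta> * R\<^sup>2) < 1"
      by (rule order_tendstoD) simp
    then have "\<forall>\<^sub>F R in at_top. C * exp (D * R) * exp (- \<eta> * R\<^sup>2) < 1 \<and> R \<ge> Im s"
      by (intro eventually_conj eventually_ge_at_top)
    then obtain R where R: "C * exp (D * R) * exp (- \<eta> * R\<^sup>2) < 1" "R \<ge> Im s"
      by (metis (mono_tags, lifting) eventually_happens trivial_limit_at_top_linorder)
    define S where "S = cbox (Complex \<alpha> t1) (Complex \<beta> R)"
    define g where "g z = f z * exp (of_real \<eta> * z\<^sup>2)" for z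
    have norm_g: "norm (g z) = norm (f z) * exp (\<eta> * ((Re z)\<^sup>2 - (Im z)\<^sup>2))" for z
      by (simp add: g_def norm_mult power2_eq_square)
    have sub: "S \<subseteq> {s. Im s > t0}"
      using t by (auto simp: S_def in_cbox_complex_iff)
    have "g holomorphic_on S"
      unfolding g_def by (intro holomorphic_intros holomorphic_on_subset[OF hol sub])
    have "norm (g s) \<le> K * exp (\<eta> * m)"
    proof (rule maximum_modulus_frontier[where f = g and S = S])
      show "g holomorphic_on interior S"
        using \<open>g holomorphic_on S\<close> holomorphic_on_subset interior_subset by blast
      show "continuous_on (closure S) g"
        using \<open>g holomorphic_on S\<close> unfolding S_def by (simp add: holomorphic_on_imp_continuous_on)
      show "bounded S" "s \<in> S"
        using s R by (auto simp: S_def in_cbox_complex_iff)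
      fix z assume "z \<in> frontier S"
      then have z: "z \<in> S" "z \<notin> box (Complex \<alpha> t1) (Complex \<beta> R)"
        by (auto simp: S_def frontier_def)
      then have zin: "\<alpha> \<le> Re z" "Re z \<le> \<beta>" "t1 \<le> Im z" "Im z \<le> R"
        by (auto simp: S_def in_cbox_complex_iff)
      have "(Re z)\<^sup>2 \<le> m"
        unfolding m_def by (rule abs_le_square_iff[THEN iffD1]) (use zin in auto)
      have exp_le: "exp (\<eta> * ((Re z)\<^sup>2 - (Im z)\<^sup>2)) \<le> exp (\<eta> * m)"
        using \<open>(Re z)\<^sup>2 \<le> m\<close> \<eta> by (intro exp_le_cancel_iff[THEN iffD2] mult_left_mono) (auto intro: order.trans[of _ "(Re z)\<^sup>2"])
      consider "norm (f z) \<le> K" | "Im z = R"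
        using z(2) zin edges[of z] growth[of z] by (fastforce simp: in_box_complex_iff K_def)
      then show "norm (g z) \<le> K * exp (\<eta> * m)"
      proof cases
        case 1
        then show ?thesis unfolding norm_g
          using exp_le by (intro mult_mono) (auto simp: K_def)
      next
        case 2
        have "norm (g z) \<le> C * exp (D * R) * exp (\<eta> * ((Re z)\<^sup>2 - R\<^sup>2))"
          using growth[of z] zin unfolding norm_g 2 by (intro mult_right_mono) auto
        also have "\<dots> = C * exp (D * R) * exp (- \<eta> * R\<^sup>2) * exp (\<eta> * (Re z)\<^sup>2)"
          by (simp add: exp_diff exp_minus field_simps)
        also have "\<dots> \<le> 1 * exp (\<eta> * m)"
        \<comment> \<open>\<open>C\<close> carries no sign condition; a negative product makes the
          bound trivial.\<close>
        proof (cases "C * exp (D * R) * exp (- \<eta> * R\<^sup>2) \<ge> 0")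
          case True
          then show ?thesis using R(1) \<open>(Re z)\<^sup>2 \<le> m\<close> \<eta> by (intro mult_mono) auto
        next
          case False
          then show ?thesis
            by (smt (verit) exp_gt_zero mult_nonneg_nonneg zero_less_mult_iff)
        qed
        also have "\<dots> \<le> K * exp (\<eta> * m)"
          by (intro mult_right_mono) (auto simp: K_def)
        finally show ?thesis .
      qed
    qed
    then show ?thesis by (simp add: norm_g)
  qed
  have bound: "norm (f s) \<le> K" if s: "\<alpha> \<le> Re s" "Re s \<le> \<beta>" "Im s \<ge> t1" for s
  proof -
    have "norm (f s) * exp (\<eta> * ((Re s)\<^sup>2 - (Im s)\<^sup>2 - m)) \<le> K" if "\<eta> > 0" for \<eta>
    proof -
      have "exp (\<eta> * ((Re s)\<^sup>2 - (Im s)\<^sup>2 - m)) = exp (\<eta> * ((Re s)\<^sup>2 - (Im s)\<^sup>2)) / exp (\<eta> * m)"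
        by (subst right_diff_distrib) (rule exp_diff)
      then show ?thesis
        using damped[OF s that] by (simp only: times_divide_eq_right pos_divide_le_eq exp_gt_zero)
    qed
    then have "\<forall>\<^sub>F \<eta> in at_right 0. norm (f s) * exp (\<eta> * ((Re s)\<^sup>2 - (Im s)\<^sup>2 - m)) \<le> K"
      by (auto simp: eventually_at_right_less intro: eventually_mono[OF eventually_at_right_less])
    moreover have "((\<lambda>\<eta>. norm (f s) * exp (\<eta> * ((Re s)\<^sup>2 - (Im s)\<^sup>2 - m))) \<longlongrightarrow>
        norm (f s) * exp (0 * ((Re s)\<^sup>2 - (Im s)\<^sup>2 - m))) (at_right 0)"
      by (intro tendsto_intros)
    ultimately show ?thesis
      using tendsto_upperbound by fastforce
  qed
  show ?thesis
    by (rule that[of K]) (use bound in \<open>auto simp: K_def\<close>)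
qed

text \<open>Cauchy's theorem on a rectangle, phrased through a primitive \<open>P\<close>: both
  vertical integrals are differences of corner values of \<open>P\<close>, divided by \<i> because
  \<open>dz = \<i> dt\<close>. Only the two horizontal differences of \<open>P\<close> remain, each
  at most \<open>B\<close> times the length of the edge.\<close>

lemma vertical_line_shift:
  fixes f :: "complex \<Rightarrow> complex"
  assumes hol: "f holomorphic_on S" and S: "open S" "convex S"
    and rect: "\<And>s. \<alpha> \<le> Re s \<Longrightarrow> Re s \<le> \<beta> \<Longrightarrow> a \<le> Im s \<Longrightarrow> Im s \<le> b \<Longrightarrow> s \<in> S"
    and ab: "\<alpha> \<le> \<beta>" "a \<le> b"
    and B: "\<And>s. \<alpha> \<le> Re s \<Longrightarrow> Re s \<le> \<beta> \<Longrightarrow> Im s = a \<or> Im s = b \<Longrightarrow> norm (f s) \<le> B"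
  shows "norm (integral {a..b} (\<lambda>t. f (Complex \<alpha> t)) - integral {a..b} (\<lambda>t. f (Complex \<beta> t)))
          \<le> 2 * B * (\<beta> - \<alpha>)"
proof -
  obtain P where P: "\<And>x. x \<in> S \<Longrightarrow> (P has_field_derivative f x) (at x within S)"
    using holomorphic_convex_primitive'[OF S(2,1) hol] by blast
  have P': "(P has_field_derivative f x) (at x within A)" if "x \<in> S" for x A
    using P[OF that] unfolding at_within_open[OF that S(1)] by (rule has_field_derivative_at_within)
  have int_eq: "integral {a..b} (\<lambda>t. f (Complex x t)) = (P (Complex x b) - P (Complex x a)) / \<i>"
    if x: "\<alpha> \<le> x" "x \<le> \<beta>" for x
  proof (rule integral_unique)
    have "((\<lambda>t. f (Complex x t)) has_integral (P (Complex x b) / \<i> - P (Complex x a) / \<i>)) {a..b}"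
    proof (rule fundamental_theorem_of_calculus[OF ab(2)])
      fix t assume t: "t \<in> {a..b}"
      have "((\<lambda>t. Complex x t) has_vector_derivative \<i>) (at t within {a..b})"
        unfolding Complex_eq by (auto intro!: derivative_eq_intros simp: has_vector_derivative_def scaleR_conv_of_real)
      moreover have "(P has_field_derivative f (Complex x t)) (at (Complex x t) within (\<lambda>t. Complex x t) ` {a..b})"
        using t x rect by (intro P') auto
      ultimately have "((P \<circ> (\<lambda>t. Complex x t)) has_vector_derivative \<i> * f (Complex x t)) (at t within {a..b})"
        by (rule field_vector_diff_chain_within)
      then have "((\<lambda>t. (P \<circ> (\<lambda>t. Complex x t)) t / \<i>) has_vector_derivative (\<i> * f (Complex x t)) / \<i>) (at t within {a..b})"
        by (rule has_vector_derivative_divide)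
      then show "((\<lambda>t. P (Complex x t) / \<i>) has_vector_derivative f (Complex x t)) (at t within {a..b})"
        by (simp add: o_def)
    qed
    then show "((\<lambda>t. f (Complex x t)) has_integral (P (Complex x b) - P (Complex x a)) / \<i>) {a..b}"
      by (simp only: diff_divide_distrib)
  qed
  have horiz: "norm (P (Complex \<alpha> y) - P (Complex \<beta> y)) \<le> B * (\<beta> - \<alpha>)" if y: "y = a \<or> y = b" for y
  proof -
    define L where "L = closed_segment (Complex \<alpha> y) (Complex \<beta> y)"
    have L: "L = {z. Im z = y \<and> \<alpha> \<le> Re z \<and> Re z \<le> \<beta>}"
      unfolding L_def using ab by (subst closed_segment_same_Im) (auto simp: closed_segment_eq_real_ivl)
    have "norm (P (Complex \<alpha> y) - P (Complex \<beta> y)) \<le> B * norm (Complex \<alpha> y - Complex \<beta> y)"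
    proof (rule field_differentiable_bound[where S = L])
      show "(P has_field_derivative f z) (at z within L)" if "z \<in> L" for z
        using that y ab rect by (intro P') (auto simp: L)
      show "convex L" by (simp add: L_def)
      show "norm (f z) \<le> B" if "z \<in> L" for z
        using that y by (intro B) (auto simp: L)
      show "Complex \<alpha> y \<in> L" "Complex \<beta> y \<in> L" using ab by (auto simp: L)
    qed
    also have "norm (Complex \<alpha> y - Complex \<beta> y) = \<beta> - \<alpha>"
      using ab by (simp add: cmod_def)
    finally show ?thesis .
  qed
  have "integral {a..b} (\<lambda>t. f (Complex \<alpha> t)) - integral {a..b} (\<lambda>t. f (Complex \<beta> t))
      = ((P (Complex \<alpha> b) - P (Complex \<beta> b)) - (P (Complex \<alpha> a) - P (Complex \<beta> a))) / \<i>"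
    using ab by (simp add: int_eq field_simps)
  then have "norm (integral {a..b} (\<lambda>t. f (Complex \<alpha> t)) - integral {a..b} (\<lambda>t. f (Complex \<beta> t)))
      \<le> norm (P (Complex \<alpha> b) - P (Complex \<beta> b)) + norm (P (Complex \<alpha> a) - P (Complex \<beta> a))"
    by (simp only: norm_divide norm_ii div_by_1 norm_triangle_ineq4)
  also have "\<dots> \<le> B * (\<beta> - \<alpha>) + B * (\<beta> - \<alpha>)"
    by (intro add_mono horiz) auto
  finally show ?thesis by simp
qed

section \<open>The rotated Gamma integral and Gaussian weights\<close>

text \<open>Euler's integral under the substitution \<open>t = exp v\<close>. In the variable
  \<open>v\<close> the parameter enters as \<open>exp (s * v)\<close>, so a Gaussian weight in
  \<open>Im s\<close> can later be integrated as a Fourier transform.\<close>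

lemma has_bochner_integral_Gamma_exp:
  fixes s :: complex
  assumes s: "Re s > 0"
  shows "has_bochner_integral lborel (\<lambda>v::real. exp (s * of_real v - of_real (exp v))) (Gamma s)"
proof -
  let ?f = "\<lambda>t::real. complex_of_real t powr (s - 1) / of_real (exp t)"
  let ?g = "\<lambda>v::real. exp (s * of_real v - of_real (exp v))"
  have g_eq: "of_real (exp v) * ?f (exp v) = ?g v" for v
  proof -
    have "complex_of_real (exp v) powr (s - 1) = exp ((s - 1) * of_real v)"
      by (simp add: powr_def Ln_of_real)
    moreover have "complex_of_real (exp v) = exp (of_real v)"
      by (simp add: exp_of_real)
    ultimately show ?thesis
      by (simp add: exp_of_real[symmetric] exp_diff algebra_simps exp_add[symmetric])
         (simp add: exp_add[symmetric] exp_minus field_simps)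
  qed
  have int_f: "?f absolutely_integrable_on {0<..}" "integral {0<..} ?f = Gamma s"
    using absolutely_integrable_Gamma_integral'[OF s] Gamma_integral_complex'[OF s]
    by (auto intro: integral_unique)
  have meas: "?g \<in> borel_measurable borel" by measurable
  \<comment> \<open>The substitution is carried out for a real-valued projection \<open>h\<close>,
    used for \<open>Re\<close> and \<open>Im\<close>; by \<open>hr\<close> the Jacobian
    \<open>exp v\<close> passes through \<open>h\<close>.\<close>
  have part: "has_bochner_integral lborel (\<lambda>v. h (?g v)) (h (Gamma s))"
    if h: "bounded_linear h" and hr: "\<And>(x::real) z. h (of_real x * z) = x * h z" for h :: "complex \<Rightarrow> real"
  proof -
    have meas_h: "h \<in> borel_measurable borel"
      using h by (intro borel_measurable_continuous_onI linear_continuous_on)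
    have "(\<lambda>t. h (?f t)) absolutely_integrable_on {0<..}"
      using absolutely_integrable_linear[OF int_f(1) h] by (simp add: o_def)
    moreover have "integral {0<..} (\<lambda>t. h (?f t)) = h (Gamma s)"
      using integral_linear[OF _ h, of ?f "{0<..}"] int_f
      by (simp add: o_def set_lebesgue_integral_eq_integral(1))
    moreover have "range (exp :: real \<Rightarrow> real) = {0<..}"
      by (auto simp: image_iff) (metis exp_ln)
    ultimately have 1: "(\<lambda>x. \<bar>exp x\<bar> * h (?f (exp x))) absolutely_integrable_on UNIV \<and>
        integral UNIV (\<lambda>x. \<bar>exp x\<bar> * h (?f (exp x))) = h (Gamma s)"
      by (subst has_absolute_integral_change_of_variables_1')
         (auto intro!: derivative_eq_intros simp: inj_on_def)
    have eq: "\<bar>exp x\<bar> * h (?f (exp x)) = h (?g x)" for x :: real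
      by (subst g_eq[symmetric], subst hr) simp
    have 2: "(\<lambda>x. h (?g x)) absolutely_integrable_on UNIV"
      "integral UNIV (\<lambda>x. h (?g x)) = h (Gamma s)"
      using 1 unfolding eq by auto
    have 3: "integrable lborel (\<lambda>x. h (?g x))"
      using 2(1) measurable_compose[OF meas meas_h]
      by (simp add: set_integrable_def integrable_completion)
    then show ?thesis
      using 2(2) by (simp add: has_bochner_integral_iff integral_lborel[symmetric])
  qed
  have "has_bochner_integral lborel (\<lambda>v. of_real (Re (?g v)) + \<i> * of_real (Im (?g v)))
          (of_real (Re (Gamma s)) + \<i> * of_real (Im (Gamma s)))"
    by (intro has_bochner_integral_add has_bochner_integral_mult_right has_bochner_integral_of_real part)
       (auto intro: bounded_linear_Re bounded_linear_Im)
  then show ?thesis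
    unfolding complex_eq[symmetric] .
qed

lemma has_bochner_integral_Gamma_exp_scaled:
  fixes s :: complex and R :: real
  assumes s: "Re s > 0" and R: "R > 0"
  shows "has_bochner_integral lborel (\<lambda>v::real. exp (s * of_real v - of_real (R * exp v)))
           (Gamma s * of_real R powr (- s))"
proof -
  have "has_bochner_integral lborel (\<lambda>v::real. exp (s * of_real (ln R + 1 * v) - of_real (exp (ln R + 1 * v))))
          (Gamma s /\<^sub>R \<bar>1\<bar>)"
    by (rule lborel_has_bochner_integral_real_affine_iff[THEN iffD1])
       (use has_bochner_integral_Gamma_exp[OF s] in auto)
  then have "has_bochner_integral lborel
      (\<lambda>v. exp (s * of_real (ln R + 1 * v) - of_real (exp (ln R + 1 * v))) * of_real R powr (- s))
      (Gamma s * of_real R powr (- s))"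
    using has_bochner_integral_mult_left[of "of_real R powr (- s)"] by simp
  also have "(\<lambda>v. exp (s * of_real (ln R + 1 * v) - of_real (exp (ln R + 1 * v))) * of_real R powr (- s))
      = (\<lambda>v::real. exp (s * of_real v - of_real (R * exp v)))"
  proof
    fix v :: real
    have "of_real R powr (- s) = exp (- (s * of_real (ln R)))"
      using R by (simp add: powr_def Ln_of_real)
    moreover have "exp (ln R + 1 * v) = R * exp v"
      using R by (simp add: exp_add)
    ultimately show "exp (s * of_real (ln R + 1 * v) - of_real (exp (ln R + 1 * v))) * of_real R powr (- s)
        = exp (s * of_real v - of_real (R * exp v))"
      by (simp only: exp_add[symmetric]) (simp add: distrib_left)
  qed
  finally show ?thesis .
qed

text \<open>The two signs cancel. In this form the binomial series with exponent \<open>- a\<close>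
  has the coefficients \<open>Gamma (a + k) / (Gamma a * fact k)\<close>, which is how it arises
  from integrating an exponential series against the Gamma integrand.\<close>

lemma gbinomial_minus_mult_power:
  fixes a x :: "'a :: field_char_0"
  shows "(- a gchoose k) * (- x) ^ k = pochhammer a k / fact k * x ^ k"
  by (cases "even k") (simp_all add: gbinomial_pochhammer)

lemma has_bochner_integral_Gamma_rotated:
  fixes s z :: complex
  assumes s: "Re s > 0" and z: "Re z > 0"
  shows "has_bochner_integral lborel (\<lambda>v::real. exp (s * of_real v - z * of_real (exp v)))
           (Gamma s * z powr (- s))"
proof -
  \<comment> \<open>\<open>R\<close> is chosen so that \<open>\<bar>z - R\<bar> < R\<close>; expanding \<open>exp (- z e\<^sup>v)\<close> around \<open>exp (- R e\<^sup>v)\<close>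
    turns the claim into the binomial series of \<open>(z / R) powr (- s)\<close>.\<close>
  define R where "R = (norm z)\<^sup>2 / Re z"
  define w where "w = of_real R - z"
  have nz: "z \<noteq> 0" using z by auto
  have R: "R > 0" using z nz by (simp add: R_def)
  \<comment> \<open>As \<open>R * Re z = (norm z)\<^sup>2\<close>, the right-hand side equals
    \<open>R\<^sup>2 - (norm z)\<^sup>2\<close>.\<close>
  have "(norm w)\<^sup>2 = R\<^sup>2 - 2 * R * Re z + (norm z)\<^sup>2"
    by (simp add: w_def cmod_power2) (simp add: power2_eq_square algebra_simps)
  also have "\<dots> < R\<^sup>2"
    using z nz by (simp add: R_def)
  finally have w: "norm w < R"
    using R by (simp add: power2_less_imp_less)
  define f where "f k v = w ^ k / fact k * exp ((s + of_nat k) * of_real v - of_real (R * exp v))" for k and v :: real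
  define I where "I k = w ^ k / fact k * (Gamma (s + of_nat k) * of_real R powr (- (s + of_nat k)))" for k
  define J where "J k = norm w ^ k / fact k * (Gamma (Re s + of_nat k) * R powr (- (Re s + of_nat k)))" for k
  have f: "has_bochner_integral lborel (f k) (I k)" for k
    unfolding f_def I_def using s R
    by (intro has_bochner_integral_mult_right has_bochner_integral_Gamma_exp_scaled) auto
  have norm_f: "norm (f k v) = norm w ^ k / fact k * exp ((Re s + of_nat k) * v - R * exp v)" for k v
    by (simp add: f_def norm_mult norm_divide norm_power del: of_real_exp of_real_mult)
  have nf: "(\<integral>v. norm (f k v) \<partial>lborel) = J k" for k
  proof -
    have "has_bochner_integral lborel (\<lambda>v. exp (of_real (Re s + of_nat k) * of_real v - of_real (R * exp v)))
       (Gamma (of_real (Re s + of_nat k)) * of_real R powr (- of_real (Re s + of_nat k)) :: complex)"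
      using s R by (intro has_bochner_integral_Gamma_exp_scaled) auto
    also have "(\<lambda>v. exp (of_real (Re s + of_nat k) * of_real v - of_real (R * exp v))) =
        (\<lambda>v. complex_of_real (exp ((Re s + of_nat k) * v - R * exp v)))"
      by (simp add: exp_of_real[symmetric])
    also have "Gamma (of_real (Re s + of_nat k)) * of_real R powr (- of_real (Re s + of_nat k)) =
        complex_of_real (Gamma (Re s + of_nat k) * R powr (- (Re s + of_nat k)))"
      using R s by (simp add: Gamma_complex_of_real[symmetric] powr_of_real[symmetric])
    finally have "(\<integral>v. exp ((Re s + of_nat k) * v - R * exp v) \<partial>lborel) = Gamma (Re s + of_nat k) * R powr (- (Re s + of_nat k))"
      by (metis has_bochner_integral_integral_eq integral_complex_of_real of_real_eq_iff)
    then show ?thesis by (simp add: J_def norm_f)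
  qed
  have not_nonpos: "s \<notin> \<int>\<^sub>\<le>\<^sub>0" "Re s \<notin> \<int>\<^sub>\<le>\<^sub>0"
    using s by (auto elim!: nonpos_Ints_cases)
  \<comment> \<open>\<open>J\<close> consists of the integrals of the moduli. It is the binomial
    series for the real data \<open>Re s\<close> and \<open>norm w / R < 1\<close>; its convergence
    justifies integrating termwise.\<close>
  have "summable J"
  proof -
    have "\<bar>- (norm w / R)\<bar> < 1" using w R by simp
    then have "summable (\<lambda>k. (- Re s gchoose k) * (- (norm w / R)) ^ k)"
      using gen_binomial_real sums_summable by blast
    then have "summable (\<lambda>k. Gamma (Re s) * R powr (- Re s) * ((- Re s gchoose k) * (- (norm w / R)) ^ k))"
      by (rule summable_mult)
    also have "(\<lambda>k. Gamma (Re s) * R powr (- Re s) * ((- Re s gchoose k) * (- (norm w / R)) ^ k)) = J"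
    proof
      fix k
      have "(- Re s gchoose k) * (- (norm w / R)) ^ k = pochhammer (Re s) k / fact k * (norm w / R) ^ k"
        by (rule gbinomial_minus_mult_power)
      also have "\<dots> * Gamma (Re s) = Gamma (Re s + of_nat k) / fact k * (norm w / R) ^ k"
        using not_nonpos by (simp add: pochhammer_Gamma Gamma_eq_zero_iff)
      finally have e: "(- Re s gchoose k) * (- (norm w / R)) ^ k * Gamma (Re s) =
          Gamma (Re s + of_nat k) / fact k * (norm w / R) ^ k" .
      have "Gamma (Re s) * R powr (- Re s) * ((- Re s gchoose k) * (- (norm w / R)) ^ k) =
          ((- Re s gchoose k) * (- (norm w / R)) ^ k * Gamma (Re s)) * R powr (- Re s)"
        by (simp only: mult_ac)
      also have "\<dots> = J k"
        unfolding e using R by (simp add: J_def powr_diff powr_realpow power_divide mult_ac)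
      finally show "Gamma (Re s) * R powr (- Re s) * ((- Re s gchoose k) * (- (norm w / R)) ^ k) = J k" .
    qed
    finally show ?thesis .
  qed
  have sums_f: "(\<lambda>k. f k v) sums exp (s * of_real v - z * of_real (exp v))" for v
  proof -
    have "(\<lambda>k. exp (s * of_real v - of_real (R * exp v)) * ((w * of_real (exp v)) ^ k /\<^sub>R fact k)) sums
      (exp (s * of_real v - of_real (R * exp v)) * exp (w * of_real (exp v)))"
      by (intro sums_mult exp_converges)
    also have "(\<lambda>k. exp (s * of_real v - of_real (R * exp v)) * ((w * of_real (exp v)) ^ k /\<^sub>R fact k)) = (\<lambda>k. f k v)"
    proof
      fix k
      have "complex_of_real (exp v) ^ k = exp (of_nat k * of_real v)"
        by (simp add: exp_of_real[symmetric] exp_of_nat_mult)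
      then show "exp (s * of_real v - of_real (R * exp v)) * ((w * of_real (exp v)) ^ k /\<^sub>R fact k) = f k v"
        by (simp add: f_def power_mult_distrib scaleR_conv_of_real algebra_simps exp_add exp_diff divide_inverse)
    qed
    also have "exp (s * of_real v - of_real (R * exp v)) * exp (w * of_real (exp v)) = exp (s * of_real v - z * of_real (exp v))"
      by (simp add: w_def exp_add[symmetric] algebra_simps)
    finally show ?thesis .
  qed
  have summ_norm: "summable (\<lambda>k. norm (f k v))" for v
  proof -
    have "summable (\<lambda>k. exp (Re s * v - R * exp v) * ((norm w * exp v) ^ k /\<^sub>R fact k))"
      by (intro summable_mult) (rule summable_exp_generic)
    also have "(\<lambda>k. exp (Re s * v - R * exp v) * ((norm w * exp v) ^ k /\<^sub>R fact k)) = (\<lambda>k. norm (f k v))"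
    proof
      fix k
      have "exp v ^ k = exp (of_nat k * v)" by (simp add: exp_of_nat_mult)
      then show "exp (Re s * v - R * exp v) * ((norm w * exp v) ^ k /\<^sub>R fact k) = norm (f k v)"
        by (simp add: norm_f power_mult_distrib algebra_simps exp_add exp_diff divide_inverse)
    qed
    finally show ?thesis .
  qed
  have fi: "integrable lborel (f k)" for k using f has_bochner_integral_iff by blast
  have sn: "summable (\<lambda>k. \<integral>v. norm (f k v) \<partial>lborel)" using \<open>summable J\<close> by (simp add: nf)
  have "integrable lborel (\<lambda>v. \<Sum>k. f k v)"
    by (rule integrable_suminf[OF fi]) (use summ_norm sn in auto)
  moreover have "(\<lambda>k. integral\<^sup>L lborel (f k)) sums (\<integral>v. (\<Sum>k. f k v) \<partial>lborel)"
    by (rule sums_integral[OF fi]) (use summ_norm sn in auto)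
  moreover have "(\<lambda>v. \<Sum>k. f k v) = (\<lambda>v. exp (s * of_real v - z * of_real (exp v)))"
    using sums_f by (auto simp: sums_iff)
  moreover have "(\<lambda>k. integral\<^sup>L lborel (f k)) = I"
    using f has_bochner_integral_integral_eq by blast
  moreover have "I sums (Gamma s * z powr (- s))"
  proof -
    have "norm (- (w / of_real R)) < 1" using w R by (simp add: norm_divide)
    then have "(\<lambda>k. (- s gchoose k) * (- (w / of_real R)) ^ k) sums ((1 + - (w / of_real R)) powr (- s))"
      by (rule gen_binomial_complex)
    then have "(\<lambda>k. Gamma s * of_real R powr (- s) * ((- s gchoose k) * (- (w / of_real R)) ^ k)) sums
       (Gamma s * of_real R powr (- s) * ((1 + - (w / of_real R)) powr (- s)))"
      by (rule sums_mult)
    also have "(\<lambda>k. Gamma s * of_real R powr (- s) * ((- s gchoose k) * (- (w / of_real R)) ^ k)) = I"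
    proof
      fix k
      have "(- s gchoose k) * (- (w / of_real R)) ^ k = pochhammer s k / fact k * (w / of_real R) ^ k"
        by (rule gbinomial_minus_mult_power)
      also have "\<dots> * Gamma s = Gamma (s + of_nat k) / fact k * (w / of_real R) ^ k"
        using not_nonpos by (simp add: pochhammer_Gamma Gamma_eq_zero_iff)
      finally have e: "(- s gchoose k) * (- (w / of_real R)) ^ k * Gamma s =
          Gamma (s + of_nat k) / fact k * (w / of_real R) ^ k" .
      have "Gamma s * of_real R powr (- s) * ((- s gchoose k) * (- (w / of_real R)) ^ k) =
          ((- s gchoose k) * (- (w / of_real R)) ^ k * Gamma s) * of_real R powr (- s)"
        by (simp only: mult_ac)
      also have "\<dots> = I k"
        unfolding e using R by (simp add: I_def powr_diff powr_nat power_divide mult_ac)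
      finally show "Gamma s * of_real R powr (- s) * ((- s gchoose k) * (- (w / of_real R)) ^ k) = I k" .
    qed
    also have "Gamma s * of_real R powr (- s) * ((1 + - (w / of_real R)) powr (- s)) = Gamma s * z powr (- s)"
    proof -
      have "1 + - (w / of_real R) = z / of_real R" using R by (simp add: w_def field_simps)
      \<comment> \<open>The power splits since \<open>R\<close> is a positive real, so the branch of
        the logarithm is unaffected.\<close>
      moreover have "(of_real R * (z / of_real R)) powr (- s) = of_real R powr (- s) * (z / of_real R) powr (- s)"
        using R by (intro powr_times_real_left) auto
      ultimately show ?thesis using R by simp
    qed
    finally show ?thesis .
  qed
  ultimately show ?thesis
    using has_bochner_integral_iff sums_unique2 by metis
qed

section \<open>Gaussian integrals and the smoothed Gamma integral\<close>

lemma has_bochner_integral_gauss: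
  fixes G :: real
  assumes G: "G > 0"
  shows "has_bochner_integral lborel (\<lambda>u. exp (- (u / G)\<^sup>2)) (sqrt pi * G)"
proof -
  \<comment> \<open>The weight is a multiple of the normal density of variance
    \<open>G\<^sup>2 / 2\<close>.\<close>
  have eq: "normal_density 0 (G / sqrt 2) u * (sqrt pi * G) = exp (- (u / G)\<^sup>2)" for u
    using G by (simp add: normal_density_def power_divide real_sqrt_mult real_sqrt_divide)
  have "has_bochner_integral lborel (normal_density 0 (G / sqrt 2)) 1"
    using G by (simp add: has_bochner_integral_iff)
  then have "has_bochner_integral lborel (\<lambda>u. normal_density 0 (G / sqrt 2) u * (sqrt pi * G)) (1 * (sqrt pi * G))"
    by (rule has_bochner_integral_mult_left)
  then show ?thesis by (simp only: eq mult_1_left)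
qed

lemma has_bochner_integral_gauss_shift:
  fixes G T :: real
  assumes "G > 0"
  shows "has_bochner_integral lborel (\<lambda>t. exp (- ((t - T) / G)\<^sup>2)) (sqrt pi * G)"
  using lborel_has_bochner_integral_real_affine_iff[of 1 "\<lambda>u. exp (- (u / G)\<^sup>2)" _ "- T"] has_bochner_integral_gauss[OF assms]
  by (simp add: algebra_simps)

text \<open>The characteristic function of the standard normal law, rescaled by
  \<open>u = G * x / sqrt 2\<close>. A weight of width \<open>G\<close> has a transform of height
  proportional to \<open>G\<close> and width proportional to \<open>1 / G\<close>.\<close>

lemma has_bochner_integral_gauss_char:
  fixes G y :: real
  assumes G: "G > 0"
  shows "has_bochner_integral lborel (\<lambda>u. exp (\<i> * of_real (y * u)) * of_real (exp (- (u / G)\<^sup>2)))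
           (complex_of_real (sqrt pi * G * exp (- (G * y / 2)\<^sup>2)))"
proof -
  define t where "t = y * G / sqrt 2"
  have int: "integrable lborel (\<lambda>u. exp (\<i> * of_real (y * u)) * of_real (exp (- (u / G)\<^sup>2)) :: complex)"
  proof (rule Bochner_Integration.integrable_bound)
    show "integrable lborel (\<lambda>u. exp (- (u / G)\<^sup>2))"
      using has_bochner_integral_gauss[OF G] has_bochner_integral_iff by blast
  qed (auto simp: norm_mult)
  have "complex_of_real (exp (- (t\<^sup>2) / 2)) = char std_normal_distribution t"
    by (simp add: char_std_normal_distribution)
  also have "\<dots> = (\<integral>x. std_normal_density x *\<^sub>R iexp (t * x) \<partial>lborel)"
    unfolding char_def by (subst integral_density) auto
  also have "\<dots> = \<bar>sqrt 2 / G\<bar> *\<^sub>R (\<integral>u. std_normal_density (0 + sqrt 2 / G * u) *\<^sub>R iexp (t * (0 + sqrt 2 / G * u)) \<partial>lborel)"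
    using G by (intro lborel_integral_real_affine) auto
  also have "(\<lambda>u. std_normal_density (0 + sqrt 2 / G * u) *\<^sub>R iexp (t * (0 + sqrt 2 / G * u)))
     = (\<lambda>u. of_real (1 / sqrt (2 * pi)) * (exp (\<i> * of_real (y * u)) * of_real (exp (- (u / G)\<^sup>2))))"
    using G by (auto simp: fun_eq_iff std_normal_density_def t_def scaleR_conv_of_real power_mult_distrib power_divide)
  also have "\<bar>sqrt 2 / G\<bar> *\<^sub>R (\<integral>u. of_real (1 / sqrt (2 * pi)) * (exp (\<i> * of_real (y * u)) * of_real (exp (- (u / G)\<^sup>2))) \<partial>lborel)
    = of_real (1 / (sqrt pi * G)) * (\<integral>u. (exp (\<i> * of_real (y * u)) * of_real (exp (- (u / G)\<^sup>2))) \<partial>lborel)"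
    using G by (simp add: scaleR_conv_of_real real_sqrt_mult)
  finally have "(\<integral>u. (exp (\<i> * of_real (y * u)) * of_real (exp (- (u / G)\<^sup>2))) \<partial>lborel)
     = of_real (sqrt pi * G) * complex_of_real (exp (- (t\<^sup>2) / 2))"
    using G by (simp add: field_simps)
  moreover have "- (t\<^sup>2) / 2 = - (G * y / 2)\<^sup>2"
    by (simp add: t_def power_mult_distrib power_divide)
  ultimately show ?thesis
    using int by (simp add: has_bochner_integral_iff)
qed

text \<open>The left-hand side is largest where \<open>y * exp v = c\<close>; the factor
  \<open>exp (- c)\<close> of the exact maximum is dropped. Uniformity in \<open>v\<close> allows
  this factor to be taken out of an integral over \<open>v\<close>.\<close>

lemma exp_minus_exp_le:
  fixes c y v :: real
  assumes "c > 0" "y > 0"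
  shows "exp (c * v - y * exp v) \<le> c powr c * y powr (- c)"
proof -
  define x where "x = y * exp v"
  have x: "x > 0" "ln x = ln y + v" using assms by (auto simp: x_def ln_mult)
  have "ln (x / c) \<le> x / c - 1" using x assms by (intro ln_le_minus_one) auto
  then have "c * ln (x / c) \<le> c * (x / c - 1)" using assms by (intro mult_left_mono) auto
  then have "c * (ln y + v) - c * ln c \<le> x - c"
    using assms x by (simp add: ln_div algebra_simps)
  then have "c * v - x \<le> c * ln c - c * ln y"
    using assms by (simp add: algebra_simps)
  then have "exp (c * v - x) \<le> exp (c * ln c - c * ln y)" by simp
  also have "\<dots> = c powr c * y powr (- c)"
    using assms by (simp add: powr_def exp_diff exp_minus field_simps)
  finally show ?thesis by (simp add: x_def)
qed

text \<open>Moving the modulus inside the rotated integral leaves the same integral for the real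
  parameters \<open>Re s\<close> and \<open>Re z\<close>. The decay in \<open>Im s\<close> is lost,
  but a bound uniform in \<open>Im s\<close> suffices for domination next to a Gaussian.\<close>

lemma norm_Gamma_rotated_le:
  fixes s z :: complex
  assumes s: "Re s > 0" and z: "Re z > 0"
  shows "norm (Gamma s * z powr (- s)) \<le> Gamma (Re s) * Re z powr (- Re s)"
proof -
  let ?f = "\<lambda>v. exp (Re s * v - Re z * exp v)"
  let ?g = "\<lambda>v::real. exp (s * of_real v - z * of_real (exp v))"
  have norm_eq: "norm (?g v) = ?f v" for v
    by (simp del: of_real_exp)
  have "has_bochner_integral lborel (\<lambda>v. complex_of_real (?f v)) (of_real (Gamma (Re s) * Re z powr (- Re s)))"
    using has_bochner_integral_Gamma_rotated[of "of_real (Re s)" "of_real (Re z)"] assms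
    by (simp add: Gamma_complex_of_real exp_of_real[symmetric] powr_of_real[symmetric])
  then have "(\<integral>v. ?f v \<partial>lborel) = Gamma (Re s) * Re z powr (- Re s)"
    by (metis has_bochner_integral_integral_eq integral_complex_of_real of_real_eq_iff)
  moreover have "norm (Gamma s * z powr (- s)) = norm (\<integral>v. ?g v \<partial>lborel)"
    using has_bochner_integral_integral_eq[OF has_bochner_integral_Gamma_rotated[OF assms]] by simp
  moreover have "\<dots> \<le> (\<integral>v. ?f v \<partial>lborel)"
    using integral_norm_bound[of lborel ?g] unfolding norm_eq by simp
  ultimately show ?thesis by simp
qed

text \<open>After Fubini the inner integral over \<open>t\<close> is the transform of a Gaussian at
  the frequency \<open>v + d\<close>, of height proportional to \<open>G\<close> and with integral
  over \<open>v\<close> bounded independently of \<open>G\<close>. The supremum of the remaining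
  factor \<open>E\<close> is taken out, so no power of \<open>G\<close> survives. The offset
  \<kappa> is the distance from the line of integration to the line on which the kernel is
  real.\<close>

lemma Gamma_gauss_integral_bound:
  fixes c G T \<kappa> :: real and z :: complex
  assumes c: "c > 0" and z: "Re z > 0" and G: "G > 0"
  shows "norm (\<integral>t. Gamma (of_real c + \<i> * of_real t) * z powr (- (of_real c + \<i> * of_real t))
              * exp (((of_real \<kappa> + \<i> * of_real (t - T)) / of_real G)\<^sup>2) \<partial>lborel)
         \<le> 2 * pi * c powr c * Re z powr (- c) * exp ((\<kappa> / G)\<^sup>2)"
proof -
  define g where "g t = exp (((of_real \<kappa> + \<i> * of_real (t - T)) / of_real G)\<^sup>2)" for t
  define h where "h t v = exp ((of_real c + \<i> * of_real t) * of_real v - z * of_real (exp v)) * g t" for t v :: real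
  define E where "E v = exp (c * v - Re z * exp v)" for v
  have norm_g: "norm (g t) = exp ((\<kappa> / G)\<^sup>2) * exp (- ((t - T) / G)\<^sup>2)" for t
    using G by (simp add: g_def exp_add[symmetric] power2_eq_square diff_divide_distrib[symmetric] algebra_simps add_divide_distrib)
  have norm_h: "norm (h t v) = E v * norm (g t)" for t v
    by (simp add: h_def norm_mult E_def del: of_real_exp)
  note gauss_shift = has_bochner_integral_gauss_shift[OF G, of T]
  have int_ng: "integrable lborel (\<lambda>t. norm (g t))"
    unfolding norm_g using gauss_shift by (intro integrable_mult_right) (simp add: has_bochner_integral_iff)
  have rot: "has_bochner_integral lborel (\<lambda>v. h t v) (Gamma (of_real c + \<i> * of_real t) * z powr (- (of_real c + \<i> * of_real t)) * g t)" for t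
    unfolding h_def using c z by (intro has_bochner_integral_mult_left has_bochner_integral_Gamma_rotated) auto
  have meas: "case_prod h \<in> borel_measurable (lborel \<Otimes>\<^sub>M lborel)"
    unfolding h_def g_def by measurable
  have "integrable (lborel \<Otimes>\<^sub>M lborel) (case_prod h)"
  proof (rule lborel_pair.Fubini_integrable[OF meas])
    show "integrable lborel (\<lambda>t. \<integral>v. norm (case (t, v) of (t, v) \<Rightarrow> h t v) \<partial>lborel)"
      using int_ng by (simp add: norm_h)
    show "AE t in lborel. integrable lborel (\<lambda>v. case (t, v) of (t, v) \<Rightarrow> h t v)"
      using rot by (simp add: has_bochner_integral_iff)
  qed
  then have "(\<integral>v. (\<integral>t. h t v \<partial>lborel) \<partial>lborel) = (\<integral>t. (\<integral>v. h t v \<partial>lborel) \<partial>lborel)"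
    by (rule lborel_pair.Fubini_integral)
  also have "\<dots> = (\<integral>t. Gamma (of_real c + \<i> * of_real t) * z powr (- (of_real c + \<i> * of_real t)) * g t \<partial>lborel)"
    using rot by (simp add: has_bochner_integral_iff)
  finally have swap: "\<dots> = (\<integral>v. (\<integral>t. h t v \<partial>lborel) \<partial>lborel)" by simp
  \<comment> \<open>With \<open>u = t - T\<close> the cross term of the squared exponent is
    \<open>2 * \<i> * \<kappa> * u / G\<^sup>2\<close>; it merely shifts the frequency
    \<open>v\<close> by \<open>d\<close>.\<close>
  define d where "d = 2 * \<kappa> / G\<^sup>2"
  have inner: "norm (\<integral>t. h t v \<partial>lborel) = E v * exp ((\<kappa> / G)\<^sup>2) * (sqrt pi * G) * exp (- (G * (v + d) / 2)\<^sup>2)" for v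
  proof -
    have "(\<integral>t. h t v \<partial>lborel) = (\<integral>u. h (T + u) v \<partial>lborel)"
      using lborel_integral_real_affine[of 1 "\<lambda>t. h t v" T] by simp
    also have "(\<lambda>u. h (T + u) v) = (\<lambda>u. (exp ((of_real c + \<i> * of_real T) * of_real v - z * of_real (exp v)) * of_real (exp ((\<kappa> / G)\<^sup>2)))
        * (exp (\<i> * of_real ((v + d) * u)) * of_real (exp (- (u / G)\<^sup>2))))"
    proof
      fix u
      have sq: "((of_real \<kappa> + \<i> * of_real u) / of_real G)\<^sup>2 = of_real ((\<kappa> / G)\<^sup>2) + \<i> * of_real (d * u) + of_real (- (u / G)\<^sup>2 :: real)"
        using G by (simp add: d_def power2_eq_square complex_eq_iff field_simps)
      show "h (T + u) v = (exp ((of_real c + \<i> * of_real T) * of_real v - z * of_real (exp v)) * of_real (exp ((\<kappa> / G)\<^sup>2)))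
        * (exp (\<i> * of_real ((v + d) * u)) * of_real (exp (- (u / G)\<^sup>2)))"
        unfolding h_def g_def add_diff_cancel_left' sq exp_of_real[symmetric] exp_add[symmetric]
        by (rule arg_cong[where f = exp]) (simp add: algebra_simps)
    qed
    also have "(\<integral>u. (exp ((of_real c + \<i> * of_real T) * of_real v - z * of_real (exp v)) * of_real (exp ((\<kappa> / G)\<^sup>2)))
        * (exp (\<i> * of_real ((v + d) * u)) * of_real (exp (- (u / G)\<^sup>2))) \<partial>lborel)
      = exp ((of_real c + \<i> * of_real T) * of_real v - z * of_real (exp v)) * of_real (exp ((\<kappa> / G)\<^sup>2)) *
         complex_of_real (sqrt pi * G * exp (- (G * (v + d) / 2)\<^sup>2))"
      using has_bochner_integral_mult_right[OF has_bochner_integral_gauss_char[OF G, of "v + d"]]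
      by (rule has_bochner_integral_integral_eq)
    finally show ?thesis
      using G by (simp add: norm_mult E_def del: of_real_exp of_real_mult)
  qed
  have outer: "has_bochner_integral lborel (\<lambda>v. exp (- (G * (v + d) / 2)\<^sup>2)) (sqrt pi * (2 / G))"
  proof -
    have "has_bochner_integral lborel (\<lambda>u. exp (- (u / (2 / G))\<^sup>2)) (sqrt pi * (2 / G))"
      using G by (intro has_bochner_integral_gauss) auto
    then show ?thesis
      using lborel_has_bochner_integral_real_affine_iff[of 1 "\<lambda>u. exp (- (u / (2 / G))\<^sup>2)" _ d]
      by (simp add: algebra_simps)
  qed
  define M where "M = c powr c * Re z powr (- c) * exp ((\<kappa> / G)\<^sup>2) * (sqrt pi * G)"
  have "norm (\<integral>v. (\<integral>t. h t v \<partial>lborel) \<partial>lborel) \<le> (\<integral>v. norm (\<integral>t. h t v \<partial>lborel) \<partial>lborel)"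
    by (rule integral_norm_bound)
  also have "\<dots> \<le> (\<integral>v. M * exp (- (G * (v + d) / 2)\<^sup>2) \<partial>lborel)"
  proof (rule integral_mono')
    show "integrable lborel (\<lambda>v. M * exp (- (G * (v + d) / 2)\<^sup>2))"
      using outer by (intro integrable_mult_right) (simp add: has_bochner_integral_iff)
    fix v
    have "E v \<le> c powr c * Re z powr (- c)"
      unfolding E_def using c z by (rule exp_minus_exp_le)
    then show "norm (\<integral>t. h t v \<partial>lborel) \<le> M * exp (- (G * (v + d) / 2)\<^sup>2)"
      unfolding inner M_def using G by (intro mult_right_mono) auto
    show "0 \<le> M * exp (- (G * (v + d) / 2)\<^sup>2)"
      using G by (simp add: M_def)
  qed
  also have "\<dots> = M * (sqrt pi * (2 / G))"
    using has_bochner_integral_mult_right[OF outer, of M] by (rule has_bochner_integral_integral_eq)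
  also have "\<dots> = 2 * pi * c powr c * Re z powr (- c) * exp ((\<kappa> / G)\<^sup>2)"
    using G by (simp add: M_def)
  finally show ?thesis
    unfolding swap[symmetric] g_def .
qed

section \<open>Vertical growth of the Gamma function\<close>

lemma norm_Gamma_le:
  fixes s :: complex
  assumes "Re s > 0"
  shows "norm (Gamma s) \<le> Gamma (Re s)"
  using norm_Gamma_rotated_le[of s 1] assms by simp

lemma norm_inverse_le_iff:
  fixes x :: "'a :: real_normed_div_algebra"
  shows "x \<noteq> 0 \<Longrightarrow> norm (inverse x) \<le> y \<longleftrightarrow> 1 \<le> y * norm x"
  unfolding norm_inverse by (simp add: field_simps)

lemma norm_sin_le_exp: "norm (sin z) \<le> exp \<bar>Im z\<bar>" for z :: complex
proof -
  have "norm (sin z) = norm (exp (\<i> * z) - exp (- (\<i> * z))) / 2"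
    by (simp add: sin_exp_eq norm_divide norm_mult)
  also have "\<dots> \<le> (norm (exp (\<i> * z)) + norm (exp (- (\<i> * z)))) / 2"
    by (intro divide_right_mono norm_triangle_ineq4) simp
  also have "\<dots> \<le> (exp \<bar>Im z\<bar> + exp \<bar>Im z\<bar>) / 2"
    by (intro divide_right_mono add_mono) auto
  finally show ?thesis by simp
qed

text \<open>The modulus of \<open>Gamma\<close> divided by the main term of Stirling's formula, up
  to the constant \<open>sqrt (2 * pi)\<close>. Two-sided bounds for this quotient in vertical
  strips are all that is taken from Stirling.\<close>

definition Gamma_ratio :: "complex \<Rightarrow> real" where
  "Gamma_ratio s = norm (Gamma s) * exp (pi * Im s / 2) * Im s powr (1/2 - Re s)"

text \<open>On this line \<open>1 - s = cnj s\<close>, so the reflection formula evaluates the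
  modulus exactly.\<close>

lemma norm_Gamma_half:
  "norm (Gamma (Complex (1/2) t)) ^ 2 = pi / cosh (pi * t)"
proof -
  define s where "s = Complex (1/2) t"
  have "1 - s = cnj s"
    by (simp add: s_def complex_eq_iff)
  have "of_real (norm (Gamma s) ^ 2) = Gamma s * cnj (Gamma s)"
    by (rule complex_norm_square)
  also have "\<dots> = Gamma s * Gamma (1 - s)"
    by (simp add: \<open>1 - s = cnj s\<close> cnj_Gamma)
  also have "\<dots> = of_real pi / sin (of_real pi * s)"
    by (rule Gamma_reflection_complex)
  also have "of_real pi * s = of_real pi / 2 + \<i> * of_real (pi * t)"
    by (simp add: s_def complex_eq_iff)
  also have "sin (of_real pi / 2 + \<i> * of_real (pi * t)) = of_real (cosh (pi * t))"
    by (simp add: complex_eq_iff Re_sin Im_sin cosh_def)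
  finally show ?thesis
    unfolding s_def by (metis of_real_divide of_real_eq_iff)
qed

text \<open>Here the power of \<open>Im s\<close> is trivial, and the squared ratio
  \<open>2 * pi / (1 + exp (- (2 * pi * t)))\<close> lies between \<open>pi\<close> and
  \<open>2 * pi\<close>; 1 and 3 are convenient outer bounds for the root.\<close>

lemma Gamma_ratio_half:
  assumes "t \<ge> 1"
  shows "Gamma_ratio (Complex (1/2) t) \<in> {1..3}"
proof -
  define q where "q = norm (Gamma (Complex (1/2) t)) * exp (pi * t / 2)"
  have eq: "Gamma_ratio (Complex (1/2) t) = q"
    using assms by (simp add: Gamma_ratio_def q_def)
  have "q\<^sup>2 = pi / cosh (pi * t) * exp (pi * t)"
    by (simp add: q_def power_mult_distrib norm_Gamma_half exp_double[symmetric])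
  also have "\<dots> = 2 * pi / (1 + exp (- (2 * pi * t)))"
  proof -
    have "exp (pi * t) * (1 + exp (- (2 * pi * t))) = exp (pi * t) + exp (- (pi * t))"
      by (simp add: distrib_left exp_add[symmetric])
    moreover have "1 + exp (- (2 * pi * t)) > 0" "exp (pi * t) + exp (- (pi * t)) > 0"
      by (simp_all add: add_pos_pos)
    ultimately show ?thesis
      by (simp add: cosh_def divide_simps)
  qed
  finally have q2: "q\<^sup>2 = 2 * pi / (1 + exp (- (2 * pi * t)))" .
  have e: "0 < exp (- (2 * pi * t))" "exp (- (2 * pi * t)) \<le> 1"
    using assms by auto
  have "1\<^sup>2 \<le> q\<^sup>2"
  proof -
    have "1 + exp (- (2 * pi * t)) \<le> 2 * pi" using e(2) pi_gt3 by linarith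
    then show ?thesis unfolding q2 using e(1) add_pos_pos[OF zero_less_one e(1)] by (simp add: pos_le_divide_eq)
  qed
  moreover have "q\<^sup>2 \<le> 3\<^sup>2"
  proof -
    have "2 * pi / (1 + exp (- (2 * pi * t))) \<le> 2 * pi / 1"
      using e(1) add_pos_pos[OF zero_less_one e(1)] by (intro divide_left_mono) auto
    then show ?thesis unfolding q2 using pi_less_4 by simp
  qed
  moreover have "q \<ge> 0" by (simp add: q_def)
  ultimately have "1 \<le> q" "q \<le> 3"
    using power2_le_imp_le[of 1 q] power2_le_imp_le[of q 3] by simp_all
  then show ?thesis by (simp add: eq)
qed

text \<open>\<open>Gamma\<close> gains the factor \<open>norm s\<close> while the normalising power
  changes by \<open>Im s\<close>. The quotient of the two is bounded in strips, so estimates travel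
  from a strip to its translates by 1.\<close>

lemma Gamma_ratio_plus1:
  assumes "Im s \<ge> 1"
  shows "Gamma_ratio (s + 1) = norm s / Im s * Gamma_ratio s"
proof -
  have "s \<notin> \<int>\<^sub>\<le>\<^sub>0" using assms by (auto elim!: nonpos_Ints_cases)
  then have "Gamma (s + 1) = s * Gamma s"
    by (rule Gamma_plus1)
  moreover have "Im s powr (1/2 - (Re s + 1)) = Im s powr (1/2 - Re s) / Im s"
    using powr_diff[of "Im s" "1/2 - Re s" 1] assms by (simp add: diff_diff_eq)
  ultimately show ?thesis
    by (simp add: Gamma_ratio_def norm_mult)
qed

lemma norm_div_Im_bounds:
  assumes "Im s \<ge> 1"
  shows "1 \<le> norm s / Im s" "norm s / Im s \<le> 1 + \<bar>Re s\<bar>"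
proof -
  show "1 \<le> norm s / Im s"
    using assms abs_Im_le_cmod[of s] by simp
  have "norm s \<le> \<bar>Re s\<bar> * 1 + \<bar>Im s\<bar>"
    using cmod_le[of s] by simp
  also have "\<dots> \<le> \<bar>Re s\<bar> * Im s + Im s"
    using assms by (intro add_mono mult_left_mono) auto
  finally show "norm s / Im s \<le> 1 + \<bar>Re s\<bar>"
    using assms by (simp add: field_simps)
qed

lemma Gamma_ratio_strip_base:
  obtains C where "C \<ge> 1"
    "\<And>s. 1/2 \<le> Re s \<Longrightarrow> Re s \<le> 3/2 \<Longrightarrow> Im s \<ge> 1 \<Longrightarrow> Gamma_ratio s \<in> {1/C..C}"
proof -
  \<comment> \<open>\<open>h\<close> is \<open>\<Gamma>\<close> divided by the main factors of Stirling's formula, with \<open>s\<close> written as \<open>\<i> (- \<i> s)\<close>.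
    Its modulus is known on the edges by reflection, so Phragmen-Lindelof applied to \<open>h\<close> and \<open>1 / h\<close>
    bounds it above and below on the strip.\<close>
  define h where "h s = Gamma s * exp (- (\<i> * of_real pi * s / 2)) * exp (- (s - 1/2) * Ln (- \<i> * s))" for s
  have norm_h: "norm (h s) = norm (Gamma s) * exp (pi * Im s / 2) * norm s powr (1/2 - Re s)
      * exp (Im s * Im (Ln (- \<i> * s)))" if "Im s > 0" for s
  proof -
    have "s \<noteq> 0" using that by auto
    then have "Re (Ln (- \<i> * s)) = ln (norm s)"
      by (simp add: norm_mult)
    then have "norm (exp (- (s - 1/2) * Ln (- \<i> * s))) =
        exp ((1/2 - Re s) * ln (norm s) + Im s * Im (Ln (- \<i> * s)))"
      by (simp add: algebra_simps)
    also have "\<dots> = norm s powr (1/2 - Re s) * exp (Im s * Im (Ln (- \<i> * s)))"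
      using \<open>s \<noteq> 0\<close> by (simp add: powr_def exp_add)
    finally show ?thesis
      by (simp add: h_def norm_mult)
  qed
  \<comment> \<open>The argument of \<open>- \<i> * s\<close> is
    \<open>arctan (- Re s / Im s)\<close>. As \<bar>arctan y\<bar> \<le> \<bar>y\<bar>,
    multiplication by \<open>Im s\<close> leaves a quantity bounded in the strip.\<close>
  have phase: "\<bar>Im s * Im (Ln (- \<i> * s))\<bar> \<le> \<bar>Re s\<bar>" if "Im s > 0" for s
  proof -
    have "Im (Ln (- \<i> * s)) = Arg (- \<i> * s)"
      using that by (subst Arg_eq_Im_Ln) auto
    also have "\<dots> = arctan (- Re s / Im s)"
      using that by (subst arg_conv_arctan) auto
    finally have "\<bar>Im (Ln (- \<i> * s))\<bar> \<le> \<bar>Re s / Im s\<bar>"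
      using abs_arctan_le[of "- Re s / Im s"] by simp
    then have "\<bar>Im s\<bar> * \<bar>Im (Ln (- \<i> * s))\<bar> \<le> \<bar>Im s\<bar> * \<bar>Re s / Im s\<bar>"
      by (intro mult_left_mono) auto
    also have "\<dots> = \<bar>Re s\<bar>"
      using that by (simp add: abs_mult)
    finally show ?thesis by (simp add: abs_mult)
  qed
  \<comment> \<open>The exponent lies in \<open>[-1, 0]\<close> and \<open>norm s / Im s\<close> in
    \<open>[1, 5/2]\<close>, so exchanging \<open>norm s\<close> for \<open>Im s\<close> costs at
    most a factor 3.\<close>
  have norm_powr: "norm s powr (1/2 - Re s) \<le> Im s powr (1/2 - Re s)"
    "Im s powr (1/2 - Re s) \<le> 3 * norm s powr (1/2 - Re s)"
    if "1/2 \<le> Re s" "Re s \<le> 3/2" "Im s \<ge> 1" for s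
  proof -
    have b: "1 \<le> norm s / Im s" "norm s / Im s \<le> 3"
      using norm_div_Im_bounds[of s] that by auto
    have "s \<noteq> 0" using that by auto
    have eq: "Im s powr (1/2 - Re s) = (norm s / Im s) powr (Re s - 1/2) * norm s powr (1/2 - Re s)"
    proof -
      define a where "a = Re s - 1/2"
      have a: "1/2 - Re s = - a" "Re s - 1/2 = a" by (simp_all add: a_def)
      show ?thesis
        unfolding a using that \<open>s \<noteq> 0\<close> by (simp add: powr_divide powr_minus divide_simps)
    qed
    have "1 \<le> (norm s / Im s) powr (Re s - 1/2)"
      using b that by (intro ge_one_powr_ge_zero) auto
    then show "norm s powr (1/2 - Re s) \<le> Im s powr (1/2 - Re s)"
      unfolding eq by (simp add: mult_le_cancel_right1)
    have "(norm s / Im s) powr (Re s - 1/2) \<le> (norm s / Im s) powr 1"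
      using b that by (intro powr_mono) auto
    then have "(norm s / Im s) powr (Re s - 1/2) \<le> 3"
      using b by simp
    then show "Im s powr (1/2 - Re s) \<le> 3 * norm s powr (1/2 - Re s)"
      unfolding eq by (intro mult_right_mono) auto
  qed
  \<comment> \<open>Bound for the exponential of the phase term, as
    \<open>\<bar>Re s\<bar> \<le> 3/2\<close> in this strip.\<close>
  define E where "E = exp (3/2 :: real)"
  have "E \<ge> 1" by (simp add: E_def)
  have h_ratio: "norm (h s) \<le> E * Gamma_ratio s" "Gamma_ratio s \<le> 3 * E * norm (h s)"
    if s: "1/2 \<le> Re s" "Re s \<le> 3/2" "Im s \<ge> 1" for s
  proof -
    define g where "g = norm (Gamma s) * exp (pi * Im s / 2)"
    define p where "p = exp (Im s * Im (Ln (- \<i> * s)))"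
    have "g \<ge> 0" by (simp add: g_def)
    have p: "p \<le> E" "1 \<le> E * p"
      using phase[of s] s unfolding p_def E_def exp_add[symmetric] exp_le_cancel_iff one_le_exp_iff
      by linarith+
    have nh: "norm (h s) = g * norm s powr (1/2 - Re s) * p"
      using norm_h[of s] s by (simp add: g_def p_def)
    have gr: "Gamma_ratio s = g * Im s powr (1/2 - Re s)"
      by (simp add: Gamma_ratio_def g_def)
    have "norm (h s) \<le> (g * Im s powr (1/2 - Re s)) * E"
      unfolding nh using p norm_powr[OF s] \<open>g \<ge> 0\<close>
      by (intro mult_mono mult_left_mono) (auto simp: p_def)
    then show "norm (h s) \<le> E * Gamma_ratio s"
      by (simp add: gr mult_ac)
    have "Gamma_ratio s \<le> g * (3 * norm s powr (1/2 - Re s)) * 1"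
      unfolding gr using norm_powr[OF s] \<open>g \<ge> 0\<close> by (simp add: mult_left_mono)
    also have "\<dots> \<le> g * (3 * norm s powr (1/2 - Re s)) * (E * p)"
      using p \<open>g \<ge> 0\<close> by (intro mult_left_mono) auto
    finally show "Gamma_ratio s \<le> 3 * E * norm (h s)"
      by (simp add: nh mult_ac)
  qed
  \<comment> \<open>The left edge is the line of exact evaluation; the recurrence carries its bound
    3 to the right edge at the cost of another factor 3.\<close>
  have edge: "Gamma_ratio s \<in> {1..9}" if s: "Re s = 1/2 \<or> Re s = 3/2" "Im s \<ge> 1" for s
  proof (cases "Re s = 1/2")
    case True
    then have "s = Complex (1/2) (Im s)" by (simp add: complex_eq_iff)
    then have "Gamma_ratio s \<in> {1..3}" using Gamma_ratio_half[OF s(2)] by simp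
    then show ?thesis by simp
  next
    case False
    define w where "w = Complex (1/2) (Im s)"
    have sw: "s = w + 1"
      using False s by (simp add: complex_eq_iff w_def)
    have w: "Re w = 1/2" "Im w \<ge> 1" using s by (simp_all add: w_def)
    have "1 \<le> norm w / Im w" "norm w / Im w \<le> 3"
      using norm_div_Im_bounds[OF w(2)] w(1) by linarith+
    moreover have "1 \<le> Gamma_ratio w" "Gamma_ratio w \<le> 3"
      using Gamma_ratio_half[OF s(2)] by (auto simp: w_def)
    moreover have eq: "Gamma_ratio s = norm w / Im w * Gamma_ratio w"
      unfolding sw using w by (intro Gamma_ratio_plus1)
    ultimately have "1 * 1 \<le> Gamma_ratio s" "Gamma_ratio s \<le> 3 * 3"
      unfolding eq by (intro mult_mono; linarith)+
    then show ?thesis by simp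
  qed
  obtain L :: real where L: "\<And>x::real. 1/2 \<le> x \<Longrightarrow> x \<le> 3/2 \<Longrightarrow> Gamma x \<le> L"
  proof -
    have "continuous_on {1/2..3/2} (Gamma :: real \<Rightarrow> real)"
      by (rule continuous_on_Gamma) (auto elim!: nonpos_Ints_cases)
    then have "bounded (Gamma ` {1/2..3/2::real})"
      by (intro compact_imp_bounded compact_continuous_image) auto
    then obtain L where "\<forall>y \<in> Gamma ` {1/2..3/2::real}. norm y \<le> L"
      by (auto simp: bounded_iff)
    then show ?thesis by (intro that[of L]) force
  qed
  have L0: "L \<ge> 0" using L[of 1] by simp
  have not_nonpos: "s \<notin> \<int>\<^sub>\<le>\<^sub>0" if "Im s > 0" for s
    using that by (auto elim!: nonpos_Ints_cases)
  have hol: "h holomorphic_on {s. Im s > 0}"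
    unfolding h_def using not_nonpos
    by (intro holomorphic_intros) (auto simp: complex_nonpos_Reals_iff)
  have nz: "h s \<noteq> 0" if "Im s > 0" for s
    using not_nonpos[OF that] by (simp add: h_def Gamma_eq_zero_iff)
  have growth: "norm (h s) \<le> E * L * exp (pi / 2 * Im s)"
    if s: "1/2 \<le> Re s" "Re s \<le> 3/2" "Im s \<ge> 1" for s
  proof -
    have "Gamma_ratio s \<le> L * exp (pi * Im s / 2) * 1"
      unfolding Gamma_ratio_def
    proof (intro mult_mono)
      show "norm (Gamma s) \<le> L" using norm_Gamma_le[of s] L[of "Re s"] s by linarith
      show "Im s powr (1/2 - Re s) \<le> 1"
        using powr_mono[of "1/2 - Re s" 0 "Im s"] s by simp
    qed (use L0 in auto)
    then have "E * Gamma_ratio s \<le> E * (L * exp (pi * Im s / 2))"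
      using \<open>E \<ge> 1\<close> by (intro mult_left_mono) auto
    then show ?thesis
      using h_ratio(1)[OF s] by (simp add: mult.assoc)
  qed
  \<comment> \<open>Reflection turns an upper bound for the other Gamma factor into a lower bound
    for \<open>Gamma s\<close>. That factor is taken at \<open>2 - s\<close> rather than
    \<open>1 - s\<close>, since the strip is symmetric under this map and \<open>L\<close> applies;
    the sine contributes the exponential growth.\<close>
  have inv_growth: "norm (inverse (h s)) \<le> 9 * E * L * exp ((pi / 2 + 1) * Im s)"
    if s: "1/2 \<le> Re s" "Re s \<le> 3/2" "Im s \<ge> 1" for s
  proof -
    have t: "Im s > 0" using s by simp
    have s1: "1 - s \<noteq> 0" using t by (auto simp: complex_eq_iff)
    have "sin (of_real pi * s) \<noteq> 0"
    proof
      assume "sin (of_real pi * s) = 0"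
      then have "Gamma s * Gamma (1 - s) = 0"
        using Gamma_reflection_complex[of s] by simp
      moreover have "s \<notin> \<int>\<^sub>\<le>\<^sub>0" "1 - s \<notin> \<int>\<^sub>\<le>\<^sub>0"
        using t by (auto elim!: nonpos_Ints_cases simp: complex_eq_iff)
      ultimately show False by (simp add: Gamma_eq_zero_iff)
    qed
    have "Gamma (1 - s + 1) = (1 - s) * Gamma (1 - s)"
      using t by (intro Gamma_plus1) (auto elim!: nonpos_Ints_cases simp: complex_eq_iff)
    then have eq: "Gamma s * Gamma (1 - s + 1) = (1 - s) * (of_real pi / sin (of_real pi * s))"
      by (simp only: mult.left_commute[of "Gamma s"] Gamma_reflection_complex)
    have "norm (Gamma s) * norm (Gamma (1 - s + 1)) * norm (sin (of_real pi * s)) = norm (1 - s) * pi"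
    proof -
      have "Gamma s * Gamma (1 - s + 1) * sin (of_real pi * s) = (1 - s) * of_real pi"
        unfolding eq using \<open>sin (of_real pi * s) \<noteq> 0\<close> by simp
      then have "norm (Gamma s * Gamma (1 - s + 1) * sin (of_real pi * s)) = norm ((1 - s) * of_real pi)"
        by (rule arg_cong)
      then show ?thesis by (simp only: norm_mult norm_of_real abs_of_nonneg pi_ge_zero)
    qed
    also have "norm (1 - s) * pi \<ge> 1 * 1"
      using pi_ge_two abs_Im_le_cmod[of "1 - s"] s by (intro mult_mono) auto
    finally have "1 \<le> norm (Gamma s) * norm (Gamma (1 - s + 1)) * norm (sin (of_real pi * s))" by simp
    also have "\<dots> \<le> norm (Gamma s) * L * exp (pi * Im s)"
    proof (intro mult_mono)
      show "norm (Gamma (1 - s + 1)) \<le> L"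
        using norm_Gamma_le[of "1 - s + 1"] L[of "Re (1 - s + 1)"] s by simp
      show "norm (sin (of_real pi * s)) \<le> exp (pi * Im s)"
        using norm_sin_le_exp[of "of_real pi * s"] t by simp
    qed (use L0 in auto)
    also have "norm (Gamma s) = Gamma_ratio s * exp (- (pi * Im s / 2)) * Im s powr (Re s - 1/2)"
    proof -
      have "Gamma_ratio s * exp (- (pi * Im s / 2)) * Im s powr (Re s - 1/2)
          = norm (Gamma s) * (exp (pi * Im s / 2) * exp (- (pi * Im s / 2)))
        * (Im s powr (1/2 - Re s) * Im s powr (Re s - 1/2))"
        by (simp only: Gamma_ratio_def mult_ac)
      also have "\<dots> = norm (Gamma s)"
        using t by (simp add: exp_add[symmetric] powr_add[symmetric] del: mult_minus_left)
      finally show ?thesis by simp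
    qed
    also have "Gamma_ratio s * exp (- (pi * Im s / 2)) * Im s powr (Re s - 1/2) * L * exp (pi * Im s)
        \<le> (3 * E * norm (h s)) * exp (- (pi * Im s / 2)) * exp (Im s) * L * exp (pi * Im s)"
    proof (intro mult_right_mono mult_mono)
      have "Im s powr (Re s - 1/2) \<le> Im s powr 1"
        using s by (intro powr_mono) auto
      also have "\<dots> \<le> exp (Im s)" using t exp_ge_add_one_self[of "Im s"] by (simp del: exp_ge_add_one_self)
      finally show "Im s powr (Re s - 1/2) \<le> exp (Im s)" .
    qed (use L0 h_ratio(2)[OF s] \<open>E \<ge> 1\<close> in auto)
    also have "\<dots> = (3 * E * norm (h s)) * L * exp ((pi / 2 + 1) * Im s)"
      by (simp add: exp_add[symmetric] mult.assoc) (simp add: algebra_simps exp_add exp_minus)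
    finally have *: "1 \<le> norm (h s) * (3 * E * L * exp ((pi / 2 + 1) * Im s))" by (simp add: mult_ac)
    have "norm (inverse (h s)) \<le> 3 * E * L * exp ((pi / 2 + 1) * Im s)"
      using * nz[OF t] by (subst norm_inverse_le_iff) (auto simp: mult_ac)
    also have "\<dots> \<le> 9 * E * L * exp ((pi / 2 + 1) * Im s)"
      using L0 \<open>E \<ge> 1\<close> by (intro mult_right_mono) auto
    finally show ?thesis .
  qed
  obtain K1 where K1: "K1 > 0" "\<And>s. 1/2 \<le> Re s \<Longrightarrow> Re s \<le> 3/2 \<Longrightarrow> Im s \<ge> 1 \<Longrightarrow> norm (h s) \<le> K1"
  proof (rule phragmen_lindelof_half_strip[OF hol, of 1 "1/2" "3/2" "E * L" "pi / 2" "9 * E"])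
    fix s assume s: "Re s = 1/2 \<or> Re s = 3/2" "Im s \<ge> 1"
    then have "norm (h s) \<le> E * Gamma_ratio s" by (intro h_ratio) auto
    also have "\<dots> \<le> E * 9" using edge[OF s] \<open>E \<ge> 1\<close> by (intro mult_left_mono) auto
    finally show "norm (h s) \<le> 9 * E" by simp
  qed (use growth in auto)
  obtain K2 where K2: "K2 > 0" "\<And>s. 1/2 \<le> Re s \<Longrightarrow> Re s \<le> 3/2 \<Longrightarrow> Im s \<ge> 1 \<Longrightarrow> norm (inverse (h s)) \<le> K2"
  proof (rule phragmen_lindelof_half_strip[of "\<lambda>s. inverse (h s)" 0 1 "1/2" "3/2" "9 * E * L" "pi / 2 + 1" "3 * E"])
    show "(\<lambda>s. inverse (h s)) holomorphic_on {s. 0 < Im s}"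
      using hol nz by (intro holomorphic_on_inverse) auto
    fix s assume s: "Re s = 1/2 \<or> Re s = 3/2" "Im s \<ge> 1"
    then have "Gamma_ratio s \<le> 3 * E * norm (h s)" by (intro h_ratio) auto
    then have "1 \<le> 3 * E * norm (h s)" using edge[OF s] by auto
    then show "norm (inverse (h s)) \<le> 3 * E"
      using nz[of s] s by (simp add: norm_inverse_le_iff)
  qed (use inv_growth in auto)
  define C where "C = max 1 (max (3 * E * K1) (E * K2))"
  show ?thesis
  proof (rule that[of C])
    fix s :: complex assume s: "1/2 \<le> Re s" "Re s \<le> 3/2" "Im s \<ge> 1"
    have "Gamma_ratio s \<le> 3 * E * K1"
      using h_ratio(2)[OF s] mult_left_mono[OF K1(2)[OF s], of "3 * E"] \<open>E \<ge> 1\<close> by linarith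
    moreover have "1 / C \<le> Gamma_ratio s"
    proof -
      have "1 \<le> K2 * norm (h s)"
        using K2(2)[OF s] nz[of s] s by (simp add: norm_inverse_le_iff)
      also have "\<dots> \<le> K2 * (E * Gamma_ratio s)"
        using K2(1) h_ratio(1)[OF s] by (intro mult_left_mono) auto
      also have "\<dots> = (E * K2) * Gamma_ratio s" by simp
      also have "\<dots> \<le> C * Gamma_ratio s"
        by (intro mult_right_mono) (auto simp: C_def Gamma_ratio_def)
      finally show ?thesis by (simp add: C_def field_simps)
    qed
    moreover have "3 * E * K1 \<le> C" by (simp add: C_def)
    ultimately show "Gamma_ratio s \<in> {1/C..C}" by simp
  qed (simp add: C_def)
qed

text \<open>Each step widens the strip by 1 on both sides, applying the recurrence upwards on the
  right and backwards on the left. The new factor \<open>m\<close> bounds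
  \<open>1 + \<bar>Re s\<bar>\<close> at every point where the recurrence is applied.\<close>

lemma Gamma_ratio_strip:
  "\<exists>C\<ge>1. \<forall>s. 1/2 - real n \<le> Re s \<and> Re s \<le> 3/2 + real n \<and> Im s \<ge> 1 \<longrightarrow> Gamma_ratio s \<in> {1/C..C}"
proof (induction n)
  case 0
  show ?case by (rule Gamma_ratio_strip_base) auto
next
  case (Suc n)
  then obtain C where C: "C \<ge> 1"
    "\<And>s. 1/2 - real n \<le> Re s \<Longrightarrow> Re s \<le> 3/2 + real n \<Longrightarrow> Im s \<ge> 1 \<Longrightarrow> Gamma_ratio s \<in> {1/C..C}"
    by blast
  define m where "m = real n + 3"
  have m: "m \<ge> 1" by (simp add: m_def)
  show ?case
  proof (intro exI[of _ "C * m"] conjI allI impI)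
    show "C * m \<ge> 1" using C(1) m mult_mono[of 1 C 1 m] by simp
    have weaken: "{1 / C..C} \<subseteq> {1 / (C * m)..C * m}"
      using C(1) m by (auto simp: field_simps intro: order.trans)
    fix s assume s: "1/2 - real (Suc n) \<le> Re s \<and> Re s \<le> 3/2 + real (Suc n) \<and> 1 \<le> Im s"
    consider "1/2 - real n \<le> Re s \<and> Re s \<le> 3/2 + real n" | "Re s > 3/2 + real n" | "Re s < 1/2 - real n"
      by linarith
    then show "Gamma_ratio s \<in> {1 / (C * m)..C * m}"
    proof cases
      case 1
      then show ?thesis using C(2)[of s] s weaken by blast
    next
      case 2
      define w where "w = s - 1"
      have w: "Gamma_ratio w \<in> {1/C..C}" "1 \<le> Im w" "\<bar>Re w\<bar> \<le> m - 1"
        using C(2)[of w] s 2 by (auto simp: w_def m_def)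
      have b: "1 \<le> norm w / Im w" "norm w / Im w \<le> m"
        using norm_div_Im_bounds[of w] w by auto
      have eq: "Gamma_ratio s = norm w / Im w * Gamma_ratio w"
        using Gamma_ratio_plus1[of w] w by (simp add: w_def)
      have nn: "Gamma_ratio w \<ge> 0" by (simp add: Gamma_ratio_def)
      have "1 * Gamma_ratio w \<le> Gamma_ratio s"
        unfolding eq using b(1) nn by (rule mult_right_mono)
      moreover have "Gamma_ratio s \<le> m * C"
        unfolding eq using b(2) w(1) nn m by (intro mult_mono) auto
      moreover have "1 / (C * m) \<le> 1 / C" using C(1) m by (simp add: field_simps)
      ultimately show ?thesis using w by (simp add: mult.commute)
    next
      case 3
      have w: "Gamma_ratio (s + 1) \<in> {1/C..C}" "\<bar>Re s\<bar> \<le> m - 1"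
        using C(2)[of "s + 1"] s 3 by (auto simp: m_def)
      have b: "1 \<le> norm s / Im s" "norm s / Im s \<le> m"
        using norm_div_Im_bounds[of s] s w by auto
      have eq: "Gamma_ratio (s + 1) = norm s / Im s * Gamma_ratio s"
        using Gamma_ratio_plus1[of s] s by simp
      have nn: "Gamma_ratio s \<ge> 0" by (simp add: Gamma_ratio_def)
      have "1 * Gamma_ratio s \<le> Gamma_ratio (s + 1)" "Gamma_ratio (s + 1) \<le> m * Gamma_ratio s"
        unfolding eq by (rule mult_right_mono[OF b(1) nn], rule mult_right_mono[OF b(2) nn])
      then have "Gamma_ratio s \<le> C" "1 / C \<le> m * Gamma_ratio s"
        using w by auto
      then have "Gamma_ratio s \<le> C * m" "1 / (C * m) \<le> Gamma_ratio s"
        using m C(1) nn mult_mono[of "Gamma_ratio s" C 1 m] by (auto simp: field_simps)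
      then show ?thesis by simp
    qed
  qed
qed

lemma Gamma_vertical_bounds:
  fixes A :: real
  obtains C where "C \<ge> 1"
    "\<And>s. \<bar>Re s\<bar> \<le> A \<Longrightarrow> Im s \<ge> 1 \<Longrightarrow> norm (Gamma s) \<le> C * Im s powr (Re s - 1/2) * exp (- (pi * Im s / 2))"
    "\<And>s. \<bar>Re s\<bar> \<le> A \<Longrightarrow> Im s \<ge> 1 \<Longrightarrow> 1 / norm (Gamma s) \<le> C * Im s powr (1/2 - Re s) * exp (pi * Im s / 2)"
proof -
  obtain n where n: "A \<le> real n" using real_arch_simple by blast
  \<comment> \<open>\<open>Suc n\<close> because the left end \<open>1/2 - n\<close> of the strip
    for \<open>n\<close> does not reach \<open>- n\<close>.\<close>
  obtain C where C: "C \<ge> 1"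
    "\<And>s. 1/2 - real (Suc n) \<le> Re s \<Longrightarrow> Re s \<le> 3/2 + real (Suc n) \<Longrightarrow> Im s \<ge> 1 \<Longrightarrow> Gamma_ratio s \<in> {1/C..C}"
    using Gamma_ratio_strip[of "Suc n"] by blast
  show ?thesis
  proof (rule that[OF C(1)])
    fix s :: complex assume s: "\<bar>Re s\<bar> \<le> A" "Im s \<ge> 1"
    define p where "p = Im s powr (Re s - 1/2) * exp (- (pi * Im s / 2))"
    have "p > 0" using s by (simp add: p_def)
    have "Gamma_ratio s * p = norm (Gamma s) * (exp (pi * Im s / 2) * exp (- (pi * Im s / 2)))
        * (Im s powr (1/2 - Re s) * Im s powr (Re s - 1/2))"
      by (simp only: Gamma_ratio_def p_def mult_ac)
    also have "\<dots> = norm (Gamma s)"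
      using s by (simp add: exp_add[symmetric] powr_add[symmetric] del: mult_minus_left)
    finally have eq: "norm (Gamma s) = Gamma_ratio s * p" by simp
    have b: "1 / C \<le> Gamma_ratio s" "Gamma_ratio s \<le> C"
      using C(2)[of s] s n by auto
    show "norm (Gamma s) \<le> C * Im s powr (Re s - 1/2) * exp (- (pi * Im s / 2))"
      using b \<open>p > 0\<close> unfolding eq mult.assoc p_def[symmetric] by (intro mult_right_mono) auto
    define x where "x = Im s powr (1/2 - Re s) * exp (pi * Im s / 2)"
    have e: "Re s - 1/2 = - (1/2 - Re s)" by simp
    have px: "p = 1 / x"
      unfolding e powr_minus exp_minus p_def x_def
      by (simp only: inverse_eq_divide[symmetric] inverse_mult_distrib)
    have "x > 0" using s by (simp add: x_def)
    have "1 / C > 0" using C(1) by simp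
    then have "Gamma_ratio s > 0" using b(1) by linarith
    then have "1 / Gamma_ratio s \<le> C"
      using b(1) C(1) by (simp add: field_simps)
    then have "1 / Gamma_ratio s * x \<le> C * x"
      using \<open>x > 0\<close> by (intro mult_right_mono) auto
    then show "1 / norm (Gamma s) \<le> C * Im s powr (1/2 - Re s) * exp (pi * Im s / 2)"
      unfolding eq px mult.assoc x_def[symmetric] by simp
  qed
qed

section \<open>Gaussian kernels and asymptotics\<close>

text \<open>An entire function of \<open>s\<close> that is the real Gaussian weight on
  \<open>Re s = x\<close>, so integrals against that weight can be moved to other lines. Away from
  \<open>Re s = x\<close> it picks up a bounded factor and a phase.\<close>

definition gauss_kernel :: "real \<Rightarrow> real \<Rightarrow> real \<Rightarrow> complex \<Rightarrow> complex" where
  "gauss_kernel x T G s = exp (((s - Complex x T) / of_real G)\<^sup>2)"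

lemma holomorphic_gauss_kernel [holomorphic_intros]:
  "f holomorphic_on A \<Longrightarrow> (\<lambda>s. gauss_kernel x T G (f s)) holomorphic_on A"
  unfolding gauss_kernel_def power2_eq_square divide_inverse by (intro holomorphic_intros)

lemma gauss_kernel_Complex:
  assumes "G > 0"
  shows "gauss_kernel x T G (Complex c t) =
    of_real (exp (((c - x) / G)\<^sup>2) * exp (- ((t - T) / G)\<^sup>2)) * exp (\<i> * of_real (2 * (c - x) * (t - T) / G\<^sup>2))"
proof -
  have "((Complex c t - Complex x T) / of_real G)\<^sup>2 =
      of_real (((c - x) / G)\<^sup>2) + of_real (- ((t - T) / G)\<^sup>2) + \<i> * of_real (2 * (c - x) * (t - T) / G\<^sup>2)"
    using assms by (simp add: complex_eq_iff power2_eq_square Re_divide Im_divide field_simps)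
  then show ?thesis
    unfolding gauss_kernel_def by (simp only: exp_add exp_of_real of_real_mult)
qed

lemma norm_gauss_kernel:
  assumes "G > 0"
  shows "norm (gauss_kernel x T G s) = exp (((Re s - x) / G)\<^sup>2) * exp (- ((Im s - T) / G)\<^sup>2)"
  using gauss_kernel_Complex[OF assms, of x T "Re s" "Im s"] by (simp add: norm_mult complex_eq)

lemma continuous_on_gauss [continuous_intros]:
  "continuous_on A (\<lambda>t. exp (- ((t - T) / G)\<^sup>2) :: real)"
  unfolding divide_inverse by (intro continuous_intros)

lemma integral_Icc_eq_lborel:
  fixes f :: "real \<Rightarrow> 'a::euclidean_space"
  assumes "integrable lborel f"
  shows "integral {a..b} f = (\<integral>t. indicat_real {a..b} t *\<^sub>R f t \<partial>lborel)"
proof -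
  have "set_integrable lborel {a..b} f"
    unfolding set_integrable_def using assms by (intro integrable_mult_indicator) auto
  from set_borel_integral_eq_integral(2)[OF this] show ?thesis
    by (simp add: set_lebesgue_integral_def)
qed

lemma integral_gauss_le:
  assumes "G > 0"
  shows "integral {a..b} (\<lambda>t. exp (- ((t - T) / G)\<^sup>2)) \<le> sqrt pi * G"
proof -
  have int: "integrable lborel (\<lambda>t. exp (- ((t - T) / G)\<^sup>2))"
    using has_bochner_integral_gauss_shift[OF assms] has_bochner_integral_iff by blast
  have "integral {a..b} (\<lambda>t. exp (- ((t - T) / G)\<^sup>2)) \<le> (\<integral>t. exp (- ((t - T) / G)\<^sup>2) \<partial>lborel)"
    unfolding integral_Icc_eq_lborel[OF int] by (intro integral_mono' int) (auto simp: indicator_def)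
  then show ?thesis using has_bochner_integral_integral_eq[OF has_bochner_integral_gauss_shift[OF assms]] by simp
qed

lemma integral_gauss_ge:
  fixes G H T :: real
  assumes "G > 0" "H \<ge> G"
  shows "exp (- 1) * G \<le> integral {T - H..T + H} (\<lambda>t. exp (- ((t - T) / G)\<^sup>2))"
proof -
  have "exp (- 1) * G = integral {T..T + G} (\<lambda>t. exp (- 1 :: real))"
    using assms by simp
  also have "\<dots> \<le> integral {T..T + G} (\<lambda>t. exp (- ((t - T) / G)\<^sup>2))"
  proof (rule integral_le)
    fix t assume t: "t \<in> {T..T + G}"
    then have "((t - T) / G)\<^sup>2 \<le> 1"
      using assms by (simp add: power_le_one)
    then show "exp (- 1) \<le> exp (- ((t - T) / G)\<^sup>2)" by simp
  qed (auto intro!: integrable_continuous_real continuous_intros)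
  also have "\<dots> \<le> integral {T - H..T + H} (\<lambda>t. exp (- ((t - T) / G)\<^sup>2))"
    using assms by (intro integral_subset_le) (auto intro!: integrable_continuous_real continuous_intros)
  finally show ?thesis .
qed

text \<open>Half of the Gaussian exponent is spent on the smallness
  \<open>exp (- (H / G)\<^sup>2 / 2)\<close> outside the window. The other half is a Gaussian of
  width \<open>sqrt 2 * G\<close>, which keeps the integral finite.\<close>

lemma gauss_tail_bound:
  fixes F :: "real \<Rightarrow> complex"
  assumes F: "integrable lborel F" and P: "\<And>t. norm (F t) \<le> P * exp (- ((t - T) / G)\<^sup>2)"
    and G: "G > 0" and H: "H \<ge> 0"
  shows "norm ((\<integral>t. F t \<partial>lborel) - integral {T - H..T + H} F) \<le> P * exp (- (H / G)\<^sup>2 / 2) * (sqrt pi * (sqrt 2 * G))"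
proof -
  have "norm (F T) \<le> P" using P[of T] by simp
  then have P0: "P \<ge> 0" using norm_ge_zero order.trans by blast
  let ?I = "indicat_real {T - H..T + H}"
  have intI: "integrable lborel (\<lambda>t. ?I t *\<^sub>R F t)"
    using F by (intro integrable_mult_indicator) auto
  have "(\<integral>t. F t \<partial>lborel) - integral {T - H..T + H} F = (\<integral>t. F t - ?I t *\<^sub>R F t \<partial>lborel)"
    unfolding integral_Icc_eq_lborel[OF F] using F intI by simp
  also have "norm \<dots> \<le> (\<integral>t. norm (F t - ?I t *\<^sub>R F t) \<partial>lborel)"
    by (rule integral_norm_bound)
  also have "\<dots> \<le> (\<integral>t. P * exp (- (H / G)\<^sup>2 / 2) * exp (- ((t - T) / (sqrt 2 * G))\<^sup>2) \<partial>lborel)"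
  proof (rule integral_mono')
    show "integrable lborel (\<lambda>t. P * exp (- (H / G)\<^sup>2 / 2) * exp (- ((t - T) / (sqrt 2 * G))\<^sup>2))"
      using has_bochner_integral_gauss_shift[of "sqrt 2 * G" T] G by (intro integrable_mult_right) (simp add: has_bochner_integral_iff)
    fix t
    show "0 \<le> P * exp (- (H / G)\<^sup>2 / 2) * exp (- ((t - T) / (sqrt 2 * G))\<^sup>2)" using P0 by simp
    show "norm (F t - ?I t *\<^sub>R F t) \<le> P * exp (- (H / G)\<^sup>2 / 2) * exp (- ((t - T) / (sqrt 2 * G))\<^sup>2)"
    proof (cases "t \<in> {T - H..T + H}")
      case True
      then show ?thesis using P0 by simp
    next
      case False
      have half: "((t - T) / (sqrt 2 * G))\<^sup>2 = ((t - T) / G)\<^sup>2 / 2"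
        by (simp add: power_mult_distrib power_divide)
      have "H\<^sup>2 \<le> (t - T)\<^sup>2"
        using False H by (intro abs_le_square_iff[THEN iffD1]) auto
      then have "(H / G)\<^sup>2 \<le> ((t - T) / G)\<^sup>2"
        using G by (simp add: power_divide divide_right_mono)
      then have "exp (- ((t - T) / G)\<^sup>2) \<le> exp (- (H / G)\<^sup>2 / 2) * exp (- ((t - T) / (sqrt 2 * G))\<^sup>2)"
        unfolding half exp_add[symmetric] by simp
      then have "P * exp (- ((t - T) / G)\<^sup>2) \<le> P * (exp (- (H / G)\<^sup>2 / 2) * exp (- ((t - T) / (sqrt 2 * G))\<^sup>2))"
        using P0 by (rule mult_left_mono)
      then show ?thesis using False P[of t] by (simp add: mult.assoc)
    qed
  qed
  also have "\<dots> = P * exp (- (H / G)\<^sup>2 / 2) * (sqrt pi * (sqrt 2 * G))"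
    using has_bochner_integral_mult_right[OF has_bochner_integral_gauss_shift[of "sqrt 2 * G" T]] G
    by (intro has_bochner_integral_integral_eq) auto
  finally show ?thesis .
qed

lemma powr_exp_decay:
  fixes p q C :: real
  assumes "q > 0"
  shows "((\<lambda>T::real. C * T powr p * exp (- (T powr q))) \<longlongrightarrow> 0) at_top"
proof -
  have "((\<lambda>T::real. T powr p * exp (- (T powr q))) \<longlongrightarrow> 0) at_top"
    using assms by real_asymp
  then have "((\<lambda>T::real. C * (T powr p * exp (- (T powr q)))) \<longlongrightarrow> C * 0) at_top"
    by (rule tendsto_mult_left)
  then show ?thesis by (simp add: mult.assoc)
qed

lemma eventually_powr_le_half:
  fixes p :: real
  assumes "p < 1"
  shows "\<forall>\<^sub>F T::real in at_top. T powr p \<le> T / 2"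
  using assms by real_asymp

lemma eventually_mult_powr_neg_le:
  fixes C p \<delta> :: real
  assumes "p < 0" "\<delta> > 0"
  shows "\<forall>\<^sub>F T::real in at_top. C * T powr p \<le> \<delta>"
proof -
  have "((\<lambda>T::real. C * T powr p) \<longlongrightarrow> C * 0) at_top"
    using tendsto_neg_powr[OF assms(1) filterlim_ident] by (rule tendsto_mult_left)
  then have "\<forall>\<^sub>F T in at_top. C * T powr p < \<delta>"
    using assms by (intro order_tendstoD) auto
  then show ?thesis by eventually_elim simp
qed

lemma eventually_powr_exp_le:
  fixes C p q \<delta> :: real
  assumes "q > 0" "\<delta> > 0"
  shows "\<forall>\<^sub>F T::real in at_top. C * T powr p * exp (- (T powr q)) \<le> \<delta>"
  using order_tendstoD(2)[OF powr_exp_decay[OF assms(1)] assms(2), of C p]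
  by eventually_elim simp

lemma eventually_powr_exp_half_le:
  fixes C p q \<delta> :: real
  assumes "q > 0" "\<delta> > 0"
  shows "\<forall>\<^sub>F T::real in at_top. C * T powr p * exp (- (T powr q) / 2) \<le> \<delta>"
proof -
  have "((\<lambda>T::real. T powr p * exp (- (T powr q) / 2)) \<longlongrightarrow> 0) at_top"
    using assms by real_asymp
  then have "((\<lambda>T::real. C * (T powr p * exp (- (T powr q) / 2))) \<longlongrightarrow> C * 0) at_top"
    by (rule tendsto_mult_left)
  then have "\<forall>\<^sub>F T in at_top. C * (T powr p * exp (- (T powr q) / 2)) < \<delta>"
    using assms by (intro order_tendstoD) auto
  then show ?thesis by eventually_elim (simp add: mult.assoc)
qed

lemma eventually_sin_inverse_ge: "\<forall>\<^sub>F T::real in at_top. sin (1 / T) \<ge> 1 / (2 * T)"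
  by real_asymp

lemma continuous_on_Gamma_Complex [continuous_intros]:
  assumes "c > 0"
  shows "continuous_on A (\<lambda>t. Gamma (Complex c t))"
proof (rule continuous_on_compose2[OF continuous_on_Gamma])
  show "{s. Re s > 0} \<inter> \<int>\<^sub>\<le>\<^sub>0 = {}" by (auto elim!: nonpos_Ints_cases)
qed (use assms in \<open>auto intro!: continuous_intros simp: Complex_eq\<close>)

text \<open>The sign is given as a constant factor, so that a modulus under an integral can be
  traded for a factor in front of it.\<close>

lemma continuous_nonzero_constant_sign:
  fixes f :: "real \<Rightarrow> real"
  assumes cont: "continuous_on {u..v} f" and nz: "\<And>t. t \<in> {u..v} \<Longrightarrow> f t \<noteq> 0"
  obtains \<sigma> where "\<bar>\<sigma>\<bar> = 1" "\<And>t. t \<in> {u..v} \<Longrightarrow> \<bar>f t\<bar> = \<sigma> * f t"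
proof -
  have "connected (f ` {u..v})" by (intro connected_continuous_image cont) auto
  then have no: "\<not> (f s < 0 \<and> f t > 0)" if "s \<in> {u..v}" "t \<in> {u..v}" for s t
    using nz connectedD_interval[of "f ` {u..v}" "f s" "f t" 0] that by fastforce
  show ?thesis
  proof (cases "\<exists>s\<in>{u..v}. f s < 0")
    case True
    then show ?thesis using no nz by (intro that[of "-1"]) (auto, force)
  next
    case False
    then show ?thesis by (intro that[of 1]) (auto simp: not_less abs_of_nonneg)
  qed
qed

section \<open>Self-dual Dirichlet series\<close>

text \<open>The point \<open>of_real r - cnj s\<close> is the mirror image of \<open>s\<close> in
  the line \<open>Re s = r/2\<close>, so on that line \<open>fun_eq\<close> says that
  \<open>Gamma s * \<phi> s\<close> is real. Holomorphy and the functional equation are recorded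
  only for \<open>Im s > t0\<close>, above the pole at \<open>r\<close> and the poles of
  \<open>Gamma\<close>. From the decay of the completed function just a bound is kept, as growth
  hypothesis for Phragmen-Lindelof.\<close>

locale self_dual_dirichlet =
  fixes r \<sigma>a t0 :: real and lam :: "nat \<Rightarrow> real" and a :: "nat \<Rightarrow> complex" and \<phi> :: "complex \<Rightarrow> complex"
  assumes r_pos: "r > 0"
    and lam_pos: "n \<ge> 1 \<Longrightarrow> lam n > 0"
    and lam_mono: "strict_mono_on {1..} lam"
    and a_nz: "\<exists>n\<ge>1. a n \<noteq> 0"
    and summable_coeff: "c > \<sigma>a \<Longrightarrow> summable (\<lambda>n. norm (a (Suc n)) * lam (Suc n) powr (- c))"
    and phi_sum: "Re s > \<sigma>a \<Longrightarrow> \<phi> s = dirichlet_sum lam a s"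
    and t0: "t0 \<ge> 1"
    and hol: "\<phi> holomorphic_on {s. Im s > t0}"
    and fun_eq: "Im s > t0 \<Longrightarrow> Gamma s * \<phi> s = cnj (Gamma (of_real r - cnj s) * \<phi> (of_real r - cnj s))"
    and decay: "\<exists>B. \<forall>s. \<sigma>1 \<le> Re s \<longrightarrow> Re s \<le> \<sigma>2 \<longrightarrow> B \<le> Im s \<longrightarrow> norm (Gamma s * \<phi> s) \<le> 1"
begin

definition coeff_sum :: "real \<Rightarrow> real" where
  "coeff_sum c = (\<Sum>n. norm (a (Suc n)) * lam (Suc n) powr (- c))"

lemma norm_dirichlet_term:
  "norm (dirichlet_term lam a s (Suc n)) = norm (a (Suc n)) * lam (Suc n) powr (- Re s)"
  using lam_pos[of "Suc n"] by (simp add: dirichlet_term_def norm_mult norm_powr_real_powr)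

lemma coeff_sum_nonneg: "c > \<sigma>a \<Longrightarrow> coeff_sum c \<ge> 0"
  unfolding coeff_sum_def by (intro suminf_nonneg summable_coeff) auto

lemma summable_dirichlet_term:
  "Re s > \<sigma>a \<Longrightarrow> summable (\<lambda>n. norm (dirichlet_term lam a s (Suc n)))"
  unfolding norm_dirichlet_term by (rule summable_coeff)

lemma norm_phi_le: "Re s > \<sigma>a \<Longrightarrow> norm (\<phi> s) \<le> coeff_sum (Re s)"
  using summable_norm[OF summable_dirichlet_term, of s]
  by (simp add: phi_sum dirichlet_sum_def coeff_sum_def norm_dirichlet_term)

lemma Gamma_hol_upper: "Gamma holomorphic_on {s. Im s > t0}"
  using t0 by (intro holomorphic_intros) (auto elim!: nonpos_Ints_cases)

lemma Gamma_nonzero_upper: "Im s > t0 \<Longrightarrow> Gamma s \<noteq> 0"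
  using t0 by (auto simp: Gamma_eq_zero_iff elim!: nonpos_Ints_cases)

section \<open>Polynomial growth in vertical strips\<close>

text \<open>With \<open>w = of_real r - cnj s\<close> the functional equation gives
  \<open>norm (\<phi> s)\<close> as \<open>norm (\<phi> w)\<close> times the quotient of two Gamma
  moduli at the same height. The exponentials cancel and the powers combine to
  \<open>(c - 1/2) + (1/2 - (r - c)) = 2 * c - r\<close>.\<close>

lemma phi_reflected_bound:
  assumes c: "c > \<sigma>a"
  obtains C where "C > 0" "\<And>s. Re s = r - c \<Longrightarrow> Im s > t0 \<Longrightarrow> norm (\<phi> s) \<le> C * Im s powr (2 * c - r)"
proof -
  define b where "b = \<bar>c\<bar> + r"
  obtain C where C: "C \<ge> 1"
    "\<And>s. \<bar>Re s\<bar> \<le> b \<Longrightarrow> Im s \<ge> 1 \<Longrightarrow> norm (Gamma s) \<le> C * Im s powr (Re s - 1/2) * exp (- (pi * Im s / 2))"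
    "\<And>s. \<bar>Re s\<bar> \<le> b \<Longrightarrow> Im s \<ge> 1 \<Longrightarrow> 1 / norm (Gamma s) \<le> C * Im s powr (1/2 - Re s) * exp (pi * Im s / 2)"
    using Gamma_vertical_bounds[of b] by blast
  have nn: "coeff_sum c \<ge> 0" by (rule coeff_sum_nonneg[OF c])
  have "norm (\<phi> s) \<le> (C * C * coeff_sum c + 1) * Im s powr (2 * c - r)" if s: "Re s = r - c" "Im s > t0" for s
  proof -
    define w where "w = of_real r - cnj s"
    have w: "Re w = c" "Im w = Im s" using s by (auto simp: w_def)
    have sb: "\<bar>Re s\<bar> \<le> b" "Im s \<ge> 1" and wb: "\<bar>Re w\<bar> \<le> b" "Im w \<ge> 1"
      using s r_pos t0 w by (auto simp: b_def)
    have "norm (\<phi> s) = norm (Gamma s * \<phi> s) * (1 / norm (Gamma s))"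
      using Gamma_nonzero_upper[OF s(2)] by (simp add: norm_mult)
    also have "norm (Gamma s * \<phi> s) = norm (Gamma w) * norm (\<phi> w)"
      unfolding fun_eq[OF s(2)] w_def[symmetric] by (simp only: complex_mod_cnj norm_mult)
    also have "norm (Gamma w) * norm (\<phi> w) * (1 / norm (Gamma s)) \<le>
       (C * Im s powr (c - 1/2) * exp (- (pi * Im s / 2))) * coeff_sum c * (C * Im s powr (1/2 - (r - c)) * exp (pi * Im s / 2))"
    proof (intro mult_mono)
      show "norm (Gamma w) \<le> C * Im s powr (c - 1/2) * exp (- (pi * Im s / 2))"
        using C(2)[OF wb] w by simp
      show "norm (\<phi> w) \<le> coeff_sum c" using norm_phi_le[of w] w c by simp
      show "1 / norm (Gamma s) \<le> C * Im s powr (1/2 - (r - c)) * exp (pi * Im s / 2)"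
        using C(3)[OF sb] s by simp
    qed (use C(1) nn in auto)
    also have "\<dots> = C * C * coeff_sum c * (Im s powr (c - 1/2) * Im s powr (1/2 - (r - c))) * (exp (- (pi * Im s / 2)) * exp (pi * Im s / 2))"
      by (simp only: mult_ac)
    also have "\<dots> = C * C * coeff_sum c * Im s powr (2 * c - r)"
      by (simp add: powr_add[symmetric] exp_add[symmetric] del: mult_minus_left)
    also have "\<dots> \<le> (C * C * coeff_sum c + 1) * Im s powr (2 * c - r)"
      by (intro mult_right_mono) auto
    finally show ?thesis .
  qed
  moreover have "C * C * coeff_sum c + 1 > 0" using C(1) nn by (simp add: add_nonneg_pos)
  ultimately show ?thesis using that by blast
qed

text \<open>Interpolation between the line \<open>Re s = b\<close> of absolute convergence and its
  reflection \<open>Re s = r - b\<close>. The a priori growth comes from \<open>decay\<close>: where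
  \<open>Gamma s * \<phi> s\<close> is at most 1 in modulus, \<phi> is at most
  \<open>1 / norm (Gamma s)\<close>, hence at most exponential.\<close>

lemma phi_poly_bound:
  fixes \<beta> :: real
  obtains K t1 and M :: nat where "K > 0" "t1 > t0"
    "\<And>s. \<bar>Re s\<bar> \<le> \<beta> \<Longrightarrow> Im s \<ge> t1 \<Longrightarrow> norm (\<phi> s) \<le> K * Im s ^ M"
proof -
  \<comment> \<open>Chosen so that \<open>[r - b, b]\<close> contains the given range of real parts
    while the series converges absolutely on \<open>Re s = b\<close>.\<close>
  define b where "b = max (\<bar>\<beta>\<bar> + r) (\<sigma>a + 1)"
  have b: "b > \<sigma>a" "b \<ge> \<bar>\<beta>\<bar>" "r - b \<le> - \<bar>\<beta>\<bar>" "b \<ge> r" "b > 0"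
    using r_pos by (auto simp: b_def)
  obtain B where B: "\<And>s. r - b \<le> Re s \<Longrightarrow> Re s \<le> b \<Longrightarrow> B \<le> Im s \<Longrightarrow> norm (Gamma s * \<phi> s) \<le> 1"
    using decay[of "r - b" b] by blast
  define t1 where "t1 = max (t0 + 1) B"
  have t1: "t1 > t0" "t1 \<ge> B" "t1 \<ge> 1" using t0 by (auto simp: t1_def)
  obtain C where C: "C \<ge> 1"
    "\<And>s. \<bar>Re s\<bar> \<le> b \<Longrightarrow> Im s \<ge> 1 \<Longrightarrow> norm (Gamma s) \<le> C * Im s powr (Re s - 1/2) * exp (- (pi * Im s / 2))"
    "\<And>s. \<bar>Re s\<bar> \<le> b \<Longrightarrow> Im s \<ge> 1 \<Longrightarrow> 1 / norm (Gamma s) \<le> C * Im s powr (1/2 - Re s) * exp (pi * Im s / 2)"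
    using Gamma_vertical_bounds[of b] by blast
  obtain C' where C': "C' > 0" "\<And>s. Re s = r - b \<Longrightarrow> Im s > t0 \<Longrightarrow> norm (\<phi> s) \<le> C' * Im s powr (2 * b - r)"
    using phi_reflected_bound[OF b(1)] by blast
  \<comment> \<open>An integral exponent, so that dividing by \<open>s ^ M\<close> keeps the
    function holomorphic and bounded on both edges.\<close>
  define M where "M = nat \<lceil>2 * b - r\<rceil>"
  have M: "real M \<ge> 2 * b - r" unfolding M_def by linarith
  define f where "f s = \<phi> s / s ^ M" for s
  have norm_ge: "norm s \<ge> Im s" for s :: complex using abs_Im_le_cmod[of s] by linarith
  have norm_f: "norm (f s) \<le> norm (\<phi> s) / Im s ^ M" if "Im s \<ge> 1" for s
    unfolding f_def norm_divide norm_power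
    using that norm_ge[of s] by (intro divide_left_mono power_mono mult_pos_pos zero_less_power) auto
  obtain K where K: "K > 0" "\<And>s. r - b \<le> Re s \<Longrightarrow> Re s \<le> b \<Longrightarrow> Im s \<ge> t1 \<Longrightarrow> norm (f s) \<le> K"
  proof (rule phragmen_lindelof_half_strip[of f t0 t1 "r - b" b C "1/2 + b + pi / 2" "max (coeff_sum b) C'"])
    show "f holomorphic_on {s. Im s > t0}"
      unfolding f_def using t0 by (intro holomorphic_intros hol) auto
    show "t0 < t1" by (rule t1)
  next
    fix s assume s: "r - b \<le> Re s" "Re s \<le> b" "Im s \<ge> t1"
    then have s': "\<bar>Re s\<bar> \<le> b" "Im s \<ge> 1" using b r_pos t1 by auto
    have "norm (\<phi> s) = norm (Gamma s * \<phi> s) * (1 / norm (Gamma s))"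
      using Gamma_nonzero_upper[of s] s t1 by (simp add: norm_mult)
    also have "\<dots> \<le> 1 * (C * Im s powr (1/2 - Re s) * exp (pi * Im s / 2))"
      using B[of s] s t1 C(3)[OF s'] by (intro mult_mono) auto
    also have "\<dots> \<le> C * exp ((1/2 + b) * Im s) * exp (pi * Im s / 2)"
    proof -
      have "Im s powr (1/2 - Re s) \<le> Im s powr (1/2 + b)"
        using s' by (intro powr_mono) auto
      also have "\<dots> = exp ((1/2 + b) * ln (Im s))" using s' by (simp add: powr_def)
      also have "\<dots> \<le> exp ((1/2 + b) * Im s)"
        using s' b ln_le_minus_one[of "Im s"] by (intro exp_le_cancel_iff[THEN iffD2] mult_left_mono) linarith+
      finally show ?thesis using C(1) by (auto intro!: mult_right_mono mult_left_mono)
    qed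
    also have "\<dots> = C * exp ((1/2 + b + pi / 2) * Im s)"
      by (simp add: exp_add[symmetric] algebra_simps mult.assoc)
    finally have "norm (\<phi> s) \<le> C * exp ((1/2 + b + pi / 2) * Im s)" .
    moreover have "norm (\<phi> s) / Im s ^ M \<le> norm (\<phi> s) / 1"
      using s' by (intro divide_left_mono) auto
    ultimately show "norm (f s) \<le> C * exp ((1/2 + b + pi / 2) * Im s)"
      using norm_f[OF s'(2)] by simp
  next
    fix s assume s: "Re s = r - b \<or> Re s = b" "Im s \<ge> t1"
    have "norm (\<phi> s) \<le> max (coeff_sum b) C' * Im s ^ M"
    proof (cases "Re s = b")
      case True
      then have "norm (\<phi> s) \<le> coeff_sum b" using norm_phi_le[of s] b by simp
      also have "\<dots> \<le> max (coeff_sum b) C' * 1" by simp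
      also have "\<dots> \<le> max (coeff_sum b) C' * Im s ^ M"
        using s t1 coeff_sum_nonneg[OF b(1)] by (intro mult_left_mono) auto
      finally show ?thesis .
    next
      case False
      have "norm (\<phi> s) \<le> C' * Im s powr (2 * b - r)"
        using False s t1 by (intro C') auto
      also have "\<dots> \<le> max (coeff_sum b) C' * Im s ^ M"
      proof (rule mult_mono)
        have "Im s powr (2 * b - r) \<le> Im s powr real M" using M s t1 by (intro powr_mono) auto
        then show "Im s powr (2 * b - r) \<le> Im s ^ M" using s t1 by (simp add: powr_realpow)
      qed (use coeff_sum_nonneg[OF b(1)] in auto)
      finally show ?thesis .
    qed
    moreover have "Im s ^ M > 0" "Im s \<ge> 1" using s t1 by auto
    ultimately show "norm (f s) \<le> max (coeff_sum b) C'"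
      using norm_f[of s] by (smt (verit) divide_le_eq)
  qed auto
  show ?thesis
  proof (rule that[of "K * (b + 1) ^ M" t1 M])
    show "K * (b + 1) ^ M > 0" using K(1) b by simp
    fix s assume s: "\<bar>Re s\<bar> \<le> \<beta>" "Im s \<ge> t1"
    have "s \<noteq> 0" using s t1 by auto
    have "norm (f s) \<le> K" using s b by (intro K) auto
    then have "norm (\<phi> s) \<le> K * norm s ^ M"
      using \<open>s \<noteq> 0\<close> by (simp add: f_def norm_divide norm_power field_simps)
    also have "norm s \<le> (b + 1) * Im s"
    proof -
      have "norm s / Im s \<le> 1 + \<bar>Re s\<bar>" using norm_div_Im_bounds[of s] s t1 by simp
      also have "\<dots> \<le> b + 1" using s b by linarith
      finally show ?thesis using s t1 by (simp add: field_simps)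
    qed
    then have "K * norm s ^ M \<le> K * ((b + 1) * Im s) ^ M"
      using K(1) by (intro mult_left_mono power_mono) auto
    finally show "norm (\<phi> s) \<le> K * (b + 1) ^ M * Im s ^ M"
      by (simp add: power_mult_distrib)
  qed (use t1 in auto)
qed

section \<open>The leading term and mean values from below\<close>

text \<open>Multiplying by \<open>lam N powr s\<close>, with \<open>N\<close> the first index of a
  nonzero coefficient, makes the leading term constant. Compared with the convergent series at the
  fixed abscissa \<open>c1\<close>, every later term gains \<open>\<rho> powr (Re s - c1)\<close>,
  and \<open>\<rho> < 1\<close> as the exponents increase strictly.\<close>

lemma phi_leading_coeff:
  obtains N where "N \<ge> 1" "a N \<noteq> 0"
    "\<And>\<delta>. \<delta> > 0 \<Longrightarrow> \<forall>\<^sub>F c in at_top. \<forall>s. Re s = c \<longrightarrow>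
       norm (\<phi> s * exp (s * of_real (ln (lam N))) - a N) \<le> \<delta>"
proof -
  define N where "N = (LEAST n. n \<ge> 1 \<and> a n \<noteq> 0)"
  have N: "N \<ge> 1" "a N \<noteq> 0"
    using LeastI_ex[of "\<lambda>n. n \<ge> 1 \<and> a n \<noteq> 0"] a_nz unfolding N_def by auto
  have zero: "a n = 0" if "n \<ge> 1" "n < N" for n
    using not_less_Least[of n "\<lambda>n. n \<ge> 1 \<and> a n \<noteq> 0"] that unfolding N_def by auto
  define L where "L = lam N"
  define \<rho> where "\<rho> = L / lam (Suc N)"
  have L: "L > 0" using lam_pos N by (simp add: L_def)
  have \<rho>: "0 < \<rho>" "\<rho> < 1"
    using lam_pos[of "Suc N"] N L strict_mono_onD[OF lam_mono, of N "Suc N"] by (auto simp: \<rho>_def L_def)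
  define c1 where "c1 = \<sigma>a + 1"
  have bound: "norm (\<phi> s * exp (s * of_real (ln L)) - a N) \<le> \<rho> powr (Re s - c1) * (L powr c1 * coeff_sum c1)"
    if s: "Re s \<ge> c1" for s
  proof -
    \<comment> \<open>Summation runs over \<open>Suc n\<close>, so the leading term sits at
      \<open>n = N - 1\<close>. Subtracting it there leaves only terms with
      \<open>Suc n > N\<close>.\<close>
    define u where "u n = dirichlet_term lam a s (Suc n) * exp (s * of_real (ln L)) - (if n = N - 1 then a N else 0)" for n
    have sm: "summable (\<lambda>n. dirichlet_term lam a s (Suc n))"
      using s by (intro summable_norm_cancel[OF summable_dirichlet_term]) (simp add: c1_def)
    have "(\<lambda>n. dirichlet_term lam a s (Suc n) * exp (s * of_real (ln L))) sums (\<phi> s * exp (s * of_real (ln L)))"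
      using sm s by (intro sums_mult2) (simp add: phi_sum c1_def dirichlet_sum_def summable_sums)
    moreover have "(\<lambda>n. if n = N - 1 then a N else 0) sums a N"
      using sums_single[of "N - 1" "\<lambda>_. a N"] by simp
    ultimately have u_sums: "u sums (\<phi> s * exp (s * of_real (ln L)) - a N)"
      unfolding u_def by (rule sums_diff)
    define g where "g n = \<rho> powr (Re s - c1) * (L powr c1 * (norm (a (Suc n)) * lam (Suc n) powr (- c1)))" for n
    have g_sums: "g sums (\<rho> powr (Re s - c1) * (L powr c1 * coeff_sum c1))"
      unfolding g_def coeff_sum_def by (intro sums_mult summable_sums summable_coeff) (simp add: c1_def)
    have expL: "exp (s * of_real (ln L)) = of_real L powr s"
      using L by (simp add: powr_def Ln_of_real)
    have u_le: "norm (u n) \<le> g n" for n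
    proof -
      consider "Suc n < N" | "Suc n = N" | "Suc n > N" by linarith
      then show ?thesis
      proof cases
        case 1
        then have "u n = 0" using zero[of "Suc n"] by (auto simp: u_def dirichlet_term_def)
        then show ?thesis by (simp add: g_def)
      next
        case 2
        then have n: "n = N - 1" by simp
        have "u n = a N * (of_real L powr (- s) * of_real L powr s) - a N"
          unfolding u_def dirichlet_term_def expL 2 L_def[symmetric] by (simp add: n mult.assoc)
        then have "u n = 0" using L by (simp add: powr_minus)
        then show ?thesis by (simp add: g_def)
      next
        case 3
        define l where "l = lam (Suc n)"
        have l: "l \<ge> lam (Suc N)" "l > 0"
        proof -
          show "l \<ge> lam (Suc N)" unfolding l_def
            using 3 strict_mono_on_leD[OF lam_mono, of "Suc N" "Suc n"] by auto
          show "l > 0" using lam_pos by (simp add: l_def)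
        qed
        have nu: "norm (u n) = norm (a (Suc n)) * (l powr (- Re s) * L powr Re s)"
          using 3 L N by (auto simp: u_def norm_mult norm_dirichlet_term expL norm_powr_real_powr l_def)
        have "l powr (- Re s) * L powr Re s = (L / l) powr (Re s - c1) * (L powr c1 * l powr (- c1))"
          using L l by (simp add: powr_divide powr_diff powr_minus field_simps)
        also have "\<dots> \<le> \<rho> powr (Re s - c1) * (L powr c1 * l powr (- c1))"
        proof (intro mult_right_mono powr_mono2)
          show "L / l \<le> \<rho>" unfolding \<rho>_def using l L lam_pos[of "Suc N"] by (intro divide_left_mono) auto
        qed (use s L l in auto)
        finally have "norm (u n) \<le> norm (a (Suc n)) * (\<rho> powr (Re s - c1) * (L powr c1 * l powr (- c1)))"
          unfolding nu by (rule mult_left_mono) simp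
        then show ?thesis by (simp add: g_def l_def mult_ac)
      qed
    qed
    show ?thesis
      using u_sums g_sums u_le by (metis norm_suminf_le sums_iff)
  qed
  have "\<forall>\<^sub>F c in at_top. \<forall>s. Re s = c \<longrightarrow> norm (\<phi> s * exp (s * of_real (ln (lam N))) - a N) \<le> \<delta>"
    if \<delta>: "\<delta> > 0" for \<delta>
  proof -
    have "((\<lambda>c::real. \<rho> powr (c - c1)) \<longlongrightarrow> 0) at_top"
      using \<rho> by real_asymp
    then have "((\<lambda>c. \<rho> powr (c - c1) * (L powr c1 * coeff_sum c1)) \<longlongrightarrow> 0 * (L powr c1 * coeff_sum c1)) at_top"
      by (rule tendsto_mult_right)
    then have "\<forall>\<^sub>F c in at_top. \<rho> powr (c - c1) * (L powr c1 * coeff_sum c1) < \<delta>"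
      using \<delta> by (intro order_tendstoD) auto
    then show ?thesis
      using eventually_ge_at_top[of c1]
      by eventually_elim (use bound L_def in force)
  qed
  with N show ?thesis using that by blast
qed

lemma continuous_on_vertical:
  assumes "f holomorphic_on {s. Im s > t0}" "u > t0"
  shows "continuous_on {u..v} (\<lambda>t. f (Complex x t))"
  by (rule continuous_on_compose2[OF holomorphic_on_imp_continuous_on[OF assms(1)]])
     (use assms(2) in \<open>auto intro!: continuous_intros simp: Complex_eq\<close>)

lemma upper_open: "open {s. Im s > t0}" and upper_convex: "convex {s. Im s > t0}"
  by (auto intro: open_halfspace_Im_gt convex_halfspace_Im_gt)

text \<open>The abscissa \<open>x\<close> is arbitrary; it may lie far to the left of the half-plane
  of convergence. On the right-hand line \<open>\<phi> s * exp (s * l)\<close> is close to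
  \<open>a N\<close>, but the kernel is no longer real there: it carries a phase of order
  \<open>T powr (\<eta> - \<gamma>)\<close> in the window. The condition
  \<open>\<eta> < \<gamma>\<close> makes this small and so rules out cancellation.\<close>

lemma phi_mean_lower:
  assumes \<eta>: "0 < \<eta>" "\<eta> < \<gamma>" "\<gamma> + \<eta> < 1"
  obtains k where "k > 0"
    "\<forall>\<^sub>F T in at_top. k * T powr \<gamma> \<le> integral {T - T powr (\<gamma> + \<eta>)..T + T powr (\<gamma> + \<eta>)}
        (\<lambda>t. norm (\<phi> (Complex x t)) * exp (- ((t - T) / T powr \<gamma>)\<^sup>2))"
proof -
  obtain N where N: "N \<ge> 1" "a N \<noteq> 0"
    "\<And>\<delta>. \<delta> > 0 \<Longrightarrow> \<forall>\<^sub>F c in at_top. \<forall>s. Re s = c \<longrightarrow>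
       norm (\<phi> s * exp (s * of_real (ln (lam N))) - a N) \<le> \<delta>"
    using phi_leading_coeff by blast
  define A where "A = norm (a N)"
  have A: "A > 0" using N by (simp add: A_def)
  define l where "l = ln (lam N)"
  have "\<forall>\<^sub>F c in at_top. (\<forall>s. Re s = c \<longrightarrow> norm (\<phi> s * exp (s * of_real l) - a N) \<le> A / 4) \<and> c \<ge> x"
    using N(3)[of "A / 4"] A by (intro eventually_conj eventually_ge_at_top) (auto simp: l_def)
  then obtain c where c: "\<And>s. Re s = c \<Longrightarrow> norm (\<phi> s * exp (s * of_real l) - a N) \<le> A / 4" "c \<ge> x"
    by (metis (mono_tags, lifting) eventually_happens trivial_limit_at_top_linorder)
  define \<kappa> where "\<kappa> = c - x"
  have \<kappa>: "\<kappa> \<ge> 0" using c by (simp add: \<kappa>_def)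
  define \<beta> where "\<beta> = max \<bar>x\<bar> \<bar>c\<bar>"
  obtain K t1 and M :: nat where K: "K > 0" "t1 > t0"
    "\<And>s. \<bar>Re s\<bar> \<le> \<beta> \<Longrightarrow> Im s \<ge> t1 \<Longrightarrow> norm (\<phi> s) \<le> K * Im s ^ M"
    using phi_poly_bound[of \<beta>] by blast
  \<comment> \<open>Bound for the integrand on the horizontal edges, where
    \<open>\<bar>Im s - T\<bar> = H\<close> and
    \<open>(H / G)\<^sup>2 = T powr (2 * \<eta>)\<close>; as \<open>G \<ge> 1\<close>, the lateral
    factor of the kernel is at most \<open>exp (\<kappa>\<^sup>2)\<close>.\<close>
  define Bd where "Bd T = K * (2 * T) ^ M * exp (\<bar>l\<bar> * \<beta>) * (exp (\<kappa>\<^sup>2) * exp (- (T powr (2 * \<eta>))))" for T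
  \<comment> \<open>Half of the main term \<open>A * D\<close> is given up for the error of the
    leading coefficient and for the phase, an eighth of \<open>A * exp (- 1) * G\<close> for the
    horizontal edges. More than a quarter remains; \<open>exp (x * l)\<close> is the modulus of the
    normalising factor on \<open>Re s = x\<close>.\<close>
  define k where "k = A * exp (- 1) / (4 * exp (x * l))"
  have k: "k > 0" using A by (simp add: k_def)
  have "\<forall>\<^sub>F T in at_top. (2 * \<kappa> * K * 2 ^ M * exp (\<bar>l\<bar> * \<beta>) * exp (\<kappa>\<^sup>2)) * T powr real M * exp (- (T powr (2 * \<eta>))) \<le> A * exp (- 1) / 8"
    using \<eta> A by (intro eventually_powr_exp_le) auto
  moreover have "\<forall>\<^sub>F T in at_top. (2 * \<kappa>) * T powr (\<eta> - \<gamma>) \<le> 1 / 4"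
    using \<eta> by (intro eventually_mult_powr_neg_le) auto
  moreover have "\<forall>\<^sub>F T in at_top. T powr (\<gamma> + \<eta>) \<le> T / 2"
    using \<eta> by (intro eventually_powr_le_half)
  moreover have "\<forall>\<^sub>F T in at_top. T \<ge> 2 * t1" by (rule eventually_ge_at_top)
  ultimately have "\<forall>\<^sub>F T in at_top. k * T powr \<gamma> \<le> integral {T - T powr (\<gamma> + \<eta>)..T + T powr (\<gamma> + \<eta>)}
        (\<lambda>t. norm (\<phi> (Complex x t)) * exp (- ((t - T) / T powr \<gamma>)\<^sup>2))"
  proof eventually_elim
    case (elim T)
    define G where "G = T powr \<gamma>"
    define H where "H = T powr (\<gamma> + \<eta>)"
    have T: "T \<ge> 1" "T > 0" using elim(4) K(2) t0 by auto
    have G: "G \<ge> 1" using T \<eta> by (simp add: G_def ge_one_powr_ge_zero)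
    have HG: "H \<ge> G" unfolding H_def G_def using T \<eta> by (intro powr_mono) auto
    have HT: "H \<le> T / 2" using elim(3) by (simp add: H_def)
    have HG2: "(H / G)\<^sup>2 = T powr (2 * \<eta>)"
    proof -
      have "H / G = T powr \<eta>" using T by (simp add: H_def G_def powr_add)
      then show ?thesis by (simp add: power2_eq_square powr_add[symmetric])
    qed
    have range: "t > t0 \<and> t \<ge> t1 \<and> 0 \<le> t \<and> t \<le> 2 * T" if "t \<in> {T - H..T + H}" for t
      using that HT elim(4) K(2) t0 by auto
    have Bd2: "2 * Bd T * \<kappa> \<le> A * exp (- 1) / 8 * G"
    proof -
      have "2 * Bd T * \<kappa> = (2 * \<kappa> * K * 2 ^ M * exp (\<bar>l\<bar> * \<beta>) * exp (\<kappa>\<^sup>2)) * T powr real M * exp (- (T powr (2 * \<eta>)))"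
        using T by (simp add: Bd_def power_mult_distrib powr_realpow mult_ac)
      also have "\<dots> \<le> A * exp (- 1) / 8 * 1" using elim(1) by simp
      also have "\<dots> \<le> A * exp (- 1) / 8 * G" using G A by (intro mult_left_mono) auto
      finally show ?thesis .
    qed
    define Q where "Q s = \<phi> s * exp (s * of_real l) * gauss_kernel x T G s" for s
    have holQ: "Q holomorphic_on {s. Im s > t0}"
      unfolding Q_def by (intro holomorphic_intros hol)
    have contQ: "continuous_on {T - H..T + H} (\<lambda>t. Q (Complex y t))" for y
      using holQ range[of "T - H"] HG G by (intro continuous_on_vertical) auto
    have contphi: "continuous_on {T - H..T + H} (\<lambda>t. \<phi> (Complex y t))" for y
      using hol range[of "T - H"] HG G by (intro continuous_on_vertical) auto
    have shift: "norm (integral {T - H..T + H} (\<lambda>t. Q (Complex x t)) - integral {T - H..T + H} (\<lambda>t. Q (Complex c t))) \<le> 2 * Bd T * (c - x)"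
    proof (rule vertical_line_shift[OF holQ upper_open upper_convex])
      fix s assume s: "x \<le> Re s" "Re s \<le> c" "Im s = T - H \<or> Im s = T + H"
      have Res: "\<bar>Re s\<bar> \<le> \<beta>" using s by (auto simp: \<beta>_def)
      have Ims: "Im s \<in> {T - H..T + H}" using s HG G by auto
      have "((Im s - T) / G)\<^sup>2 = (H / G)\<^sup>2" using s(3) by (auto simp: power_divide)
      then have 1: "norm (gauss_kernel x T G s) \<le> exp (\<kappa>\<^sup>2) * exp (- (T powr (2 * \<eta>)))"
      proof -
        have "((Re s - x) / G)\<^sup>2 \<le> \<kappa>\<^sup>2"
        proof (rule power_mono)
          have "(Re s - x) / G \<le> (Re s - x) / 1" using G s by (intro divide_left_mono) auto
          then show "(Re s - x) / G \<le> \<kappa>" using s by (simp add: \<kappa>_def)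
          show "0 \<le> (Re s - x) / G" using s G by simp
        qed
        then show ?thesis
          using G \<open>((Im s - T) / G)\<^sup>2 = (H / G)\<^sup>2\<close> HG2 by (simp add: norm_gauss_kernel mult_right_mono)
      qed
      have 2: "norm (\<phi> s) \<le> K * (2 * T) ^ M"
      proof -
        have "norm (\<phi> s) \<le> K * Im s ^ M" using Res range[OF Ims] by (intro K) auto
        also have "\<dots> \<le> K * (2 * T) ^ M" using K(1) range[OF Ims] by (intro mult_left_mono power_mono) auto
        finally show ?thesis .
      qed
      have 3: "norm (exp (s * of_real l)) \<le> exp (\<bar>l\<bar> * \<beta>)"
      proof -
        have "Re s * l \<le> \<bar>Re s\<bar> * \<bar>l\<bar>" by (simp add: abs_mult[symmetric])
        also have "\<dots> \<le> \<beta> * \<bar>l\<bar>" using Res by (intro mult_right_mono) auto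
        finally show ?thesis by (simp add: mult.commute)
      qed
      show "norm (Q s) \<le> Bd T"
        unfolding Q_def norm_mult Bd_def using 1 2 3 T K(1) by (intro mult_mono) auto
    next
      show "s \<in> {s. t0 < Im s}" if "T - H \<le> Im s" "Im s \<le> T + H" for s
        using range[of "Im s"] that by simp
      show "x \<le> c" by (rule c)
      show "T - H \<le> T + H" using HG G by simp
    qed
    define w where "w t = exp ((\<kappa> / G)\<^sup>2) * exp (- ((t - T) / G)\<^sup>2)" for t
    have contw: "continuous_on {T - H..T + H} w"
      unfolding w_def by (intro continuous_intros)
    define D where "D = integral {T - H..T + H} w"
    have D: "exp (- 1) * G \<le> D"
    proof -
      have "exp (- 1) * G \<le> integral {T - H..T + H} (\<lambda>t. exp (- ((t - T) / G)\<^sup>2))"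
        using G HG by (intro integral_gauss_ge) auto
      also have "\<dots> \<le> D"
        unfolding D_def by (intro integral_le integrable_continuous_real contw continuous_intros) (simp add: w_def)
      finally show ?thesis .
    qed
    have main: "norm (integral {T - H..T + H} (\<lambda>t. Q (Complex c t)) - a N * of_real D) \<le> A / 2 * D"
    proof -
      have "(of_real D :: complex) = integral {T - H..T + H} (\<lambda>t. of_real (w t))"
        unfolding D_def using integral_linear[OF integrable_continuous_real[OF contw] bounded_linear_of_real[where ?'a = complex]]
        by (simp add: o_def)
      then have "integral {T - H..T + H} (\<lambda>t. Q (Complex c t)) - a N * of_real D =
          integral {T - H..T + H} (\<lambda>t. Q (Complex c t) - a N * of_real (w t))"
        by (simp, subst integral_diff)
           (auto intro!: integrable_continuous_real contQ contw continuous_intros)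
      also have "norm \<dots> \<le> integral {T - H..T + H} (\<lambda>t. A / 2 * w t)"
      proof (rule integral_norm_bound_integral)
        fix t assume t: "t \<in> {T - H..T + H}"
        define X where "X = \<phi> (Complex c t) * exp (Complex c t * of_real l)"
        define \<theta> where "\<theta> = 2 * \<kappa> * (t - T) / G\<^sup>2"
        have "\<bar>\<theta>\<bar> \<le> 1 / 4"
        proof -
          have "\<bar>\<theta>\<bar> = 2 * \<kappa> * \<bar>t - T\<bar> / G\<^sup>2" using \<kappa> by (simp add: \<theta>_def abs_mult)
          also have "\<dots> \<le> 2 * \<kappa> * H / G\<^sup>2" using t \<kappa> by (intro divide_right_mono mult_left_mono) auto
          also have "\<dots> = 2 * \<kappa> * T powr (\<eta> - \<gamma>)"
            using T by (simp add: H_def G_def powr_add powr_diff power2_eq_square)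
          also have "\<dots> \<le> 1 / 4" using elim(2) by simp
          finally show ?thesis .
        qed
        then have e: "norm (exp (\<i> * of_real \<theta>) - 1) \<le> 1 / 4"
          using iexp_approx1[of \<theta> 0] by simp
        have X: "norm (X - a N) \<le> A / 4" unfolding X_def by (rule c) simp
        have "Q (Complex c t) = X * (of_real (w t) * exp (\<i> * of_real \<theta>))"
          unfolding Q_def X_def gauss_kernel_Complex[OF less_le_trans[OF zero_less_one G]] w_def \<theta>_def \<kappa>_def by simp
        then have "Q (Complex c t) - a N * of_real (w t) =
           of_real (w t) * ((X - a N) * exp (\<i> * of_real \<theta>) + a N * (exp (\<i> * of_real \<theta>) - 1))"
          by (simp add: algebra_simps)
        also have "norm \<dots> = w t * norm ((X - a N) * exp (\<i> * of_real \<theta>) + a N * (exp (\<i> * of_real \<theta>) - 1))"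
          by (simp add: norm_mult w_def)
        also have "\<dots> \<le> w t * (A / 4 * 1 + A * (1 / 4))"
        proof (rule mult_left_mono)
          show "norm ((X - a N) * exp (\<i> * of_real \<theta>) + a N * (exp (\<i> * of_real \<theta>) - 1)) \<le> A / 4 * 1 + A * (1 / 4)"
            using X e A by (intro norm_triangle_mono) (auto simp: norm_mult A_def intro!: mult_left_mono simp del: mult_1_right)
        qed (simp add: w_def)
        also have "\<dots> = A / 2 * w t" by simp
        finally show "norm (Q (Complex c t) - a N * of_real (w t)) \<le> A / 2 * w t" .
      qed (auto intro!: integrable_continuous_real contQ contw continuous_intros)
      also have "\<dots> = A / 2 * D" by (simp add: D_def)
      finally show ?thesis .
    qed
    define J where "J = integral {T - H..T + H} (\<lambda>t. norm (\<phi> (Complex x t)) * exp (- ((t - T) / G)\<^sup>2))"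
    have "norm (integral {T - H..T + H} (\<lambda>t. Q (Complex x t))) \<le>
       integral {T - H..T + H} (\<lambda>t. exp (x * l) * (norm (\<phi> (Complex x t)) * exp (- ((t - T) / G)\<^sup>2)))"
    proof (rule integral_norm_bound_integral)
      show "norm (Q (Complex x t)) \<le> exp (x * l) * (norm (\<phi> (Complex x t)) * exp (- ((t - T) / G)\<^sup>2))" for t
        using G by (simp add: Q_def norm_mult norm_gauss_kernel)
    qed (auto intro!: integrable_continuous_real contQ contphi continuous_intros)
    then have up: "norm (integral {T - H..T + H} (\<lambda>t. Q (Complex x t))) \<le> exp (x * l) * J"
      by (simp add: J_def)
    have "A * D \<le> norm (integral {T - H..T + H} (\<lambda>t. Q (Complex x t))) + 2 * Bd T * \<kappa> + A / 2 * D"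
    proof -
      have "D \<ge> 0" using D G by (smt (verit) exp_gt_zero mult_nonneg_nonneg)
      then have "A * D = norm (a N * of_real D)" by (simp add: A_def norm_mult)
      moreover have "norm y \<le> norm u + norm (u - v) + norm (v - y)" for u v y :: complex
        using norm_triangle_ineq4[of "u - (u - v)" "v - y"] norm_triangle_ineq4[of u "u - v"] by simp
      ultimately show ?thesis
        using shift main unfolding \<kappa>_def by (smt (verit))
    qed
    moreover define z where "z = A * exp (- 1) * G"
    moreover have "A * D = A / 2 * D + A / 2 * D" by simp
    moreover have "A / 2 * (exp (- 1) * G) \<le> A / 2 * D" using D A by (intro mult_left_mono) auto
    moreover have "A / 2 * (exp (- 1) * G) = z / 2" "A * exp (- 1) / 8 * G = z / 8" "z \<ge> 0"
      using A G by (simp_all add: z_def)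
    ultimately have "z / 4 \<le> exp (x * l) * J"
      using up Bd2 by linarith
    then show ?case
      unfolding k_def G_def[symmetric] H_def[symmetric] J_def[symmetric]
      by (simp add: z_def field_simps)
  qed
  with k show ?thesis by (rule that)
qed

text \<open>
  Otherwise, by the functional equation, \<open>\<phi>\<close> would tend to 0 on some vertical line, against the
  lower bound for its mean value there.
\<close>

lemma abscissa_ge_half: "r / 2 \<le> \<sigma>a"
proof (rule ccontr)
  assume "\<not> r / 2 \<le> \<sigma>a"
  \<comment> \<open>Half the gap: \<open>Re s = r/2 - d\<close> is still a line of absolute
    convergence, and on its reflection \<open>Re s = r/2 + d\<close> the function is at most of
    order \<open>Im s powr (- 2 * d)\<close>.\<close>
  define d where "d = (r / 2 - \<sigma>a) / 2"
  have d: "d > 0" "r / 2 - d > \<sigma>a" using \<open>\<not> r / 2 \<le> \<sigma>a\<close> by (auto simp: d_def field_simps)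
  obtain C where C: "C > 0"
    "\<And>s. Re s = r - (r / 2 - d) \<Longrightarrow> Im s > t0 \<Longrightarrow> norm (\<phi> s) \<le> C * Im s powr (2 * (r / 2 - d) - r)"
    using phi_reflected_bound[OF d(2)] by blast
  obtain k where k: "k > 0"
    "\<forall>\<^sub>F T in at_top. k * T powr (1/2) \<le> integral {T - T powr (1/2 + 1/4)..T + T powr (1/2 + 1/4)}
        (\<lambda>t. norm (\<phi> (Complex (r / 2 + d) t)) * exp (- ((t - T) / T powr (1/2))\<^sup>2))"
    by (rule phi_mean_lower[of "1/4" "1/2" "r / 2 + d"]) auto
  have "\<forall>\<^sub>F T in at_top. C * 2 powr (2 * d) * sqrt pi * T powr (- 2 * d) \<le> k / 2"
    using d k by (intro eventually_mult_powr_neg_le) auto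
  moreover have "\<forall>\<^sub>F T in at_top. T powr (1/2 + 1/4) \<le> T / (2::real)"
    by (intro eventually_powr_le_half) auto
  moreover have "\<forall>\<^sub>F T in at_top. T > 2 * t0" by (rule eventually_gt_at_top)
  moreover note k(2)
  ultimately have "\<forall>\<^sub>F T::real in at_top. False"
  proof eventually_elim
    case (elim T)
    define H where "H = T powr (1/2 + 1/4)"
    define G where "G = T powr (1/2)"
    have T: "T > 0" using elim(3) t0 by simp
    have G: "G > 0" using T by (simp add: G_def)
    have H: "H \<le> T / 2" "H \<ge> 0" using elim(2) by (auto simp: H_def)
    have int: "(\<lambda>t. norm (\<phi> (Complex (r / 2 + d) t)) * exp (- ((t - T) / G)\<^sup>2)) integrable_on {T - H..T + H}"
      using H elim(3) by (intro integrable_continuous_real continuous_intros continuous_on_vertical hol) auto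
    have "k * G \<le> integral {T - H..T + H} (\<lambda>t. norm (\<phi> (Complex (r / 2 + d) t)) * exp (- ((t - T) / G)\<^sup>2))"
      using elim(4) by (simp add: H_def G_def)
    also have "\<dots> \<le> integral {T - H..T + H} (\<lambda>t. C * (T / 2) powr (- 2 * d) * exp (- ((t - T) / G)\<^sup>2))"
    proof (rule integral_le[OF int])
      show "(\<lambda>t. C * (T / 2) powr (- 2 * d) * exp (- ((t - T) / G)\<^sup>2)) integrable_on {T - H..T + H}"
        by (intro integrable_continuous_real continuous_intros)
      fix t assume "t \<in> {T - H..T + H}"
      then have t: "t \<ge> T / 2" "t > t0" using H elim(3) by auto
      have "norm (\<phi> (Complex (r / 2 + d) t)) \<le> C * t powr (- 2 * d)"
        using C(2)[of "Complex (r / 2 + d) t"] t by simp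
      also have "\<dots> \<le> C * (T / 2) powr (- 2 * d)"
        using C(1) t T d by (intro mult_left_mono powr_mono2') auto
      finally show "norm (\<phi> (Complex (r / 2 + d) t)) * exp (- ((t - T) / G)\<^sup>2) \<le> C * (T / 2) powr (- 2 * d) * exp (- ((t - T) / G)\<^sup>2)"
        by (intro mult_right_mono) auto
    qed
    also have "\<dots> = C * (T / 2) powr (- 2 * d) * integral {T - H..T + H} (\<lambda>t. exp (- ((t - T) / G)\<^sup>2))"
      by simp
    also have "\<dots> \<le> C * (T / 2) powr (- 2 * d) * (sqrt pi * G)"
      using C(1) G by (intro mult_left_mono integral_gauss_le) auto
    also have "\<dots> = C * 2 powr (2 * d) * sqrt pi * T powr (- 2 * d) * G"
      using T by (simp add: powr_divide powr_minus field_simps)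
    also have "\<dots> \<le> k / 2 * G"
      using elim(1) G by (intro mult_right_mono) auto
    finally show False using k(1) G by simp
  qed
  then show False by simp
qed

section \<open>Upper bound for the twisted mean value\<close>

text \<open>The factor \<open>lam n powr (- s)\<close> merges with \<open>z powr (- s)\<close> into
  \<open>(lam n * z) powr (- s)\<close>, as \<open>lam n\<close> is positive. So each term is a
  smoothed Gamma integral with parameter \<open>lam n * z\<close>, whose bound carries
  \<open>lam n powr (- c)\<close>; the bounds add up to a multiple of \<open>coeff_sum c\<close>.
  The pointwise bound on \<open>F\<close> is there for cutting the line down to the window.\<close>

lemma twisted_line_integral:
  fixes c G T x :: real and z :: complex
  assumes c: "c > \<sigma>a" "c > 0" and z: "Re z > 0" and G: "G > 0"
  defines "F \<equiv> \<lambda>t. \<phi> (Complex c t) * (Gamma (Complex c t) * z powr (- Complex c t) * gauss_kernel x T G (Complex c t))"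
  shows "integrable lborel F"
    and "norm (\<integral>t. F t \<partial>lborel) \<le> coeff_sum c * (2 * pi * c powr c * Re z powr (- c) * exp (((c - x) / G)\<^sup>2))"
    and "norm (F t) \<le> coeff_sum c * (Gamma c * Re z powr (- c) * exp (((c - x) / G)\<^sup>2)) * exp (- ((t - T) / G)\<^sup>2)"
proof -
  define e where "e = exp (((c - x) / G)\<^sup>2)"
  define g where "g t = exp (- ((t - T) / G)\<^sup>2)" for t
  define h where "h t = Gamma (Complex c t) * z powr (- Complex c t) * gauss_kernel x T G (Complex c t)" for t
  define q where "q n = norm (a (Suc n)) * lam (Suc n) powr (- c)" for n
  have z0: "z \<noteq> 0" using z by auto
  have norm_h: "norm (h t) \<le> Gamma c * Re z powr (- c) * e * g t" for t
  proof -
    have "norm (h t) = norm (Gamma (Complex c t) * z powr (- Complex c t)) * (e * g t)"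
      unfolding h_def norm_mult[of _ "gauss_kernel x T G _"] norm_gauss_kernel[OF G] by (simp add: e_def g_def)
    also have "\<dots> \<le> (Gamma c * Re z powr (- c)) * (e * g t)"
      using norm_Gamma_rotated_le[of "Complex c t" z] c z by (intro mult_right_mono) (auto simp: e_def g_def)
    finally show ?thesis by (simp add: mult.assoc)
  qed
  define f where "f n t = dirichlet_term lam a (Complex c t) (Suc n) * h t" for n t
  have norm_f: "norm (f n t) = q n * norm (h t)" for n t
    by (simp add: f_def norm_mult norm_dirichlet_term q_def)
  have cont_h: "continuous_on UNIV h"
  proof -
    have eq: "h = (\<lambda>t. Gamma (Complex c t) * exp (- (of_real c + \<i> * of_real t) * Ln z) *
        exp (((of_real c + \<i> * of_real t - Complex x T) * (1 / of_real G))\<^sup>2))"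
      using z0 by (simp add: h_def powr_def gauss_kernel_def Complex_eq fun_eq_iff)
    show ?thesis
      unfolding eq using c by (intro continuous_intros) auto
  qed
  have cont_f: "continuous_on UNIV (f n)" for n
  proof -
    have eq: "f n = (\<lambda>t. a (Suc n) * exp (- (of_real c + \<i> * of_real t) * Ln (of_real (lam (Suc n)))) * h t)"
      using lam_pos[of "Suc n"] by (auto simp: f_def dirichlet_term_def powr_def Complex_eq fun_eq_iff)
    show ?thesis
      unfolding eq by (intro continuous_intros cont_h)
  qed
  have int_g: "integrable lborel g" "(\<integral>t. g t \<partial>lborel) = sqrt pi * G"
    using has_bochner_integral_gauss_shift[OF G, of T] by (auto simp: g_def[abs_def] has_bochner_integral_iff)
  have int_h: "integrable lborel (\<lambda>t. norm (h t))"
  proof (rule Bochner_Integration.integrable_bound)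
    show "integrable lborel (\<lambda>t. Gamma c * Re z powr (- c) * e * g t)"
      by (intro integrable_mult_right int_g)
    show "(\<lambda>t. norm (h t)) \<in> borel_measurable lborel"
      using borel_measurable_continuous_onI[OF cont_h] by simp
    show "AE t in lborel. norm (norm (h t)) \<le> norm (Gamma c * Re z powr (- c) * e * g t)"
      using order.trans[OF norm_h abs_ge_self] by simp
  qed
  have int_f: "integrable lborel (f n)" for n
  proof (rule Bochner_Integration.integrable_bound)
    show "integrable lborel (\<lambda>t. q n * norm (h t))" by (intro integrable_mult_right int_h)
    show "f n \<in> borel_measurable lborel"
      using borel_measurable_continuous_onI[OF cont_f] by simp
  qed (simp add: norm_f)
  have q: "summable q" "(\<Sum>n. q n) = coeff_sum c"
    using summable_coeff[OF c(1)] by (auto simp: q_def[abs_def] coeff_sum_def)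
  have q_nonneg: "q n \<ge> 0" for n by (simp add: q_def)
  have f_sums: "(\<lambda>n. f n t) sums F t" for t
  proof -
    have "summable (\<lambda>n. dirichlet_term lam a (Complex c t) (Suc n))"
      using c by (intro summable_norm_cancel[OF summable_dirichlet_term]) simp
    then have "(\<lambda>n. dirichlet_term lam a (Complex c t) (Suc n)) sums \<phi> (Complex c t)"
      using c by (simp add: phi_sum dirichlet_sum_def summable_sums)
    then show ?thesis unfolding f_def F_def h_def[symmetric] by (rule sums_mult2)
  qed
  have sn: "summable (\<lambda>n. norm (f n t))" for t
    unfolding norm_f by (intro summable_mult2 q)
  have si: "summable (\<lambda>n. \<integral>t. norm (f n t) \<partial>lborel)"
    unfolding norm_f by (simp add: summable_mult2 q)
  have F_eq: "(\<lambda>t. \<Sum>n. f n t) = F"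
    using f_sums by (auto simp: sums_iff)
  show "integrable lborel F"
    using integrable_suminf[OF int_f _ si] sn unfolding F_eq by simp
  have sums_int: "(\<lambda>n. \<integral>t. f n t \<partial>lborel) sums (\<integral>t. F t \<partial>lborel)"
    using sums_integral[OF int_f _ si] sn unfolding F_eq by simp
  have term_bound: "norm (\<integral>t. f n t \<partial>lborel) \<le> q n * (2 * pi * c powr c * Re z powr (- c) * e)" for n
  proof -
    define l where "l = lam (Suc n)"
    have l: "l > 0" using lam_pos by (simp add: l_def)
    have eq: "f n t = a (Suc n) * (Gamma (of_real c + \<i> * of_real t) * (of_real l * z) powr (- (of_real c + \<i> * of_real t))
              * exp (((of_real (c - x) + \<i> * of_real (t - T)) / of_real G)\<^sup>2))" for t
    proof -
      have "(of_real l * z) powr (- Complex c t) = of_real l powr (- Complex c t) * z powr (- Complex c t)"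
        using l by (intro powr_times_real_left) auto
      moreover have "Complex c t - Complex x T = of_real (c - x) + \<i> * of_real (t - T)"
        by (simp add: complex_eq_iff)
      ultimately show ?thesis
        unfolding f_def h_def dirichlet_term_def l_def[symmetric] gauss_kernel_def Complex_eq[symmetric]
        by (simp add: mult_ac)
    qed
    have "norm (\<integral>t. f n t \<partial>lborel) = norm (a (Suc n)) *
       norm (\<integral>t. Gamma (of_real c + \<i> * of_real t) * (of_real l * z) powr (- (of_real c + \<i> * of_real t))
              * exp (((of_real (c - x) + \<i> * of_real (t - T)) / of_real G)\<^sup>2) \<partial>lborel)"
      unfolding eq by (simp add: norm_mult del: of_real_diff)
    also have "\<dots> \<le> norm (a (Suc n)) * (2 * pi * c powr c * Re (of_real l * z) powr (- c) * exp (((c - x) / G)\<^sup>2))"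
      using c l z G by (intro mult_left_mono Gamma_gauss_integral_bound) auto
    also have "\<dots> = q n * (2 * pi * c powr c * Re z powr (- c) * e)"
      using l z by (simp add: q_def l_def[symmetric] e_def powr_mult mult_ac)
    finally show ?thesis .
  qed
  have "norm (\<integral>t. F t \<partial>lborel) = norm (\<Sum>n. \<integral>t. f n t \<partial>lborel)"
    using sums_int by (simp add: sums_iff)
  also have "\<dots> \<le> (\<Sum>n. q n * (2 * pi * c powr c * Re z powr (- c) * e))"
    by (intro norm_suminf_le term_bound summable_mult2 q)
  also have "\<dots> = coeff_sum c * (2 * pi * c powr c * Re z powr (- c) * e)"
    using q by (simp add: suminf_mult2[symmetric])
  finally show "norm (\<integral>t. F t \<partial>lborel) \<le> coeff_sum c * (2 * pi * c powr c * Re z powr (- c) * exp (((c - x) / G)\<^sup>2))"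
    by (simp add: e_def)
  have "norm (F t) \<le> coeff_sum c * (Gamma c * Re z powr (- c) * e * g t)"
    unfolding F_def h_def[symmetric] norm_mult
    using norm_phi_le[of "Complex c t"] c norm_h[of t] coeff_sum_nonneg[OF c(1)] by (intro mult_mono) auto
  then show "norm (F t) \<le> coeff_sum c * (Gamma c * Re z powr (- c) * exp (((c - x) / G)\<^sup>2)) * exp (- ((t - T) / G)\<^sup>2)"
    by (simp add: e_def g_def mult.assoc)
qed

text \<open>Here the bound for the whole line \<open>Re s = c\<close> is brought back to the window
  on the line of symmetry. Completing the window to a line and joining the two lines cost Gaussian
  tails only; the size \<open>T powr c\<close> is entirely due to
  \<open>Re z powr (- c)\<close>.\<close>

lemma twisted_mean_upper:
  assumes c: "c > \<sigma>a" "c \<ge> r / 2" and \<eta>: "0 < \<eta>" "0 < \<gamma>" "\<gamma> + \<eta> < 1"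
  obtains K where
    "\<forall>\<^sub>F T in at_top. norm (integral {T - T powr (\<gamma> + \<eta>)..T + T powr (\<gamma> + \<eta>)}
        (\<lambda>t. \<phi> (Complex (r / 2) t) * (Gamma (Complex (r / 2) t) * exp (- (\<i> * of_real (pi / 2 - 1 / T)) * Complex (r / 2) t)
          * gauss_kernel (r / 2) T (T powr \<gamma>) (Complex (r / 2) t)))) \<le> K * T powr c"
proof -
  define x where "x = r / 2"
  have c0: "c > 0" using c r_pos by simp
  define \<kappa> where "\<kappa> = c - x"
  have \<kappa>: "\<kappa> \<ge> 0" using c by (simp add: \<kappa>_def x_def)
  obtain P t1 and M :: nat where P: "P > 0" "t1 > t0"
    "\<And>s. \<bar>Re s\<bar> \<le> c \<Longrightarrow> Im s \<ge> t1 \<Longrightarrow> norm (\<phi> s) \<le> P * Im s ^ M"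
    using phi_poly_bound[of c] by blast
  obtain C where C: "C \<ge> 1"
    "\<And>s. \<bar>Re s\<bar> \<le> c \<Longrightarrow> Im s \<ge> 1 \<Longrightarrow> norm (Gamma s) \<le> C * Im s powr (Re s - 1/2) * exp (- (pi * Im s / 2))"
    "\<And>s. \<bar>Re s\<bar> \<le> c \<Longrightarrow> Im s \<ge> 1 \<Longrightarrow> 1 / norm (Gamma s) \<le> C * Im s powr (1/2 - Re s) * exp (pi * Im s / 2)"
    using Gamma_vertical_bounds[of c] by blast
  define Bd where "Bd T = P * (2 * T) ^ M * (C * (2 * T) powr c * (exp (\<kappa>\<^sup>2) * exp (- (T powr (2 * \<eta>)))))" for T
  define A where "A = coeff_sum c"
  have A: "A \<ge> 0" unfolding A_def by (rule coeff_sum_nonneg[OF c(1)])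
  define E where "E = A * 2 powr c * exp (\<kappa>\<^sup>2)"
  have E: "E \<ge> 0" using A by (simp add: E_def)
  \<comment> \<open>The summands stand for the integral over the whole line, its tail, and the
    horizontal edges, which contribute at most \<open>1 \<le> T powr c\<close>.\<close>
  define K where "K = E * (2 * pi * c powr c) + E * Gamma c + 1"
  have "\<forall>\<^sub>F T in at_top. (2 * \<kappa> * P * 2 ^ M * C * 2 powr c * exp (\<kappa>\<^sup>2)) * T powr (real M + c) * exp (- (T powr (2 * \<eta>))) \<le> 1"
    using \<eta> by (intro eventually_powr_exp_le) auto
  moreover have "\<forall>\<^sub>F T in at_top. (sqrt pi * sqrt 2) * T powr \<gamma> * exp (- (T powr (2 * \<eta>)) / 2) \<le> 1"
    using \<eta> by (intro eventually_powr_exp_half_le) auto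
  moreover have "\<forall>\<^sub>F T in at_top. T powr (\<gamma> + \<eta>) \<le> T / 2"
    using \<eta> by (intro eventually_powr_le_half)
  moreover have "\<forall>\<^sub>F T in at_top. T \<ge> 2 * t1" by (rule eventually_ge_at_top)
  moreover note eventually_sin_inverse_ge
  ultimately have "\<forall>\<^sub>F T in at_top. norm (integral {T - T powr (\<gamma> + \<eta>)..T + T powr (\<gamma> + \<eta>)}
        (\<lambda>t. \<phi> (Complex x t) * (Gamma (Complex x t) * exp (- (\<i> * of_real (pi / 2 - 1 / T)) * Complex x t)
          * gauss_kernel x T (T powr \<gamma>) (Complex x t)))) \<le> K * T powr c"
  proof eventually_elim
    case (elim T)
    define G where "G = T powr \<gamma>"
    define H where "H = T powr (\<gamma> + \<eta>)"
    have T: "T \<ge> 2" "T > 0" "T \<ge> 1" using elim(4) P(2) t0 by auto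
    have G: "G \<ge> 1" using T \<eta> by (simp add: G_def ge_one_powr_ge_zero)
    have H: "H \<ge> 1" using T \<eta> by (simp add: H_def ge_one_powr_ge_zero)
    have HT: "H \<le> T / 2" using elim(3) by (simp add: H_def)
    have HG2: "(H / G)\<^sup>2 = T powr (2 * \<eta>)"
    proof -
      have "H / G = T powr \<eta>" using T by (simp add: H_def G_def powr_add)
      then show ?thesis by (simp add: power2_eq_square powr_add[symmetric])
    qed
    have range: "t > t0 \<and> t \<ge> t1 \<and> 1 \<le> t \<and> t \<le> 2 * T" if "t \<in> {T - H..T + H}" for t
      using that HT elim(4) P(2) t0 by auto
    have Bd1: "2 * Bd T * \<kappa> \<le> 1"
    proof -
      have "2 * Bd T * \<kappa> = (2 * \<kappa> * P * 2 ^ M * C * 2 powr c * exp (\<kappa>\<^sup>2)) * T powr (real M + c) * exp (- (T powr (2 * \<eta>)))"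
        using T by (simp add: Bd_def power_mult_distrib powr_add powr_realpow powr_mult mult_ac)
      also have "\<dots> \<le> 1" by (rule elim(1))
      finally show ?thesis .
    qed
    \<comment> \<open>The angle stays between \<open>- pi\<close> and \<open>pi\<close>, so
      \<open>Ln z\<close> is the exponent itself and \<open>z powr (- s)\<close> is the entire twist
      of the statement.\<close>
    define z where "z = exp (\<i> * of_real (pi / 2 - 1 / T))"
    have Lnz: "Ln z = \<i> * of_real (pi / 2 - 1 / T)"
    proof -
      have "0 < 1 / T" "1 / T \<le> 1" using T by auto
      then have "- pi < pi / 2 - 1 / T" "pi / 2 - 1 / T \<le> pi"
        using pi_gt3 by linarith+
      then show ?thesis unfolding z_def by (intro Ln_exp) auto
    qed
    have Rez: "Re z = sin (1 / T)"
      by (simp add: z_def Re_exp sin_cos_eq)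
    have zpos: "Re z \<ge> 1 / (2 * T)" "Re z > 0"
      using elim(5) T unfolding Rez by (auto intro: less_le_trans[of _ "1 / (2 * T)"])
    have powz: "z powr (- s) = exp (- (\<i> * of_real (pi / 2 - 1 / T)) * s)" for s
      unfolding powr_def Lnz by (simp add: z_def mult_ac)
    have Rezc: "Re z powr (- c) \<le> 2 powr c * T powr c"
    proof -
      have "Re z powr (- c) \<le> (1 / (2 * T)) powr (- c)"
        using zpos c0 T by (intro powr_mono2') auto
      also have "\<dots> = 2 powr c * T powr c"
        using T by (simp add: powr_minus powr_divide powr_mult)
      finally show ?thesis .
    qed
    define Q where "Q s = \<phi> s * (Gamma s * z powr (- s) * gauss_kernel x T G s)" for s
    have holQ: "Q holomorphic_on {s. Im s > t0}"
      unfolding Q_def powz by (intro holomorphic_intros hol Gamma_hol_upper)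
    have shift: "norm (integral {T - H..T + H} (\<lambda>t. Q (Complex x t)) - integral {T - H..T + H} (\<lambda>t. Q (Complex c t))) \<le> 2 * Bd T * (c - x)"
    proof (rule vertical_line_shift[OF holQ upper_open upper_convex])
      fix s assume s: "x \<le> Re s" "Re s \<le> c" "Im s = T - H \<or> Im s = T + H"
      have Res: "\<bar>Re s\<bar> \<le> c" using s r_pos by (auto simp: x_def)
      have Ims: "Im s \<in> {T - H..T + H}" using s H by auto
      have "((Im s - T) / G)\<^sup>2 = (H / G)\<^sup>2" using s(3) by (auto simp: power_divide)
      then have 1: "norm (gauss_kernel x T G s) \<le> exp (\<kappa>\<^sup>2) * exp (- (T powr (2 * \<eta>)))"
      proof -
        have "((Re s - x) / G)\<^sup>2 \<le> \<kappa>\<^sup>2"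
        proof (rule power_mono)
          have "(Re s - x) / G \<le> (Re s - x) / 1" using G s by (intro divide_left_mono) auto
          then show "(Re s - x) / G \<le> \<kappa>" using s by (simp add: \<kappa>_def)
          show "0 \<le> (Re s - x) / G" using s G by simp
        qed
        then show ?thesis
          using G \<open>((Im s - T) / G)\<^sup>2 = (H / G)\<^sup>2\<close> HG2 by (simp add: norm_gauss_kernel mult_right_mono)
      qed
      have 2: "norm (\<phi> s) \<le> P * (2 * T) ^ M"
      proof -
        have "norm (\<phi> s) \<le> P * Im s ^ M" using Res range[OF Ims] by (intro P) auto
        also have "\<dots> \<le> P * (2 * T) ^ M" using P(1) range[OF Ims] by (intro mult_left_mono power_mono) auto
        finally show ?thesis .
      qed
      have 3: "norm (Gamma s * z powr (- s)) \<le> C * (2 * T) powr c"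
      proof -
        \<comment> \<open>On the edges the twist grows no faster than \<open>Gamma\<close> decays,
          so the product of the two is polynomial in \<open>T\<close> and the kernel makes it
          negligible.\<close>
        have "norm (z powr (- s)) = exp ((pi / 2 - 1 / T) * Im s)"
          unfolding powz by simp
        also have "\<dots> \<le> exp (pi * Im s / 2)"
          using T range[OF Ims] by (simp add: algebra_simps)
        finally have "norm (z powr (- s)) \<le> exp (pi * Im s / 2)" .
        moreover have "norm (Gamma s) \<le> C * Im s powr (Re s - 1/2) * exp (- (pi * Im s / 2))"
          using range[OF Ims] by (intro C(2) Res) auto
        ultimately have "norm (Gamma s * z powr (- s)) \<le> C * Im s powr (Re s - 1/2) * exp (- (pi * Im s / 2)) * exp (pi * Im s / 2)"
          unfolding norm_mult using C(1) by (intro mult_mono) auto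
        also have "\<dots> = C * Im s powr (Re s - 1/2)"
          by (simp add: exp_minus)
        also have "\<dots> \<le> C * (2 * T) powr c"
        proof (rule mult_left_mono)
          have "Im s powr (Re s - 1/2) \<le> Im s powr c" using s range[OF Ims] by (intro powr_mono) auto
          also have "\<dots> \<le> (2 * T) powr c" using c0 range[OF Ims] by (intro powr_mono2) auto
          finally show "Im s powr (Re s - 1/2) \<le> (2 * T) powr c" .
        qed (use C(1) in simp)
        finally show ?thesis .
      qed
      have "norm (Gamma s * z powr (- s) * gauss_kernel x T G s) \<le> C * (2 * T) powr c * (exp (\<kappa>\<^sup>2) * exp (- (T powr (2 * \<eta>))))"
        unfolding norm_mult[of _ "gauss_kernel x T G s"] using 1 3 C(1) by (intro mult_mono) auto
      then show "norm (Q s) \<le> Bd T"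
        unfolding Q_def norm_mult[of "\<phi> s"] Bd_def using 2 T P(1) by (intro mult_mono) auto
    next
      show "s \<in> {s. t0 < Im s}" if "T - H \<le> Im s" "Im s \<le> T + H" for s
        using range[of "Im s"] that by simp
      show "x \<le> c" using c by (simp add: x_def)
      show "T - H \<le> T + H" using H by simp
    qed
    have G0: "G > 0" using G by simp
    define e where "e = exp (((c - x) / G)\<^sup>2)"
    have e: "e \<le> exp (\<kappa>\<^sup>2)" "e > 0"
    proof -
      have "\<kappa> / G \<le> \<kappa> / 1" using G \<kappa> by (intro divide_left_mono) auto
      then show "e \<le> exp (\<kappa>\<^sup>2)" using \<kappa> G unfolding e_def \<kappa>_def[symmetric]
        by (intro exp_le_cancel_iff[THEN iffD2] power_mono) auto
    qed (simp add: e_def)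
    have Gc: "Gamma c > 0" using c0 by (simp add: Gamma_real_pos)
    have ARe: "A * (Re z powr (- c) * e) \<le> E * T powr c"
    proof -
      have "A * (Re z powr (- c) * e) \<le> A * ((2 powr c * T powr c) * exp (\<kappa>\<^sup>2))"
        using A Rezc e by (intro mult_left_mono mult_mono) auto
      then show ?thesis by (simp add: E_def mult_ac)
    qed
    note line = twisted_line_integral[OF c(1) c0 zpos(2) G0, where x = x and T = T, folded A_def e_def]
    have full: "norm (\<integral>t. Q (Complex c t) \<partial>lborel) \<le> E * (2 * pi * c powr c) * T powr c"
    proof -
      have "norm (\<integral>t. Q (Complex c t) \<partial>lborel) \<le> (A * (Re z powr (- c) * e)) * (2 * pi * c powr c)"
        using line(2) by (simp add: Q_def mult_ac)
      also have "\<dots> \<le> (E * T powr c) * (2 * pi * c powr c)"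
        using ARe by (intro mult_right_mono) auto
      finally show ?thesis by (simp add: mult_ac)
    qed
    have tail: "norm ((\<integral>t. Q (Complex c t) \<partial>lborel) - integral {T - H..T + H} (\<lambda>t. Q (Complex c t))) \<le> E * Gamma c * T powr c"
    proof -
      have "norm ((\<integral>t. Q (Complex c t) \<partial>lborel) - integral {T - H..T + H} (\<lambda>t. Q (Complex c t)))
        \<le> A * (Gamma c * Re z powr (- c) * e) * exp (- (H / G)\<^sup>2 / 2) * (sqrt pi * (sqrt 2 * G))"
        using line(1) line(3) G0 H unfolding Q_def by (intro gauss_tail_bound) auto
      also have "\<dots> = (A * (Re z powr (- c) * e)) * Gamma c * ((sqrt pi * sqrt 2) * T powr \<gamma> * exp (- (T powr (2 * \<eta>)) / 2))"
        unfolding HG2 by (simp only: mult_ac G_def)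
      also have "\<dots> \<le> (E * T powr c) * Gamma c * 1"
        by (rule mult_mono[OF mult_right_mono[OF ARe] elim(2)]) (use Gc E in auto)
      finally show ?thesis by (simp add: mult_ac)
    qed
    have "norm (integral {T - H..T + H} (\<lambda>t. Q (Complex x t))) \<le> norm (integral {T - H..T + H} (\<lambda>t. Q (Complex x t)) - integral {T - H..T + H} (\<lambda>t. Q (Complex c t)))
       + norm ((\<integral>t. Q (Complex c t) \<partial>lborel) - integral {T - H..T + H} (\<lambda>t. Q (Complex c t))) + norm (\<integral>t. Q (Complex c t) \<partial>lborel)"
    proof -
      have "norm u \<le> norm (u - v) + norm (w - v) + norm w" for u v w :: complex
        using norm_triangle_ineq[of "u - v" "v"] norm_triangle_ineq4[of w "w - v"] by simp
      then show ?thesis .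
    qed
    also have "\<dots> \<le> 1 + E * Gamma c * T powr c + E * (2 * pi * c powr c) * T powr c"
      using shift tail full Bd1 unfolding \<kappa>_def by linarith
    also have "1 \<le> T powr c" using T c0 by (intro ge_one_powr_ge_zero) auto
    then have "1 + E * Gamma c * T powr c + E * (2 * pi * c powr c) * T powr c \<le> K * T powr c"
      by (simp add: K_def algebra_simps)
    finally show ?case
      unfolding Q_def powz H_def G_def .
  qed
  then show ?thesis unfolding x_def by (rule that)
qed

section \<open>Comparison of the two bounds\<close>

theorem zeros_in_short_intervals:
  assumes \<sigma>a: "\<sigma>a < (r + 1) / 2" and \<epsilon>: "\<epsilon> > 0"
  shows "\<exists>T0>0. \<forall>T\<ge>T0. \<exists>\<tau>. \<phi> (Complex (r / 2) \<tau>) = 0 \<and> \<bar>\<tau> - T\<bar> \<le> T powr (\<sigma>a + (1 - r) / 2 + \<epsilon>)"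
proof -
  \<comment> \<open>A large \<epsilon> would push the exponent of the window to 1 or beyond. A zero
    found in the smaller window also lies in the larger one, as \<open>T \<ge> 1\<close>.\<close>
  define \<epsilon>' where "\<epsilon>' = min \<epsilon> (((r + 1) / 2 - \<sigma>a) / 2)"
  define \<eta> where "\<eta> = \<epsilon>' / 4"
  \<comment> \<open>Of the summand \<open>3 * \<eta>\<close> one part pays for
    \<open>c = \<sigma>a + \<eta>\<close>; the other two become the saving
    \<open>T powr (- 2 * \<eta>)\<close> that yields the contradiction.\<close>
  define \<gamma> where "\<gamma> = \<sigma>a + (1 - r) / 2 + 3 * \<eta>"
  have \<epsilon>': "\<epsilon>' > 0" "\<epsilon>' \<le> \<epsilon>" "\<epsilon>' < (r + 1) / 2 - \<sigma>a"
  proof -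
    define d where "d = (r + 1) / 2 - \<sigma>a"
    have "d > 0" using \<sigma>a by (simp add: d_def)
    then show "\<epsilon>' > 0" "\<epsilon>' \<le> \<epsilon>" "\<epsilon>' < (r + 1) / 2 - \<sigma>a"
      using \<epsilon> unfolding \<epsilon>'_def d_def[symmetric] by (auto simp: min_def)
  qed
  have exponent: "\<gamma> + \<eta> = \<sigma>a + (1 - r) / 2 + \<epsilon>'" by (simp add: \<gamma>_def \<eta>_def)
  have \<eta>: "0 < \<eta>" "\<eta> < \<gamma>" "\<gamma> + \<eta> < 1"
  proof -
    show "0 < \<eta>" using \<epsilon>' by (simp add: \<eta>_def)
    then show "\<eta> < \<gamma>" using abscissa_ge_half by (simp add: \<gamma>_def field_simps)
    show "\<gamma> + \<eta> < 1" unfolding exponent using \<epsilon>' by (simp add: field_simps)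
  qed
  define x where "x = r / 2"
  define c where "c = \<sigma>a + \<eta>"
  have c: "c > \<sigma>a" "c \<ge> r / 2" using \<eta> abscissa_ge_half by (auto simp: c_def)
  obtain k where k: "k > 0"
    "\<forall>\<^sub>F T in at_top. k * T powr \<gamma> \<le> integral {T - T powr (\<gamma> + \<eta>)..T + T powr (\<gamma> + \<eta>)}
        (\<lambda>t. norm (\<phi> (Complex x t)) * exp (- ((t - T) / T powr \<gamma>)\<^sup>2))"
    using phi_mean_lower[OF \<eta>] by blast
  obtain K where K:
    "\<forall>\<^sub>F T in at_top. norm (integral {T - T powr (\<gamma> + \<eta>)..T + T powr (\<gamma> + \<eta>)}
        (\<lambda>t. \<phi> (Complex x t) * (Gamma (Complex x t) * exp (- (\<i> * of_real (pi / 2 - 1 / T)) * Complex x t)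
          * gauss_kernel x T (T powr \<gamma>) (Complex x t)))) \<le> K * T powr c"
    using twisted_mean_upper[OF c, of \<eta> \<gamma>] \<eta> unfolding x_def by auto
  obtain C where C: "C \<ge> 1"
    "\<And>s. \<bar>Re s\<bar> \<le> x \<Longrightarrow> Im s \<ge> 1 \<Longrightarrow> norm (Gamma s) \<le> C * Im s powr (Re s - 1/2) * exp (- (pi * Im s / 2))"
    "\<And>s. \<bar>Re s\<bar> \<le> x \<Longrightarrow> Im s \<ge> 1 \<Longrightarrow> 1 / norm (Gamma s) \<le> C * Im s powr (1/2 - Re s) * exp (pi * Im s / 2)"
    using Gamma_vertical_bounds[of x] by blast
  define p where "p = 1/2 - x"
  \<comment> \<open>\<open>C\<close> is the Stirling constant, \<open>2 powr \<bar>p\<bar>\<close>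
    compares \<open>t powr p\<close> with \<open>T powr p\<close> for
    \<open>T / 2 \<le> t \<le> 2 * T\<close>, and \<open>exp 2\<close> bounds
    \<open>exp (t / T)\<close>, the part of the Gamma decay that the twist leaves
    uncancelled.\<close>
  define B where "B = C * 2 powr \<bar>p\<bar> * exp 2"
  have B: "B > 0" using C(1) by (simp add: B_def)
  have "\<forall>\<^sub>F T in at_top. (B * K) * T powr (- 2 * \<eta>) \<le> k / 2"
    using \<eta> k by (intro eventually_mult_powr_neg_le) auto
  moreover have "\<forall>\<^sub>F T in at_top. T powr (\<gamma> + \<eta>) \<le> T / 2"
    using \<eta> by (intro eventually_powr_le_half)
  moreover have "\<forall>\<^sub>F T in at_top. T > 2 * t0" by (rule eventually_gt_at_top)
  moreover note k(2) K
  ultimately have "\<forall>\<^sub>F T in at_top. \<exists>\<tau>. \<phi> (Complex x \<tau>) = 0 \<and> \<bar>\<tau> - T\<bar> \<le> T powr (\<sigma>a + (1 - r) / 2 + \<epsilon>)"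
  proof eventually_elim
    case (elim T)
    define G where "G = T powr \<gamma>"
    define H where "H = T powr (\<gamma> + \<eta>)"
    have T: "T \<ge> 1" "T > 0" using elim(3) t0 by auto
    have G: "G > 0" using T by (simp add: G_def)
    have H: "H \<ge> 0" "H \<le> T / 2" using elim(2) by (auto simp: H_def)
    have range: "t > t0 \<and> 1 \<le> t \<and> T / 2 \<le> t \<and> t \<le> 2 * T" if "t \<in> {T - H..T + H}" for t
      using that H elim(3) t0 by auto
    have "\<exists>\<tau>\<in>{T - H..T + H}. \<phi> (Complex x \<tau>) = 0"
    proof (rule ccontr)
      assume no_zero: "\<not> (\<exists>\<tau>\<in>{T - H..T + H}. \<phi> (Complex x \<tau>) = 0)"
      define f where "f t = Re (Gamma (Complex x t) * \<phi> (Complex x t))" for t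
      \<comment> \<open>Points with \<open>Re s = r/2\<close> are fixed by the reflection, so the
        functional equation equates the value with its own conjugate.\<close>
      have real: "Gamma (Complex x t) * \<phi> (Complex x t) = of_real (f t)" if "t \<in> {T - H..T + H}" for t
      proof -
        have "of_real r - cnj (Complex x t) = Complex x t" by (simp add: complex_eq_iff x_def)
        then have "cnj (Gamma (Complex x t) * \<phi> (Complex x t)) = Gamma (Complex x t) * \<phi> (Complex x t)"
          using fun_eq[of "Complex x t"] range[OF that] by simp
        then have "Im (Gamma (Complex x t) * \<phi> (Complex x t)) = 0"
          by (metis Im_complex_of_real Reals_cases Reals_cnj_iff)
        then show ?thesis by (simp add: f_def complex_eq_iff)
      qed
      have cont_phi: "continuous_on {T - H..T + H} (\<lambda>t. \<phi> (Complex x t))"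
        and cont_Gamma: "continuous_on {T - H..T + H} (\<lambda>t. Gamma (Complex x t))"
        using range[of "T - H"] H by (auto intro!: continuous_on_vertical hol Gamma_hol_upper)
      have cont_f: "continuous_on {T - H..T + H} f"
        unfolding f_def by (intro continuous_intros cont_phi cont_Gamma)
      have f_nz: "f t \<noteq> 0" if "t \<in> {T - H..T + H}" for t
        using real[OF that] no_zero that Gamma_nonzero_upper[of "Complex x t"] range[OF that] by auto
      obtain \<sigma> where \<sigma>: "\<bar>\<sigma>\<bar> = 1" "\<And>t. t \<in> {T - H..T + H} \<Longrightarrow> \<bar>f t\<bar> = \<sigma> * f t"
        using continuous_nonzero_constant_sign[OF cont_f f_nz] by blast
      define \<theta> where "\<theta> = pi / 2 - 1 / T"
      define u where "u = exp (- (\<i> * of_real (\<theta> * x)))"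
      define q where "q t = exp (\<theta> * t) * exp (- ((t - T) / G)\<^sup>2)" for t
      have cont_q: "continuous_on {T - H..T + H} q"
        unfolding q_def by (intro continuous_intros)
      \<comment> \<open>On this line the kernel is real; the only non-real factor of the integrand
        is the constant \<open>u\<close> of modulus 1.\<close>
      have integrand: "\<phi> (Complex x t) * (Gamma (Complex x t) * exp (- (\<i> * of_real \<theta>) * Complex x t) * gauss_kernel x T G (Complex x t))
          = u * of_real (f t * q t)" if "t \<in> {T - H..T + H}" for t
      proof -
        have "exp (- (\<i> * of_real \<theta>) * Complex x t) = u * of_real (exp (\<theta> * t))"
          unfolding u_def exp_of_real[symmetric] exp_add[symmetric]
          by (rule arg_cong[where f = exp]) (simp add: complex_eq_iff)
        moreover have "gauss_kernel x T G (Complex x t) = of_real (exp (- ((t - T) / G)\<^sup>2))"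
          using gauss_kernel_Complex[OF G, of x T x t] by simp
        ultimately have "\<phi> (Complex x t) * (Gamma (Complex x t) * exp (- (\<i> * of_real \<theta>) * Complex x t) * gauss_kernel x T G (Complex x t))
          = (Gamma (Complex x t) * \<phi> (Complex x t)) * (u * of_real (q t))"
          by (simp add: q_def)
        then show ?thesis unfolding real[OF that] by simp
      qed
      define I where "I = integral {T - H..T + H} (\<lambda>t. \<bar>f t\<bar> * q t)"
      have "integral {T - H..T + H} (\<lambda>t. \<phi> (Complex x t) * (Gamma (Complex x t) * exp (- (\<i> * of_real \<theta>) * Complex x t) * gauss_kernel x T G (Complex x t)))
        = integral {T - H..T + H} (\<lambda>t. u * of_real (f t * q t))"
        using integrand by (rule integral_cong)
      also have "\<dots> = u * of_real (integral {T - H..T + H} (\<lambda>t. f t * q t))"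
        using integral_linear[OF integrable_continuous_real[OF continuous_on_mult[OF cont_f cont_q]] bounded_linear_of_real[where ?'a = complex]]
        by (simp add: o_def)
      finally have "norm (integral {T - H..T + H} (\<lambda>t. f t * q t)) \<le> K * T powr c"
        using elim(5) unfolding H_def[symmetric] G_def[symmetric] \<theta>_def[symmetric] by (simp add: norm_mult u_def)
      moreover have "I = integral {T - H..T + H} (\<lambda>t. \<sigma> * (f t * q t))"
        unfolding I_def using \<sigma>(2) by (intro integral_cong) simp
      then have "I = \<sigma> * integral {T - H..T + H} (\<lambda>t. f t * q t)" by simp
      then have "I \<le> norm (integral {T - H..T + H} (\<lambda>t. f t * q t))"
        using \<sigma>(1) abs_ge_self[of I] by (simp add: abs_mult)
      ultimately have upper: "I \<le> K * T powr c" by simp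
      have lower: "k * G \<le> B * T powr p * I"
      proof -
        have "k * G \<le> integral {T - H..T + H} (\<lambda>t. norm (\<phi> (Complex x t)) * exp (- ((t - T) / G)\<^sup>2))"
          using elim(4) by (simp add: G_def H_def)
        also have "\<dots> \<le> integral {T - H..T + H} (\<lambda>t. (B * T powr p) * (\<bar>f t\<bar> * q t))"
        proof (rule integral_le)
          fix t assume t: "t \<in> {T - H..T + H}"
          define s where "s = Complex x t"
          have "norm (Gamma s) > 0" using Gamma_nonzero_upper[of s] range[OF t] by (simp add: s_def)
          then have "norm (\<phi> s) = (1 / norm (Gamma s)) * \<bar>f t\<bar>"
            using arg_cong[OF real[OF t], of norm] by (simp add: s_def norm_mult field_simps)
          also have "\<dots> \<le> (B * T powr p * exp (\<theta> * t)) * \<bar>f t\<bar>"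
          proof (rule mult_right_mono)
            have "1 / norm (Gamma s) \<le> C * t powr p * exp (pi * t / 2)"
              using C(3)[of s] range[OF t] r_pos by (simp add: s_def p_def x_def)
            also have "t powr p \<le> 2 powr \<bar>p\<bar> * T powr p"
            proof -
              have tT: "1 / 2 \<le> t / T" "t / T \<le> 2" using range[OF t] T by (auto simp: field_simps)
              have "(t / T) powr p \<le> 2 powr \<bar>p\<bar>"
              proof (cases "p \<ge> 0")
                case True
                have "0 \<le> t / T" using tT(1) by linarith
                then have "(t / T) powr p \<le> 2 powr p" using True tT(2) by (intro powr_mono2)
                then show ?thesis using True by simp
              next
                case False
                then have "(t / T) powr p \<le> (1 / 2) powr p" using tT by (intro powr_mono2') auto
                also have "\<dots> = 2 powr \<bar>p\<bar>" using False by (simp add: powr_divide powr_minus_divide[symmetric])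
                finally show ?thesis .
              qed
              moreover have "t powr p = (t / T) powr p * T powr p"
                using T range[OF t] by (simp add: powr_divide)
              ultimately show ?thesis by (simp add: mult_right_mono)
            qed
            also have "exp (pi * t / 2) \<le> exp 2 * exp (\<theta> * t)"
            proof -
              have "t / T \<le> 2" using range[OF t] T by (simp add: field_simps)
              moreover have "\<theta> * t = pi * t / 2 - t / T"
                by (simp add: \<theta>_def left_diff_distrib)
              ultimately have "pi * t / 2 \<le> 2 + \<theta> * t" by linarith
              then show ?thesis by (simp add: exp_add[symmetric])
            qed
            finally have "1 / norm (Gamma s) \<le> C * (2 powr \<bar>p\<bar> * T powr p) * (exp 2 * exp (\<theta> * t))"
              using C(1) by (simp add: mult_left_mono mult_right_mono)
            then show "1 / norm (Gamma s) \<le> B * T powr p * exp (\<theta> * t)"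
              by (simp add: B_def mult_ac)
          qed simp
          finally have "norm (\<phi> s) * exp (- ((t - T) / G)\<^sup>2) \<le> (B * T powr p * exp (\<theta> * t)) * \<bar>f t\<bar> * exp (- ((t - T) / G)\<^sup>2)"
            by (rule mult_right_mono) simp
          then show "norm (\<phi> (Complex x t)) * exp (- ((t - T) / G)\<^sup>2) \<le> (B * T powr p) * (\<bar>f t\<bar> * q t)"
            by (simp add: s_def q_def mult_ac)
        qed (auto intro!: integrable_continuous_real continuous_intros cont_phi cont_f cont_q)
        also have "\<dots> = B * T powr p * I" by (simp add: I_def)
        finally show ?thesis .
      qed
      have "k * G \<le> B * T powr p * (K * T powr c)"
        using lower upper B by (meson mult_left_mono order.trans mult_nonneg_nonneg less_imp_le powr_ge_zero)
      also have "\<dots> = (B * K) * (T powr p * T powr c)" by (simp add: mult_ac)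
      \<comment> \<open>By the choice of parameters,
        \<open>p + c = \<gamma> - 2 * \<eta>\<close>.\<close>
      also have "T powr p * T powr c = T powr (- 2 * \<eta>) * G"
        unfolding G_def powr_add[symmetric]
        by (rule arg_cong[where f = "\<lambda>y. T powr y"]) (simp add: p_def x_def c_def \<gamma>_def field_simps)
      also have "(B * K) * (T powr (- 2 * \<eta>) * G) = ((B * K) * T powr (- 2 * \<eta>)) * G" by (simp add: mult_ac)
      also have "\<dots> \<le> k / 2 * G" using elim(1) G by (intro mult_right_mono) auto
      finally show False using k(1) G by simp
    qed
    then obtain \<tau> where \<tau>: "\<tau> \<in> {T - H..T + H}" "\<phi> (Complex x \<tau>) = 0" by blast
    have "H \<le> T powr (\<sigma>a + (1 - r) / 2 + \<epsilon>)"
      unfolding H_def exponent using T \<epsilon>' by (intro powr_mono) auto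
    then show ?case using \<tau> by (intro exI[of _ \<tau>]) auto
  qed
  then obtain T1 where T1: "\<And>T. T \<ge> T1 \<Longrightarrow> \<exists>\<tau>. \<phi> (Complex x \<tau>) = 0 \<and> \<bar>\<tau> - T\<bar> \<le> T powr (\<sigma>a + (1 - r) / 2 + \<epsilon>)"
    by (auto simp: eventually_at_top_linorder)
  then show ?thesis
    unfolding x_def by (intro exI[of _ "max T1 1"]) auto
qed

end

section \<open>From the class to the self-dual setting\<close>

text \<open>The two expressions for \<open>X\<close> are given in half-planes far to the right and
  far to the left, which may be disjoint. Above all singularities the half-plane \<open>U\<close> is
  connected and meets both, so the identity theorem extends both expressions to \<open>U\<close>.
  Conjugate coefficients turn the dual series at \<open>w\<close> into the conjugate of \<phi> at
  \<open>cnj w\<close>, and equating the two gives the reflected functional equation.\<close>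

lemma class_A_self_dual:
  fixes r \<sigma>\<^sub>a :: real
  assumes A: "class_A r lam a mu b \<phi> \<psi>"
    and b: "\<And>n. n \<ge> 1 \<Longrightarrow> b n = cnj (a n)"
    and mu: "\<And>n. n \<ge> 1 \<Longrightarrow> lam n = mu n"
    and \<sigma>a: "abs_abscissa lam a = ereal \<sigma>\<^sub>a"
  obtains t0 where "self_dual_dirichlet r \<sigma>\<^sub>a t0 lam a \<phi>"
proof -
  have pair: "hecke_pair r lam a mu b" and cont: "dirichlet_continuation r lam a \<phi>"
    using A by (auto simp: class_A_def)
  have r: "r > 0" and adm: "admissible_exponents lam" and nz: "\<exists>n\<ge>1. a n \<noteq> 0"
    using pair by (auto simp: hecke_pair_def)
  have lam_pos: "lam n > 0" if "n \<ge> 1" for n using adm that by (auto simp: admissible_exponents_def)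
  have mono: "strict_mono_on {1..} lam" using adm by (auto simp: admissible_exponents_def)
  have lim: "filterlim lam at_top sequentially" using adm by (auto simp: admissible_exponents_def)
  have norm_term: "norm (dirichlet_term lam a s (Suc n)) = norm (a (Suc n)) * lam (Suc n) powr (- Re s)" for s n
    using lam_pos[of "Suc n"] by (simp add: dirichlet_term_def norm_mult norm_powr_real_powr)
  have cnj_term: "dirichlet_term mu b s (Suc n) = cnj (dirichlet_term lam a (cnj s) (Suc n))" for s n
    using lam_pos[of "Suc n"] b[of "Suc n"] mu[of "Suc n"]
    by (simp add: dirichlet_term_def cnj_powr)
  have "norm (dirichlet_term mu b s (Suc n)) = norm (dirichlet_term lam a s (Suc n))" for s n
    unfolding cnj_term complex_mod_cnj norm_term by simp
  then have abs_b: "abs_abscissa mu b = ereal \<sigma>\<^sub>a"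
    using \<sigma>a by (simp add: abs_abscissa_def)
  have summ: "summable (\<lambda>n. norm (a (Suc n)) * lam (Suc n) powr (- c))" if c: "c > \<sigma>\<^sub>a" for c
  proof -
    have "(INF s\<in>{s. summable (\<lambda>n. norm (dirichlet_term lam a s (Suc n)))}. ereal (Re s)) < ereal c"
      using \<sigma>a c by (simp add: abs_abscissa_def)
    then obtain s where s: "summable (\<lambda>n. norm (dirichlet_term lam a s (Suc n)))" "Re s < c"
      by (auto simp: INF_less_iff)
    \<comment> \<open>\<open>lam n powr (- c)\<close> is nonincreasing in \<open>c\<close> only
      where \<open>lam n \<ge> 1\<close>; this fails for finitely many \<open>n\<close> at
      most.\<close>
    have "\<forall>\<^sub>F n in sequentially. lam n \<ge> 1" using lim by (auto simp: filterlim_at_top)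
    then have "\<forall>\<^sub>F n in sequentially. lam (Suc n) \<ge> 1" by (rule eventually_compose_filterlim[OF _ filterlim_Suc])
    then have "\<forall>\<^sub>F n in sequentially. norm (norm (a (Suc n)) * lam (Suc n) powr (- c)) \<le> norm (dirichlet_term lam a s (Suc n))"
    proof eventually_elim
      case (elim n)
      then have "lam (Suc n) powr (- c) \<le> lam (Suc n) powr (- Re s)" using s by (intro powr_mono) auto
      then show ?case unfolding norm_term by (simp add: mult_left_mono)
    qed
    then show ?thesis using s(1) by (rule summable_comparison_test_ev)
  qed
  obtain X Kc where X:
    "\<And>s. ereal \<sigma>\<^sub>a < ereal (Re s) \<Longrightarrow> s \<notin> \<int>\<^sub>\<le>\<^sub>0 \<Longrightarrow> X s = Gamma s * dirichlet_sum lam a s"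
    "\<And>s. ereal (Re s) < ereal r - ereal \<sigma>\<^sub>a \<Longrightarrow> of_real r - s \<notin> \<int>\<^sub>\<le>\<^sub>0 \<Longrightarrow>
             X s = Gamma (of_real r - s) * dirichlet_sum mu b (of_real r - s)"
    "\<And>\<sigma>1 \<sigma>2 e. e > 0 \<Longrightarrow> \<exists>B. \<forall>s. \<sigma>1 \<le> Re s \<and> Re s \<le> \<sigma>2 \<and> B \<le> \<bar>Im s\<bar> \<longrightarrow> norm (X s) < e"
    "compact Kc" "X analytic_on (- Kc)"
    using pair unfolding hecke_pair_def \<sigma>a abs_b by blast
  obtain M where M: "\<And>s. s \<in> Kc \<Longrightarrow> norm s \<le> M"
    using compact_imp_bounded[OF X(4)] by (auto simp: bounded_iff)
  \<comment> \<open>\<open>Kc\<close> reaches no higher than \<open>M\<close>; the 1 keeps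
    \<open>U\<close> in the range of the Gamma estimates and off the real axis.\<close>
  define t0 where "t0 = max M 1"
  define U where "U = {s. Im s > t0}"
  have t0: "t0 \<ge> 1" by (simp add: t0_def)
  have U: "open U" "convex U" "connected U"
    unfolding U_def by (auto intro: open_halfspace_Im_gt convex_halfspace_Im_gt convex_connected)
  have "s \<notin> Kc" if "s \<in> U" for s
  proof
    assume "s \<in> Kc"
    then have "Im s \<le> M" using M[of s] abs_Im_le_cmod[of s] by linarith
    then show False using that by (simp add: U_def t0_def)
  qed
  then have "U \<subseteq> - Kc" by blast
  then have holX: "X holomorphic_on U"
    using X(5) analytic_imp_holomorphic holomorphic_on_subset by blast
  have phi_hol: "\<phi> holomorphic_on - {of_real r}"
    using cont by (auto simp: dirichlet_continuation_def intro: analytic_imp_holomorphic)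
  have hol_phi: "\<phi> holomorphic_on U"
    by (rule holomorphic_on_subset[OF phi_hol]) (use t0 in \<open>auto simp: U_def\<close>)
  have phi_sum: "\<phi> s = dirichlet_sum lam a s" if "Re s > \<sigma>\<^sub>a" for s
    using cont that \<sigma>a by (auto simp: dirichlet_continuation_def)
  have notU: "s \<notin> \<int>\<^sub>\<le>\<^sub>0" "of_real r - s \<notin> \<int>\<^sub>\<le>\<^sub>0" if "s \<in> U" for s
    using that t0 by (auto simp: U_def complex_eq_iff elim!: nonpos_Ints_cases)
  have eq1: "X s = Gamma s * \<phi> s" if s: "s \<in> U" for s
  proof (rule analytic_continuation_open[where s = "U \<inter> {s. Re s > \<sigma>\<^sub>a}" and s' = U
        and f = X and g = "\<lambda>s. Gamma s * \<phi> s"])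
    show "open (U \<inter> {s. Re s > \<sigma>\<^sub>a})" by (intro open_Int U open_halfspace_Re_gt)
    have "Complex (\<sigma>\<^sub>a + 1) (t0 + 1) \<in> U \<inter> {s. Re s > \<sigma>\<^sub>a}" by (simp add: U_def)
    then show "U \<inter> {s. Re s > \<sigma>\<^sub>a} \<noteq> {}" by blast
    show "(\<lambda>s. Gamma s * \<phi> s) holomorphic_on U"
      using notU by (intro holomorphic_intros hol_phi) auto
    show "X z = Gamma z * \<phi> z" if "z \<in> U \<inter> {s. Re s > \<sigma>\<^sub>a}" for z
      using that X(1)[of z] notU phi_sum[of z] by auto
  qed (use U holX s in auto)
  have dual_sum: "dirichlet_sum mu b w = cnj (\<phi> (cnj w))" if w: "Re w > \<sigma>\<^sub>a" for w
  proof -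
    have "summable (\<lambda>n. norm (dirichlet_term lam a (cnj w) (Suc n)))"
      unfolding norm_term using summ[OF w] by simp
    then have "(\<lambda>n. dirichlet_term lam a (cnj w) (Suc n)) sums \<phi> (cnj w)"
      using phi_sum[of "cnj w"] w by (simp add: dirichlet_sum_def summable_norm_cancel summable_sums)
    then have "(\<lambda>n. dirichlet_term mu b w (Suc n)) sums cnj (\<phi> (cnj w))"
      unfolding cnj_term sums_cnj .
    then show ?thesis by (simp add: dirichlet_sum_def sums_iff)
  qed
  have eq2: "X s = Gamma (of_real r - s) * cnj (\<phi> (cnj (of_real r - s)))" if s: "s \<in> U" for s
  proof (rule analytic_continuation_open[where s = "U \<inter> {s. Re s < r - \<sigma>\<^sub>a}" and s' = U
        and f = X and g = "\<lambda>s. Gamma (of_real r - s) * cnj (\<phi> (cnj (of_real r - s)))"])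
    show "open (U \<inter> {s. Re s < r - \<sigma>\<^sub>a})" by (intro open_Int U open_halfspace_Re_lt)
    have "Complex (r - \<sigma>\<^sub>a - 1) (t0 + 1) \<in> U \<inter> {s. Re s < r - \<sigma>\<^sub>a}" by (simp add: U_def)
    then show "U \<inter> {s. Re s < r - \<sigma>\<^sub>a} \<noteq> {}" by blast
    define V where "V = {s. Im s < - t0}"
    have "cnj ` V \<subseteq> U" by (auto simp: V_def U_def)
    \<comment> \<open>Schwarz reflection: conjugating argument and value gives a holomorphic
      function on the lower half-plane \<open>V\<close>, into which
      \<open>s \<mapsto> of_real r - s\<close> sends \<open>U\<close>.\<close>
    define g where "g = cnj \<circ> \<phi> \<circ> cnj"
    have "g holomorphic_on V" unfolding g_def
      using holomorphic_on_subset[OF hol_phi \<open>cnj ` V \<subseteq> U\<close>]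
      by (rule holomorphic_on_compose_cnj_cnj) (simp add: V_def open_halfspace_Im_lt)
    have "g \<circ> (\<lambda>s. of_real r - s) holomorphic_on U"
    proof (rule holomorphic_on_compose_gen)
      show "(\<lambda>s. of_real r - s) holomorphic_on U" by (intro holomorphic_intros)
      show "g holomorphic_on V" by fact
      show "(\<lambda>s. of_real r - s) ` U \<subseteq> V" by (auto simp: U_def V_def)
    qed
    then have "(\<lambda>s. cnj (\<phi> (cnj (of_real r - s)))) holomorphic_on U" by (simp add: o_def g_def)
    then show "(\<lambda>s. Gamma (of_real r - s) * cnj (\<phi> (cnj (of_real r - s)))) holomorphic_on U"
      using notU by (intro holomorphic_intros) auto
    show "X z = Gamma (of_real r - z) * cnj (\<phi> (cnj (of_real r - z)))" if "z \<in> U \<inter> {s. Re s < r - \<sigma>\<^sub>a}" for z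
      using that X(2)[of z] notU[of z] dual_sum[of "of_real r - z"] by auto
  qed (use U holX s in auto)
  have fun_eq: "Gamma s * \<phi> s = cnj (Gamma (of_real r - cnj s) * \<phi> (of_real r - cnj s))" if "Im s > t0" for s
    using eq1[of s] eq2[of s] that by (simp add: U_def cnj_Gamma)
  have "self_dual_dirichlet r \<sigma>\<^sub>a t0 lam a \<phi>"
  proof
    fix \<sigma>1 \<sigma>2 :: real
    obtain B where B: "\<And>s. \<sigma>1 \<le> Re s \<and> Re s \<le> \<sigma>2 \<and> B \<le> \<bar>Im s\<bar> \<Longrightarrow> norm (X s) < 1"
      using X(3)[of 1 \<sigma>1 \<sigma>2] by auto
    show "\<exists>B. \<forall>s. \<sigma>1 \<le> Re s \<longrightarrow> Re s \<le> \<sigma>2 \<longrightarrow> B \<le> Im s \<longrightarrow> norm (Gamma s * \<phi> s) \<le> 1"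
    proof (intro exI[of _ "max B (t0 + 1)"] allI impI)
      fix s assume s: "\<sigma>1 \<le> Re s" "Re s \<le> \<sigma>2" "max B (t0 + 1) \<le> Im s"
      then have "s \<in> U" "B \<le> \<bar>Im s\<bar>" by (auto simp: U_def)
      then show "norm (Gamma s * \<phi> s) \<le> 1" using B[of s] s eq1[of s] by simp
    qed
  qed (use r lam_pos mono nz summ phi_sum t0 hol_phi fun_eq in \<open>auto simp: U_def\<close>)
  then show ?thesis by (rule that)
qed

theorem corollary4p6:
  fixes r \<sigma>\<^sub>a :: real
    and lam mu :: "nat \<Rightarrow> real"
    and a b :: "nat \<Rightarrow> complex"
    and \<phi> \<psi> :: "complex \<Rightarrow> complex"
  assumes "r > 0"
    and "class_A r lam a mu b \<phi> \<psi>"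
    and "\<And>n. n \<ge> 1 \<Longrightarrow> b n = cnj (a n)"
    and "\<And>n. n \<ge> 1 \<Longrightarrow> lam n = mu n"
    and "abs_abscissa lam a = ereal \<sigma>\<^sub>a"
    and "\<sigma>\<^sub>a < (r + 1) / 2"
  shows "\<forall>\<epsilon>>0. \<exists>T\<^sub>0>0. \<forall>T\<ge>T\<^sub>0. \<exists>\<tau>::real.
           \<phi> (of_real r / 2 + \<i> * of_real \<tau>) = 0 \<and>
           \<bar>\<tau> - T\<bar> \<le> T powr (\<sigma>\<^sub>a + (1 - r) / 2 + \<epsilon>)"
proof (intro allI impI)
  fix \<epsilon> :: real assume "\<epsilon> > 0"
  obtain t0 where "self_dual_dirichlet r \<sigma>\<^sub>a t0 lam a \<phi>"
    using class_A_self_dual[OF assms(2-5)] by blast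
  then interpret self_dual_dirichlet r \<sigma>\<^sub>a t0 lam a \<phi> .
  have "Complex (r / 2) \<tau> = of_real r / 2 + \<i> * of_real \<tau>" for \<tau>
    by (simp add: complex_eq_iff)
  then show "\<exists>T\<^sub>0>0. \<forall>T\<ge>T\<^sub>0. \<exists>\<tau>::real.
           \<phi> (of_real r / 2 + \<i> * of_real \<tau>) = 0 \<and>
           \<bar>\<tau> - T\<bar> \<le> T powr (\<sigma>\<^sub>a + (1 - r) / 2 + \<epsilon>)"
    using zeros_in_short_intervals[OF assms(6) \<open>\<epsilon> > 0\<close>] by simp
qed

end
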